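(* Let $0\le\delta<R\le\infty$ and let $u$ be a solution of $\mathcal{L}u=0$ in the cylinder $A(\delta,R)=(\delta,R)\times\mathbb{S}^1$. Then $u$ has a Laurent series expansion \[ u(r,t)=\sum_{j\in\mathbb{Z}}\big(a_j^+w_j^+(r,t)+a_j^-w_j^-(r,t)\big),\qquad a_j^\pm\in\mathbb{R}, \] converging in $A(\delta,R)$, and there is a constant $C>0$ (depending only on the family $\{w_j^\pm\}$) such that for every $R_0\in(\delta,R)$ \[ |a_j^\pm|\le \frac{C}{R_0^{\mathrm{Re}(\sigma_j^\pm)}}\max_{\theta}|u(R_0,\theta)|\qquad\forall j\in\mathbb{Z}. \]
   Context: Fix $a>0$, $b\in\mathbb{R}\setminus\{0\}$, $\lambda=a+ib$, $\nu\in[0,1)$, an integer $k\ge2$ and $c\in C^k(\mathbb{S}^1,\mathbb{C})$. On $(0,\infty)\times\mathbb{S}^1$ (coordinates $(r,t)$) let $\mathcal{L}u=\lambda u_t-iru_r+i\lambda\nu u-c(t)\bar u$. A basic solution of $\mathcal{L}$ is a nontrivial solution of $\mathcal{L}w=0$ on $(0,\infty)\times\mathbb{S}^1$ of the form $w=r^\sigma\phi(t)+\overline{r^\sigma\psi(t)}$, $\sigma\in\mathbb{C}$, $\phi,\psi$ $2\pi$-periodic, written with $|\phi|>|\psi|$ when $\sigma\notin\mathbb{R}$ and as $r^\sigma f$ ($f$ nowhere zero) when $\sigma\in\mathbb{R}$; $\sigma$ is its exponent and the winding number of $\phi$ (resp. $f$) its winding number. For each $j\in\mathbb{Z}$, $\mathcal{L}$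 has exactly two $\mathbb{R}$-independent basic solutions $w_j^\pm$ with winding number $j$, with exponents $\sigma_j^\pm$, where $\sigma_j^-=\sigma_j^+=:\sigma_j$ if $\sigma_j^+\notin\mathbb{R}$, and $\{\sigma_j^\pm\}$ is the set of all exponents. The family $\{w_j^\pm\}$ is fixed as follows: for $|j|$ large, $w_j^+=r^{\sigma_j}\phi_j+\overline{r^{\sigma_j}\psi_j}$ and $w_j^-=i\big(r^{\sigma_j}\phi_j-\overline{r^{\sigma_j}\psi_j}\big)$ where $\sigma_j=\lambda(j+\nu)+\gamma/j+O(j^{-2})$, $\phi_j=e^{ijt}(1+O(1/j))$, $\psi_j=O(1/j)$ uniformly in $t$ (here $\gamma=\frac1{4a\pi}\int_0^{2\pi}|c|^2$); for the finitely many remaining $j$ they are any fixed choice. *)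

theory Defs
  imports "HOL-Analysis.Analysis"
begin

text \<open>Functions on the circle are represented as 2pi-periodic functions on the reals.\<close>

definition periodic2pi :: "(real \<Rightarrow> 'a) \<Rightarrow> bool" where
  "periodic2pi f \<longleftrightarrow> (\<forall>t. f (t + 2 * pi) = f t)"

definition Ck_circle :: "nat \<Rightarrow> (real \<Rightarrow> complex) \<Rightarrow> bool" where
  "Ck_circle k c \<longleftrightarrow> periodic2pi c \<and>
     (\<exists>D :: nat \<Rightarrow> real \<Rightarrow> complex. D 0 = c \<and>
        (\<forall>i<k. \<forall>t. (D i has_vector_derivative D (Suc i) t) (at t)) \<and>
        continuous_on UNIV (D k))"

definition has_winding :: "(real \<Rightarrow> complex) \<Rightarrow> int \<Rightarrow> bool" where
  "has_winding f j \<longleftrightarrow> continuous_on UNIV f \<and> (\<forall>t. f t \<noteq> 0) \<and>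
     (\<exists>\<theta> :: real \<Rightarrow> real. continuous_on UNIV \<theta> \<and>
        (\<forall>t. f t = of_real (norm (f t)) * exp (\<i> * of_real (\<theta> t))) \<and>
        (\<forall>t. \<theta> (t + 2 * pi) - \<theta> t = 2 * pi * of_int j))"

definition cyl :: "real \<Rightarrow> ereal \<Rightarrow> (real \<times> real) set" where
  "cyl \<delta> R = {(r, t). \<delta> < r \<and> ereal r < R}"

definition L_solution ::
  "complex \<Rightarrow> real \<Rightarrow> (real \<Rightarrow> complex) \<Rightarrow> real \<Rightarrow> ereal \<Rightarrow> (real \<Rightarrow> real \<Rightarrow> complex) \<Rightarrow> bool" where
  "L_solution lam nu c \<delta> R u \<longleftrightarrow>
     (\<forall>r t. (r, t) \<in> cyl \<delta> R \<longrightarrow> u r (t + 2 * pi) = u r t) \<and>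
     (\<exists>ur ut :: real \<Rightarrow> real \<Rightarrow> complex.
        continuous_on (cyl \<delta> R) (\<lambda>(r, t). u r t) \<and>
        continuous_on (cyl \<delta> R) (\<lambda>(r, t). ur r t) \<and>
        continuous_on (cyl \<delta> R) (\<lambda>(r, t). ut r t) \<and>
        (\<forall>r t. (r, t) \<in> cyl \<delta> R \<longrightarrow>
           ((\<lambda>\<rho>. u \<rho> t) has_vector_derivative ur r t) (at r) \<and>
           ((\<lambda>s. u r s) has_vector_derivative ut r t) (at t) \<and>
           lam * ut r t - \<i> * of_real r * ur r t + \<i> * lam * of_real nu * u r t
             - c t * cnj (u r t) = 0))"

definition basic_solution ::
  "complex \<Rightarrow> real \<Rightarrow> (real \<Rightarrow> complex) \<Rightarrow> (real \<Rightarrow> real \<Rightarrow> complex) \<Rightarrow> complex \<Rightarrow> int \<Rightarrow> bool" where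
  "basic_solution lam nu c w \<sigma> j \<longleftrightarrow>
     L_solution lam nu c 0 PInfty w \<and> (\<exists>r t. 0 < r \<and> w r t \<noteq> 0) \<and>
     (if \<sigma> \<in> \<real> then
        (\<exists>f. periodic2pi f \<and> has_winding f j \<and>
           (\<forall>r t. 0 < r \<longrightarrow> w r t = of_real (r powr Re \<sigma>) * f t))
      else
        (\<exists>\<phi> \<psi>. periodic2pi \<phi> \<and> periodic2pi \<psi> \<and> has_winding \<phi> j \<and>
           (\<forall>t. norm (\<psi> t) < norm (\<phi> t)) \<and>
           (\<forall>r t. 0 < r \<longrightarrow>
              w r t = (of_real r) powr \<sigma> * \<phi> t + cnj ((of_real r) powr \<sigma> * \<psi> t))))"

text \<open>The standing hypotheses on the fixed family {w_j^+, w_j^-} (True = +, False = -),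
  with exponents sigma_j^+-, and the normalisation for large |j|.\<close>
definition basic_family ::
  "complex \<Rightarrow> real \<Rightarrow> (real \<Rightarrow> complex) \<Rightarrow> (int \<Rightarrow> bool \<Rightarrow> real \<Rightarrow> real \<Rightarrow> complex)
   \<Rightarrow> (int \<Rightarrow> bool \<Rightarrow> complex) \<Rightarrow> bool" where
  "basic_family lam nu c w \<sigma> \<longleftrightarrow>
     (\<forall>j s. basic_solution lam nu c (w j s) (\<sigma> j s) j) \<and>
     (\<forall>j. \<forall>x y :: real. (\<forall>r t. 0 < r \<longrightarrow> of_real x * w j True r t + of_real y * w j False r t = 0)
            \<longrightarrow> x = 0 \<and> y = 0) \<and>
     (\<forall>j. \<sigma> j True \<notin> \<real> \<longrightarrow> \<sigma> j False = \<sigma> j True) \<and>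
     (let \<gamma> = integral {0..2*pi} (\<lambda>t. (norm (c t))\<^sup>2) / (4 * Re lam * pi) in
      \<exists>N M :: real. \<exists>\<phi> \<psi> :: int \<Rightarrow> real \<Rightarrow> complex.
        \<forall>j. N \<le> \<bar>real_of_int j\<bar> \<longrightarrow>
          \<sigma> j False = \<sigma> j True \<and>
          norm (\<sigma> j True - (lam * of_real (of_int j + nu) + of_real (\<gamma> / of_int j)))
             \<le> M / (of_int j)\<^sup>2 \<and>
          (\<forall>t. norm (\<phi> j t - exp (\<i> * of_int j * of_real t)) \<le> M / \<bar>of_int j\<bar>) \<and>
          (\<forall>t. norm (\<psi> j t) \<le> M / \<bar>of_int j\<bar>) \<and>
          periodic2pi (\<phi> j) \<and> periodic2pi (\<psi> j) \<and>
          (\<forall>r t. 0 < r \<longrightarrow>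
             w j True r t = (of_real r) powr (\<sigma> j True) * \<phi> j t
                            + cnj ((of_real r) powr (\<sigma> j True) * \<psi> j t) \<and>
             w j False r t = \<i> * ((of_real r) powr (\<sigma> j True) * \<phi> j t
                            - cnj ((of_real r) powr (\<sigma> j True) * \<psi> j t))))"

end

theory Submission
  imports Defs
begin

text \<open>
  With \<open>P g = - i \<lambda> g' + \<lambda> \<nu> g + i c (cnj g)\<close> the equation reads \<open>r u\<^sub>r = P u\<close>, and a basic
  solution is the orbit of an eigenvector of the real-linear operator \<open>P\<close> on the circle.

  Exponents: \<open>P\<close> satisfies a Wronskian identity. Integrated over a period it shows that a nonreal exponent
  carries only one complex line of eigenvectors, and that basic solutions with different winding numbers never
  have equal or conjugate exponents.

  Completeness: for large \<open>|j|\<close> the pairs \<open>w\<^sub>j\<close> are within \<open>O(1/j)\<close> of the Fourier modes in the sup norm, so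
  by Bessel's inequality replacing the high modes by them is an invertible perturbation of the identity on
  continuous periodic functions. The remaining finitely many pairs fill the finite codimension exactly, provided
  that they are independent modulo the closed span of the others. This follows from the maximum principle
  \<open>|g| \<le> |(P - \<mu>) g|\<close> for a large real \<open>\<mu>\<close>: quadratic polynomials in the inverse of \<open>P - \<mu>\<close> are bounded on the span
  of the \<open>w\<^sub>j\<close> and kill any chosen finite set of pairs while being injective on the others.

  Expansion: one obtains uniformly bounded biorthogonal functionals that separate points and intertwine \<open>P\<close>
  with its action on each pair. Along a solution they evolve like \<open>r\<^bsup>\<sigma>\<^esup>\<close>, which gives the coefficient bound, hence
  geometric convergence, and the sum has the same functionals as the solution.
\<close>

section \<open>Systems quadratically close to an orthonormal one\<close>

text \<open>The term with \<open>cnj\<close> makes \<open>P\<close> only real linear, and no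
  orthogonal eigenbasis is at hand. So a block is a real plane with a complex coordinate, and the
  coefficient functionals have to be manufactured. Winding numbers do the counting: there is one
  block for each \<open>j\<close>, hence as many low blocks as low Fourier modes, and injectivity of
  a finite linear system already gives its solvability. The low blocks are arbitrary: their
  exponents may be real, equal or distinct, and no estimate compares them with modes. This is why
  their independence of the closed span of the others is obtained algebraically, with boundedness of
  one operator as the only analytic input. The sup norm is used throughout: the maximum principle
  and the values of the series live there, and Bessel's inequality survives because the sup norm
  dominates the normalised mean square norm. The hypotheses on \<lambda> have different tasks:
  \<open>Im lam \<noteq> 0\<close> gives the maximum principle and nonreal high exponents,
  \<open>0 < Re lam\<close> gives the energy identity of the Wronskian and the geometric
  decay.\<close>

text \<open>On the block \<open>j\<close> the map \<open>\<delta> j\<close> represents a bounded operator that leaves every block invariant, and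
  \<open>p j\<close>, \<open>m j\<close> are its trace and determinant there. It is only given on the span of the blocks, so that in the
  application no resolvent has to be constructed.\<close>

locale perturbed_expansion =
  fixes S :: "'v::banach set" and E G :: "'i \<Rightarrow> complex \<Rightarrow> 'v" and fc :: "'i \<Rightarrow> 'v \<Rightarrow> complex"
    and \<delta> :: "'i \<Rightarrow> complex \<Rightarrow> complex" and p m :: "'i \<Rightarrow> real" and \<eta> :: "'i \<Rightarrow> real" and C :: real
  assumes subspace_S: "subspace S" and closed_S: "closed S"
    and linear_E: "linear (E j)" and linear_G: "linear (G j)"
    and E_in: "E j z \<in> S" and G_in: "G j z \<in> S"
    and bl_fc: "bounded_linear (fc j)"
    and fc_E: "fc i (E j z) = (if i = j then z else 0)"
    and norm_E: "norm (E j z) \<le> norm z"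
    and bessel: "finite A \<Longrightarrow> (\<Sum>j\<in>A. (norm (fc j v))\<^sup>2) \<le> (norm v)\<^sup>2"
    and dense_E: "v \<in> S \<Longrightarrow> 0 < \<epsilon> \<Longrightarrow> \<exists>A y. finite A \<and> norm (v - (\<Sum>j\<in>A. E j (y j))) < \<epsilon>"
    and total_fc: "v \<in> S \<Longrightarrow> (\<And>j. fc j v = 0) \<Longrightarrow> v = 0"
    and close: "norm (G j z - E j z) \<le> \<eta> j * norm z"
    and eta_nonneg: "0 \<le> \<eta> j"
    and eta_summable: "(\<lambda>j. (\<eta> j)\<^sup>2) summable_on UNIV"
    and linear_delta: "linear (\<delta> j)"
    and apriori: "finite A \<Longrightarrow> norm (\<Sum>j\<in>A. G j (\<delta> j (y j))) \<le> C * norm (\<Sum>j\<in>A. G j (y j))"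
    and C_nonneg: "0 \<le> C"
    and annihilate: "\<delta> j (\<delta> j z) - p j *\<^sub>R \<delta> j z + m j *\<^sub>R z = 0"
    and separate: "i \<noteq> j \<Longrightarrow> \<delta> i (\<delta> i z) - p j *\<^sub>R \<delta> i z + m j *\<^sub>R z = 0 \<Longrightarrow> z = 0"
    and inj_G: "G j z = 0 \<Longrightarrow> z = 0"
begin

lemma linear_fc: "linear (fc j)"
  by (rule bounded_linear.linear[OF bl_fc])

text \<open>Cauchy criterion. The bound \<open>1/4\<close> is the square of the operator bound
  \<open>1/2\<close> wanted for \<open>pert\<close>.\<close>

lemma tail_small:
  "\<exists>F. finite F \<and> (\<forall>A. finite A \<and> A \<inter> F = {} \<longrightarrow> (\<Sum>j\<in>A. (\<eta> j)\<^sup>2) \<le> 1/4)"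
proof -
  obtain s where s: "((\<lambda>j. (\<eta> j)\<^sup>2) has_sum s) UNIV"
    using eta_summable by (auto simp: summable_on_def)
  then have "\<forall>\<^sub>F X in finite_subsets_at_top UNIV. dist (\<Sum>j\<in>X. (\<eta> j)\<^sup>2) s < 1/8"
    unfolding has_sum_def by (rule tendstoD) simp
  then obtain F where F: "finite F" "\<And>Y. finite Y \<Longrightarrow> F \<subseteq> Y \<Longrightarrow> dist (\<Sum>j\<in>Y. (\<eta> j)\<^sup>2) s < 1/8"
    unfolding eventually_finite_subsets_at_top by auto
  show ?thesis
  proof (intro exI conjI allI impI)
    show "finite F" by fact
    fix A assume "finite A \<and> A \<inter> F = {}"
    then have A: "finite A" "A \<inter> F = {}" by auto
    have "(\<Sum>j\<in>A \<union> F. (\<eta> j)\<^sup>2) = (\<Sum>j\<in>A. (\<eta> j)\<^sup>2) + (\<Sum>j\<in>F. (\<eta> j)\<^sup>2)"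
      using A F by (intro sum.union_disjoint) auto
    moreover have "\<bar>(\<Sum>j\<in>F. (\<eta> j)\<^sup>2) - s\<bar> < 1/8" "\<bar>(\<Sum>j\<in>A \<union> F. (\<eta> j)\<^sup>2) - s\<bar> < 1/8"
      using F(2)[of F] F(2)[of "A \<union> F"] A F(1) by (auto simp: dist_real_def)
    ultimately show "(\<Sum>j\<in>A. (\<eta> j)\<^sup>2) \<le> 1/4"
      by linarith
  qed
qed

section \<open>Finite combinations of blocks and annihilating polynomials\<close>

definition comb :: "'i set \<Rightarrow> ('i \<Rightarrow> complex) \<Rightarrow> 'v" where
  "comb A z = (\<Sum>j\<in>A. G j (z j))"

lemma comb_in: "comb A z \<in> S"
  unfolding comb_def by (intro subspace_sum subspace_S G_in)

lemma comb_add: "comb A (\<lambda>j. y j + z j) = comb A y + comb A z"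
  unfolding comb_def by (simp add: linear_add[OF linear_G] sum.distrib)

lemma comb_diff: "comb A (\<lambda>j. y j - z j) = comb A y - comb A z"
  unfolding comb_def by (simp add: linear_diff[OF linear_G] sum_subtractf)

lemma comb_scaleR: "comb A (\<lambda>j. c *\<^sub>R z j) = c *\<^sub>R comb A z"
  unfolding comb_def by (simp add: linear_scale[OF linear_G] scaleR_sum_right)

lemma comb_subset:
  assumes "finite B" "A \<subseteq> B" "\<And>j. j \<in> B - A \<Longrightarrow> z j = 0"
  shows "comb B z = comb A z"
  unfolding comb_def using assms
  by (intro sum.mono_neutral_right) (auto simp: linear_0[OF linear_G])

text \<open>The characteristic polynomial of \<open>\<delta>\<close> on block \<open>j\<close>,
  evaluated on block \<open>i\<close>: zero for \<open>i = j\<close> by \<open>annihilate\<close>,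
  injective for \<open>i \<noteq> j\<close> by \<open>separate\<close>.\<close>

definition quad :: "'i \<Rightarrow> 'i \<Rightarrow> complex \<Rightarrow> complex" where
  "quad j i z = \<delta> i (\<delta> i z) - p j *\<^sub>R \<delta> i z + m j *\<^sub>R z"

fun quads :: "'i list \<Rightarrow> 'i \<Rightarrow> complex \<Rightarrow> complex" where
  "quads [] i z = z"
| "quads (j # js) i z = quad j i (quads js i z)"

lemma linear_quad: "linear (quad j i)"
  unfolding quad_def[abs_def]
  using linear_compose[OF linear_delta linear_delta, of i i, unfolded o_def]
  by (intro linear_compose_add linear_compose_sub linear_compose_scale_right linear_delta linear_ident)

lemma linear_quads: "linear (quads js i)"
proof (induction js)
  case Nil
  then show ?case by (simp add: linear_ident)
next
  case (Cons j js)
  then show ?case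
    using linear_compose[OF Cons linear_quad] by (simp add: o_def)
qed

lemma quads_mem: "i \<in> set js \<Longrightarrow> quads js i z = 0"
proof (induction js)
  case (Cons j js)
  show ?case
  proof (cases "i = j")
    case True
    then show ?thesis using annihilate by (simp add: quad_def)
  next
    case False
    with Cons show ?thesis by (simp add: linear_0[OF linear_quad])
  qed
qed simp

lemma quads_not_mem: "i \<notin> set js \<Longrightarrow> quads js i z = 0 \<Longrightarrow> z = 0"
proof (induction js)
  case (Cons j js)
  then have "quads js i z = 0"
    using separate[of i j "quads js i z"] by (simp add: quad_def)
  with Cons show ?case by simp
qed auto

lemma comb_quad_bound:
  assumes "finite A"
  shows "norm (comb A (\<lambda>i. quad j i (z i))) \<le> (C * C + \<bar>p j\<bar> * C + \<bar>m j\<bar>) * norm (comb A z)"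
proof -
  have 1: "norm (comb A (\<lambda>i. \<delta> i (z i))) \<le> C * norm (comb A z)" for z
    using apriori[OF assms] by (simp add: comb_def)
  have 2: "norm (comb A (\<lambda>i. \<delta> i (\<delta> i (z i)))) \<le> C * (C * norm (comb A z))"
    using 1[of "\<lambda>i. \<delta> i (z i)"] mult_left_mono[OF 1[of z] C_nonneg] by linarith
  have "comb A (\<lambda>i. quad j i (z i)) = comb A (\<lambda>i. \<delta> i (\<delta> i (z i)))
      - p j *\<^sub>R comb A (\<lambda>i. \<delta> i (z i)) + m j *\<^sub>R comb A z"
    unfolding quad_def by (simp add: comb_add comb_diff comb_scaleR)
  also have "norm \<dots> \<le> norm (comb A (\<lambda>i. \<delta> i (\<delta> i (z i))))
      + \<bar>p j\<bar> * norm (comb A (\<lambda>i. \<delta> i (z i))) + \<bar>m j\<bar> * norm (comb A z)"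
    by (rule order_trans[OF norm_triangle_ineq add_mono[OF order_trans[OF norm_triangle_ineq4]]]) auto
  also have "\<dots> \<le> C * (C * norm (comb A z)) + \<bar>p j\<bar> * (C * norm (comb A z)) + \<bar>m j\<bar> * norm (comb A z)"
    using 1[of z] 2 by (intro add_mono mult_left_mono) auto
  finally show ?thesis by (simp add: algebra_simps)
qed

text \<open>A polynomial in a bounded operator is bounded. What matters is that \<open>B\<close>
  depends neither on \<open>A\<close> nor on \<open>z\<close>, so that the estimate survives limits
  of combinations over varying index sets.\<close>

lemma comb_quads_bound:
  "\<exists>B. \<forall>A z. finite A \<longrightarrow> norm (comb A (\<lambda>i. quads js i (z i))) \<le> B * norm (comb A z)"
proof (induction js)
  case Nil
  then show ?case by (intro exI[of _ 1]) auto
next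
  case (Cons j js)
  then obtain B where B: "\<And>A z. finite A \<Longrightarrow> norm (comb A (\<lambda>i. quads js i (z i))) \<le> B * norm (comb A z)"
    by auto
  let ?D = "C * C + \<bar>p j\<bar> * C + \<bar>m j\<bar>"
  have D: "0 \<le> ?D" using C_nonneg by auto
  have "norm (comb A (\<lambda>i. quads (j # js) i (z i))) \<le> (?D * B) * norm (comb A z)" if "finite A" for A z
    using comb_quad_bound[OF that, of j "\<lambda>i. quads js i (z i)"]
      mult_left_mono[OF B[OF that, of z] D] by (simp add: mult.assoc)
  then show ?case by blast
qed

text \<open>The polynomial belonging to \<open>A - {j}\<close> removes all blocks but
  \<open>j\<close> from the vanishing combination, the bound keeps the result zero, and on block
  \<open>j\<close> the polynomial is injective.\<close>

lemma comb_independent: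
  assumes "finite A" "comb A z = 0" "j \<in> A"
  shows "z j = 0"
proof -
  obtain js where js: "set js = A - {j}"
    using assms(1) finite_list by (metis finite_Diff)
  obtain B where "norm (comb A (\<lambda>i. quads js i (z i))) \<le> B * norm (comb A z)"
    using comb_quads_bound assms(1) by blast
  then have "comb A (\<lambda>i. quads js i (z i)) = 0"
    using assms(2) by simp
  moreover have "comb A (\<lambda>i. quads js i (z i)) = comb {j} (\<lambda>i. quads js i (z i))"
    using assms js by (intro comb_subset) (auto intro: quads_mem)
  ultimately have "quads js j (z j) = 0"
    using inj_G by (simp add: comb_def)
  then show ?thesis using quads_not_mem js by auto
qed

section \<open>Replacement of the high modes by the high blocks\<close>

context
  fixes F
  assumes finite_F: "finite F"
    and small_F: "\<forall>A. finite A \<and> A \<inter> F = {} \<longrightarrow> (\<Sum>j\<in>A. (\<eta> j)\<^sup>2) \<le> 1/4"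
begin

text \<open>The map \<open>v \<mapsto> v + pert v\<close> sends the mode \<open>E j z\<close> to
  \<open>G j z\<close> for \<open>j \<notin> F\<close> and fixes it for
  \<open>j \<in> F\<close>.\<close>

definition pert :: "'v \<Rightarrow> 'v" where
  "pert v = infsum (\<lambda>j. G j (fc j v) - E j (fc j v)) (- F)"

text \<open>Cauchy-Schwarz: off \<open>F\<close> the closeness constants have square sum at most
  \<open>1/4\<close>, and the coefficients have square sum at most \<open>(norm v)\<^sup>2\<close>
  by Bessel.\<close>

lemma pert_sums:
  assumes "finite A" "A \<subseteq> - F"
  shows "(\<Sum>j\<in>A. norm (G j (fc j v) - E j (fc j v))) \<le> norm v / 2"
proof -
  have "(\<Sum>j\<in>A. norm (G j (fc j v) - E j (fc j v))) \<le> (\<Sum>j\<in>A. \<bar>\<eta> j\<bar> * \<bar>norm (fc j v)\<bar>)"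
    using close eta_nonneg by (intro sum_mono) auto
  also have "\<dots> \<le> L2_set \<eta> A * L2_set (\<lambda>j. norm (fc j v)) A"
    by (rule L2_set_mult_ineq)
  also have "\<dots> \<le> (1/2) * norm v"
  proof (intro mult_mono)
    show "L2_set \<eta> A \<le> 1/2"
      unfolding L2_set_def using small_F[THEN spec, of A] assms
      by (intro real_le_lsqrt) (auto intro: sum_nonneg simp: power2_eq_square)
    show "L2_set (\<lambda>j. norm (fc j v)) A \<le> norm v"
      unfolding L2_set_def using bessel[OF assms(1)]
      by (intro real_le_lsqrt) (auto intro: sum_nonneg)
  qed auto
  finally show ?thesis by simp
qed

lemma pert_abs_summable: "(\<lambda>j. G j (fc j v) - E j (fc j v)) abs_summable_on (- F)"
  unfolding abs_summable_iff_bdd_above by (rule bdd_aboveI[of _ "norm v / 2"]) (use pert_sums in auto)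

lemma pert_has_sum: "((\<lambda>j. G j (fc j v) - E j (fc j v)) has_sum pert v) (- F)"
  unfolding pert_def by (rule has_sum_infsum[OF abs_summable_summable[OF pert_abs_summable]])

lemma norm_pert: "norm (pert v) \<le> norm v / 2"
proof -
  have "norm (pert v) \<le> (\<Sum>\<^sub>\<infinity>j\<in>-F. norm (G j (fc j v) - E j (fc j v)))"
    unfolding pert_def by (rule norm_infsum_bound) (rule pert_abs_summable)
  also have "\<dots> \<le> norm v / 2"
    by (rule infsum_le_finite_sums) (use pert_abs_summable pert_sums in auto)
  finally show ?thesis .
qed

lemma linear_pert: "linear pert"
proof (rule linearI)
  fix v w :: 'v and c :: real
  have 1: "G j (fc j (v + w)) - E j (fc j (v + w))
      = (G j (fc j v) - E j (fc j v)) + (G j (fc j w) - E j (fc j w))" for j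
    by (simp add: linear_add[OF linear_G] linear_add[OF linear_E] linear_add[OF linear_fc])
  have "((\<lambda>j. G j (fc j (v + w)) - E j (fc j (v + w))) has_sum (pert v + pert w)) (- F)"
    unfolding 1 by (intro has_sum_add pert_has_sum)
  with pert_has_sum show "pert (v + w) = pert v + pert w"
    by (rule has_sum_unique)
  have 2: "G j (fc j (c *\<^sub>R v)) - E j (fc j (c *\<^sub>R v)) = c *\<^sub>R (G j (fc j v) - E j (fc j v))" for j
    by (simp add: linear_scale[OF linear_G] linear_scale[OF linear_E] linear_scale[OF linear_fc]
        scaleR_diff_right)
  have "((\<lambda>j. G j (fc j (c *\<^sub>R v)) - E j (fc j (c *\<^sub>R v))) has_sum (c *\<^sub>R pert v)) (- F)"
    unfolding 2 using has_sum_bounded_linear[OF bounded_linear_scaleR_right pert_has_sum]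
    by (simp add: o_def)
  with pert_has_sum show "pert (c *\<^sub>R v) = c *\<^sub>R pert v"
    by (rule has_sum_unique)
qed

lemma pert_in: "pert v \<in> S"
proof -
  have "((\<lambda>A. \<Sum>j\<in>A. G j (fc j v) - E j (fc j v)) \<longlongrightarrow> pert v) (finite_subsets_at_top (- F))"
    using pert_has_sum by (simp add: has_sum_def)
  moreover have "(\<Sum>j\<in>A. G j (fc j v) - E j (fc j v)) \<in> S" for A
    by (intro subspace_sum subspace_diff subspace_S G_in E_in)
  ultimately show ?thesis
    by (intro Lim_in_closed_set[OF closed_S]) auto
qed

lemma pert_E: "pert (E j z) = (if j \<in> F then 0 else G j z - E j z)"
proof -
  have 0: "G i (fc i (E j z)) - E i (fc i (E j z)) = 0" if "i \<noteq> j" for i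
    using that by (simp add: fc_E linear_0[OF linear_G] linear_0[OF linear_E])
  show ?thesis
  proof (cases "j \<in> F")
    case True
    then have "pert (E j z) = infsum (\<lambda>_. 0) (- F)"
      unfolding pert_def by (intro infsum_cong 0) auto
    with True show ?thesis by simp
  next
    case False
    then have "pert (E j z) = infsum (\<lambda>i. G i (fc i (E j z)) - E i (fc i (E j z))) {j}"
      unfolding pert_def by (intro infsum_cong_neutral)
        (auto simp: fc_E linear_0[OF linear_G] linear_0[OF linear_E])
    with False show ?thesis by (simp add: fc_E)
  qed
qed

text \<open>The solution is the fixed point of \<open>h \<mapsto> g - pert h\<close>, a contraction
  with factor \<open>1/2\<close> by \<open>norm_pert\<close>.\<close>

lemma ex1_inverse: "\<exists>!h. h + pert h = g"
proof -
  have "\<exists>!h. g - pert h = h"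
  proof (rule banach_fix_type[of "1/2"])
    show "\<forall>x y. dist (g - pert x) (g - pert y) \<le> 1/2 * dist x y"
    proof (intro allI)
      fix x y
      have "(g - pert x) - (g - pert y) = - pert (x - y)"
        by (simp add: linear_diff[OF linear_pert])
      then show "dist (g - pert x) (g - pert y) \<le> 1/2 * dist x y"
        using norm_pert[of "x - y"] by (simp add: dist_norm)
    qed
  qed auto
  moreover have "g - pert h = h \<longleftrightarrow> h + pert h = g" for h by (auto simp: algebra_simps)
  ultimately show ?thesis by simp
qed

definition inv_pert :: "'v \<Rightarrow> 'v" where "inv_pert g = (THE h. h + pert h = g)"

lemma inv_pert_eq: "inv_pert g + pert (inv_pert g) = g"
  unfolding inv_pert_def using theI'[OF ex1_inverse] .

lemma inv_pert_unique: "h + pert h = g \<Longrightarrow> inv_pert g = h"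
  using inv_pert_eq ex1_inverse by blast

lemma linear_inv_pert: "linear inv_pert"
proof (rule linearI)
  fix v w :: 'v and c :: real
  have "inv_pert v + inv_pert w + pert (inv_pert v + inv_pert w) = (inv_pert v + pert (inv_pert v)) + (inv_pert w + pert (inv_pert w))"
    by (simp add: linear_add[OF linear_pert])
  then show "inv_pert (v + w) = inv_pert v + inv_pert w"
    by (intro inv_pert_unique) (simp add: inv_pert_eq)
  show "inv_pert (c *\<^sub>R v) = c *\<^sub>R inv_pert v"
    by (intro inv_pert_unique) (metis inv_pert_eq linear_pert linear_scale scaleR_add_right)
qed

lemma norm_inv_pert: "norm (inv_pert g) \<le> 2 * norm g"
proof -
  have "norm (inv_pert g) = norm (g - pert (inv_pert g))" by (metis inv_pert_eq add_diff_cancel_right')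
  also have "\<dots> \<le> norm g + norm (inv_pert g) / 2" using norm_triangle_ineq4 norm_pert by (smt (verit))
  finally show ?thesis by simp
qed

lemma inv_pert_in: "g \<in> S \<Longrightarrow> inv_pert g \<in> S"
  by (metis pert_in inv_pert_eq add_diff_cancel_right' subspace_S subspace_diff)

lemma inv_pert_G: "j \<notin> F \<Longrightarrow> inv_pert (G j z) = E j z"
  by (intro inv_pert_unique) (simp add: pert_E)

text \<open>Coordinates in the hybrid system that consists of \<open>E j\<close> for
  \<open>j \<in> F\<close> and \<open>G j\<close> for \<open>j \<notin> F\<close>.\<close>

definition pcoef :: "'i \<Rightarrow> 'v \<Rightarrow> complex" where "pcoef j v = fc j (inv_pert v)"

lemma linear_pcoef: "linear (pcoef j)"
  using linear_compose[OF linear_inv_pert bounded_linear.linear[OF bl_fc]] by (simp add: o_def pcoef_def[abs_def])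

lemma norm_fc: "norm (fc j v) \<le> norm v"
  using bessel[of "{j}" v] by (simp add: power_mono_iff)

lemma norm_pcoef: "norm (pcoef j v) \<le> 2 * norm v"
  unfolding pcoef_def using norm_fc norm_inv_pert order_trans by blast

lemma bounded_linear_pcoef: "bounded_linear (pcoef j)"
  using norm_pcoef by (intro bounded_linear_intro[where K = 2])
     (auto simp: linear_add[OF linear_pcoef] linear_scale[OF linear_pcoef] mult.commute[of _ 2])

lemma pcoef_G: "j \<notin> F \<Longrightarrow> pcoef i (G j z) = (if i = j then z else 0)"
  by (simp add: pcoef_def inv_pert_G fc_E)

lemma pcoef_total: "v \<in> S \<Longrightarrow> (\<And>j. pcoef j v = 0) \<Longrightarrow> v = 0"
  unfolding pcoef_def using total_fc[OF inv_pert_in] inv_pert_eq by (metis add.right_neutral linear_0 linear_pert)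

text \<open>Approximate \<open>inv_pert v\<close> by modes. Its low coefficients vanish, so those of
  the approximation are pure error and may be dropped; applying
  \<open>v \<mapsto> v + pert v\<close> then turns the remaining modes into high blocks.\<close>

lemma approx_high:
  assumes v: "v \<in> S" "\<And>i. i \<in> F \<Longrightarrow> pcoef i v = 0" and \<epsilon>: "0 < \<epsilon>"
  shows "\<exists>A z. finite A \<and> A \<inter> F = {} \<and> norm (v - comb A z) < \<epsilon>"
proof -
  \<comment> \<open>Dropping the low modes costs at most \<open>card F\<close> times the error,
    which with the error itself makes the factor \<open>n\<close>. The map
    \<open>v \<mapsto> v + pert v\<close> costs another \<open>3/2\<close>, so the total stays below
    \<open>3/4 * \<epsilon>\<close>.\<close>
  define n where "n = real (card F) + 1"
  have n: "n \<ge> 1" by (simp add: n_def)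
  obtain A z where A: "finite A" and Az: "norm (inv_pert v - (\<Sum>j\<in>A. E j (z j))) < \<epsilon> / (2 * n)"
    using dense_E[OF inv_pert_in[OF v(1)], of "\<epsilon> / (2 * n)"] \<epsilon> n by auto
  let ?h = "\<Sum>j\<in>A. E j (z j)"
  let ?l = "\<Sum>i\<in>F \<inter> A. E i (z i)"
  have "fc i ?h = z i" if "i \<in> A" for i
    using that A by (simp add: linear_sum[OF linear_fc] fc_E sum.delta')
  then have fcd: "fc i (inv_pert v - ?h) = - z i" if "i \<in> F \<inter> A" for i
    using that v(2) by (simp add: linear_diff[OF linear_fc] pcoef_def)
  have "norm ?l \<le> (\<Sum>i\<in>F \<inter> A. norm (E i (z i)))" by (rule norm_sum)
  also have "\<dots> \<le> (\<Sum>i\<in>F \<inter> A. norm (inv_pert v - ?h))"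
  proof (rule sum_mono)
    fix i assume "i \<in> F \<inter> A"
    then have "norm (z i) \<le> norm (inv_pert v - ?h)"
      using fcd[of i] norm_fc[of i "inv_pert v - ?h"] by simp
    then show "norm (E i (z i)) \<le> norm (inv_pert v - ?h)"
      using norm_E[of i "z i"] by simp
  qed
  also have "\<dots> \<le> real (card F) * norm (inv_pert v - ?h)"
    using finite_F by (auto intro!: mult_right_mono card_mono)
  finally have l: "norm ?l \<le> real (card F) * norm (inv_pert v - ?h)" .
  have split: "?h = ?l + (\<Sum>j\<in>A - F. E j (z j))"
    using A by (subst sum.Int_Diff[of A _ F]) (auto simp: Int_commute)
  let ?h' = "\<Sum>j\<in>A - F. E j (z j)"
  have "norm (inv_pert v - ?h') \<le> norm (inv_pert v - ?h) + norm ?l"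
    using norm_triangle_ineq[of "inv_pert v - ?h" ?l] split by simp
  also have "\<dots> \<le> n * norm (inv_pert v - ?h)" using l by (simp add: n_def algebra_simps)
  also have "\<dots> < n * (\<epsilon> / (2 * n))" using Az n by (intro mult_strict_left_mono) auto
  also have "\<dots> = \<epsilon> / 2" using n by simp
  finally have d: "norm (inv_pert v - ?h') < \<epsilon> / 2" .
  have "?h' + pert ?h' = comb (A - F) z"
    by (simp add: linear_sum[OF linear_pert] pert_E comb_def flip: sum.distrib)
  then have "v - comb (A - F) z = (inv_pert v - ?h') + pert (inv_pert v - ?h')"
    using inv_pert_eq[of v] by (simp add: linear_diff[OF linear_pert] algebra_simps)
  then have "norm (v - comb (A - F) z) \<le> norm (inv_pert v - ?h') + norm (inv_pert v - ?h') / 2"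
    using norm_triangle_ineq norm_pert by (smt (verit))
  with d \<epsilon> have "norm (v - comb (A - F) z) < \<epsilon>" by linarith
  with A show ?thesis by (intro exI[of _ "A - F"] exI[of _ z]) auto
qed

text \<open>By \<open>approx_high\<close> the low combination is a limit of high ones. The
  polynomial that annihilates the blocks in \<open>F\<close> is bounded on the differences, which
  tend to 0, and it erases their low part; so it sends the high combinations to 0 as well. Being
  injective on each high block, it forces the high hybrid coordinates of the limit to vanish. The
  limit is then 0, and \<open>comb_independent\<close> applies.\<close>

lemma low_independent:
  assumes b0: "\<And>i. i \<in> F \<Longrightarrow> pcoef i (comb F z) = 0" and "j \<in> F"
  shows "z j = 0"
proof -
  obtain js where js: "set js = F" using finite_F finite_list by blast
  obtain B where B: "\<And>A y. finite A \<Longrightarrow> norm (comb A (\<lambda>i. quads js i (y i))) \<le> B * norm (comb A y)"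
    using comb_quads_bound by blast
  have "\<exists>A y. finite A \<and> A \<inter> F = {} \<and> norm (comb F z - comb A y) < 1 / real (Suc n)" for n
    by (rule approx_high) (use b0 comb_in in auto)
  then obtain A y where A: "\<And>n. finite (A n)" "\<And>n. A n \<inter> F = {}"
    and Ay: "\<And>n. norm (comb F z - comb (A n) (y n)) < 1 / real (Suc n)" by metis
  \<comment> \<open>With the default value 0 off \<open>A n\<close>, the number
    \<open>y' n i\<close> is the hybrid coordinate of the combination for every \<open>i\<close>, so
    that it converges as \<open>n\<close> grows.\<close>
  define y' where "y' n i = (if i \<in> A n then y n i else 0)" for n i
  have combA: "comb (A n) (y n) = comb (A n) (y' n)" for n
    unfolding comb_def y'_def by (intro sum.cong) auto
  have lim: "(\<lambda>n. comb (A n) (y' n)) \<longlonglongrightarrow> comb F z"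
  proof (rule LIM_zero_cancel, rule Lim_null_comparison)
    show "\<forall>\<^sub>F n in sequentially. norm (comb (A n) (y' n) - comb F z) \<le> 1 / real (Suc n)"
      using Ay by (simp add: combA norm_minus_commute less_imp_le)
    show "(\<lambda>n. 1 / real (Suc n)) \<longlonglongrightarrow> 0"
      using LIMSEQ_inverse_real_of_nat by (simp add: inverse_eq_divide)
  qed
  have bA: "pcoef i (comb (A n) x) = (if i \<in> A n then x i else 0)" for i n x
  proof -
    have "pcoef i (comb (A n) x) = (\<Sum>j\<in>A n. if i = j then x j else 0)"
      unfolding comb_def linear_sum[OF linear_pcoef] using A(2)[of n] by (intro sum.cong) (auto simp: pcoef_G disjoint_iff)
    then show ?thesis using A(1)[of n] by (simp add: sum.delta')
  qed
  have "pcoef i (comb F z) = 0" for i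
  proof (cases "i \<in> F")
    case False
    have q: "(\<lambda>n. comb (A n) (\<lambda>i. quads js i (y' n i))) \<longlonglongrightarrow> 0"
    proof (rule Lim_null_comparison)
      show "\<forall>\<^sub>F n in sequentially. norm (comb (A n) (\<lambda>i. quads js i (y' n i)))
          \<le> B * norm (comb (A n) (y' n) - comb F z)"
      proof (intro always_eventually allI)
        fix n
        \<comment> \<open>One coefficient family on \<open>A n \<union> F\<close> for the difference
          of the high and the low combination, so that the bound \<open>B\<close> applies to
          it.\<close>
        define x where "x i = (if i \<in> F then - z i else y' n i)" for i
        have "comb (A n \<union> F) x = comb (A n) x + comb F x"
          unfolding comb_def using A finite_F by (intro sum.union_disjoint) auto
        also have "comb (A n) x = comb (A n) (y' n)"
          unfolding comb_def x_def using A(2)[of n] by (intro sum.cong) auto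
        also have "comb F x = - comb F z"
          unfolding comb_def x_def sum_negf[symmetric]
          by (intro sum.cong) (auto simp: linear_neg[OF linear_G])
        finally have 1: "comb (A n \<union> F) x = comb (A n) (y' n) - comb F z" by simp
        have "comb (A n \<union> F) (\<lambda>i. quads js i (x i)) = comb (A n) (\<lambda>i. quads js i (x i))"
          using A finite_F js by (intro comb_subset) (auto intro: quads_mem)
        also have "\<dots> = comb (A n) (\<lambda>i. quads js i (y' n i))"
          unfolding comb_def x_def using A(2)[of n] by (intro sum.cong) auto
        finally show "norm (comb (A n) (\<lambda>i. quads js i (y' n i)))
            \<le> B * norm (comb (A n) (y' n) - comb F z)"
          using B[of "A n \<union> F" x] A finite_F 1 by simp
      qed
      show "(\<lambda>n. B * norm (comb (A n) (y' n) - comb F z)) \<longlonglongrightarrow> 0"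
        using lim by (intro tendsto_mult_right_zero tendsto_norm_zero LIM_zero)
    qed
    have "(\<lambda>n. pcoef i (comb (A n) (\<lambda>i. quads js i (y' n i)))) \<longlonglongrightarrow> pcoef i 0"
      by (rule bounded_linear.tendsto[OF bounded_linear_pcoef q])
    moreover have "pcoef i (comb (A n) (\<lambda>i. quads js i (y' n i))) = quads js i (y' n i)" for n
      unfolding bA by (auto simp: y'_def linear_0[OF linear_quads])
    ultimately have "(\<lambda>n. quads js i (y' n i)) \<longlonglongrightarrow> 0"
      by (simp add: linear_0[OF linear_pcoef])
    moreover have "(\<lambda>n. quads js i (y' n i)) \<longlonglongrightarrow> quads js i (pcoef i (comb F z))"
    proof -
      have "(\<lambda>n. pcoef i (comb (A n) (y' n))) \<longlonglongrightarrow> pcoef i (comb F z)"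
        by (rule bounded_linear.tendsto[OF bounded_linear_pcoef lim])
      then have "(\<lambda>n. y' n i) \<longlonglongrightarrow> pcoef i (comb F z)"
        unfolding bA by (simp add: y'_def cong: if_cong)
      then show ?thesis
        by (rule bounded_linear.tendsto[OF linear_conv_bounded_linear[THEN iffD1, OF linear_quads]])
    qed
    ultimately have "quads js i (pcoef i (comb F z)) = 0"
      using LIMSEQ_unique by blast
    with quads_not_mem js False show ?thesis by blast
  qed (use b0 in auto)
  then have "comb F z = 0"
    using pcoef_total[OF comb_in] by blast
  then show ?thesis using comb_independent finite_F assms(2) by blast
qed

text \<open>The square system that computes the low hybrid coordinates of a low combination is
  transported to the real span \<open>V\<close> of the low modes, where it becomes the endomorphism
  \<open>\<Theta>\<close>. It is injective by \<open>low_independent\<close>, hence surjective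
  because \<open>V\<close> has finite dimension; \<open>g\<close> is its inverse.\<close>

lemma low_solvable:
  obtains g where "linear g" "\<And>y i. i \<in> F \<Longrightarrow> pcoef i (comb F (\<lambda>l. fc l (g (\<Sum>l\<in>F. E l (y l))))) = y i"
proof -
  define lowE where "lowE y = (\<Sum>l\<in>F. E l (y l))" for y
  define V where "V = range lowE"
  define \<Theta> where "\<Theta> v = lowE (\<lambda>i. pcoef i (comb F (\<lambda>l. fc l v)))" for v
  have fc_low: "fc i (lowE y) = (if i \<in> F then y i else 0)" for i y
    using finite_F by (simp add: lowE_def linear_sum[OF linear_fc] fc_E sum.delta')
  have lowE_cong: "lowE y = lowE y'" if "\<And>i. i \<in> F \<Longrightarrow> y i = y' i" for y y'
    unfolding lowE_def using that by (intro sum.cong) auto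
  have low_add: "lowE (\<lambda>i. y i + y' i) = lowE y + lowE y'" for y y'
    by (simp add: lowE_def linear_add[OF linear_E] sum.distrib)
  have low_scale: "lowE (\<lambda>i. c *\<^sub>R y i) = c *\<^sub>R lowE y" for c y
    by (simp add: lowE_def linear_scale[OF linear_E] scaleR_sum_right)
  have lin\<Theta>: "linear \<Theta>"
    unfolding \<Theta>_def
    by (rule linearI) (simp_all add: linear_add[OF linear_fc] linear_scale[OF linear_fc] comb_add
        comb_scaleR linear_add[OF linear_pcoef] linear_scale[OF linear_pcoef] low_add low_scale)
  have subV: "subspace V"
    unfolding V_def subspace_def
  proof (intro conjI ballI allI)
    show "0 \<in> range lowE"
      by (rule range_eqI[of _ _ "\<lambda>_. 0"]) (simp add: lowE_def linear_0[OF linear_E])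
  qed (auto simp flip: low_add low_scale)
  have inj: "inj_on \<Theta> V"
    unfolding linear_inj_on_iff_eq_0[OF lin\<Theta> subV]
  proof (intro ballI impI)
    fix v assume v: "v \<in> V" "\<Theta> v = 0"
    have "pcoef i (comb F (\<lambda>l. fc l v)) = 0" if "i \<in> F" for i
      using fc_low[of i "\<lambda>i. pcoef i (comb F (\<lambda>l. fc l v))"] v(2) that
      by (simp add: \<Theta>_def linear_0[OF linear_fc])
    then have "fc l v = 0" if "l \<in> F" for l
      using low_independent that by blast
    moreover obtain y where y: "v = lowE y" using v(1) by (auto simp: V_def)
    ultimately have "y l = 0" if "l \<in> F" for l using that fc_low[of l y] by simp
    then show "v = 0" unfolding y lowE_def by (auto intro!: sum.neutral simp: linear_0[OF linear_E])
  qed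
  \<comment> \<open>Two vectors for each low mode, since \<open>E l\<close> is linear only over the
    reals.\<close>
  define D where "D = (\<Union>l\<in>F. {E l 1, E l \<i>})"
  have "finite D" using finite_F by (simp add: D_def)
  have VD: "V \<subseteq> span D"
  proof
    fix v assume "v \<in> V"
    then obtain y where y: "v = (\<Sum>l\<in>F. E l (y l))" by (auto simp: V_def lowE_def)
    have "E l (y l) = Re (y l) *\<^sub>R E l 1 + Im (y l) *\<^sub>R E l \<i>" for l
    proof -
      have "y l = Re (y l) *\<^sub>R 1 + Im (y l) *\<^sub>R \<i>"
        by (simp add: complex_eq_iff)
      then show ?thesis by (metis linear_E linear_add linear_scale)
    qed
    moreover have "E l 1 \<in> span D" "E l \<i> \<in> span D" if "l \<in> F" for l
      using that by (auto simp: D_def intro!: span_base)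
    ultimately show "v \<in> span D"
      unfolding y by (intro span_sum) (auto intro!: span_add span_scale)
  qed
  obtain B where B: "B \<subseteq> V" "independent B" "V \<subseteq> span B"
    by (rule maximal_independent_subset)
  have finB: "finite B"
    using independent_span_bound[OF \<open>finite D\<close> B(2)] B(1) VD by blast
  have spanB: "span B = V" using B(1,3) subV by (simp add: span_minimal subset_antisym)
  have \<Theta>V: "\<Theta> v \<in> V" for v by (simp add: \<Theta>_def V_def)
  have indB: "independent (\<Theta> ` B)"
    using linear_independent_injective_image[OF lin\<Theta> B(2)] inj spanB by simp
  have cardB: "card (\<Theta> ` B) = card B"
    using inj B(1) by (intro card_image) (rule inj_on_subset)
  have "V \<subseteq> span (\<Theta> ` B)"
  proof
    fix v assume v: "v \<in> V"
    show "v \<in> span (\<Theta> ` B)"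
    proof (rule ccontr)
      assume nv: "v \<notin> span (\<Theta> ` B)"
      then have "independent (insert v (\<Theta> ` B))"
        using indB by (simp add: independent_insertI)
      moreover have "insert v (\<Theta> ` B) \<subseteq> span B"
        using v \<Theta>V spanB by auto
      ultimately have "card (insert v (\<Theta> ` B)) \<le> card B"
        using independent_span_bound finB by blast
      moreover have "v \<notin> \<Theta> ` B" using nv span_base[of v "\<Theta> ` B"] by auto
      ultimately show False using finB cardB by simp
    qed
  qed
  then have surj: "V \<subseteq> \<Theta> ` V"
    using linear_span_image[OF lin\<Theta>, of B] spanB by simp
  obtain g where g: "linear g" "\<And>v. v \<in> V \<Longrightarrow> g (\<Theta> v) = v"
    using linear_exists_left_inverse_on[OF lin\<Theta> subV inj] by blast
  show thesis
  proof
    show "linear g" by fact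
    fix y i assume i: "i \<in> F"
    have "lowE y \<in> V" by (simp add: V_def)
    then obtain v where v: "v \<in> V" "lowE y = \<Theta> v" using surj by blast
    have "y i = fc i (lowE y)" using i by (simp add: fc_low)
    also have "\<dots> = pcoef i (comb F (\<lambda>l. fc l v))"
      unfolding v(2) \<Theta>_def using i by (simp add: fc_low)
    finally show "pcoef i (comb F (\<lambda>l. fc l (g (\<Sum>l\<in>F. E l (y l))))) = y i"
      using g(2)[OF v(1)] v(2) by (simp add: lowE_def)
  qed
qed

text \<open>The low coefficients \<open>lo\<close> are chosen such that subtracting their
  combination cancels all low hybrid coordinates; the high coefficients are the hybrid coordinates
  of the remainder.\<close>

lemma biorthogonal_aux:
  "\<exists>a B. (\<forall>j. linear (a j)) \<and> (\<forall>j v. norm (a j v) \<le> B * norm v) \<and>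
     (\<forall>i j z. a i (G j z) = (if i = j then z else 0)) \<and>
     (\<forall>v\<in>S. (\<forall>j. a j v = 0) \<longrightarrow> v = 0) \<and>
     (\<forall>v\<in>S. \<forall>\<epsilon>>0. \<exists>A z. finite A \<and> norm (v - (\<Sum>j\<in>A. G j (z j))) < \<epsilon>)"
proof -
  obtain g where g: "linear g"
    "\<And>y i. i \<in> F \<Longrightarrow> pcoef i (comb F (\<lambda>l. fc l (g (\<Sum>l\<in>F. E l (y l))))) = y i"
    using low_solvable by blast
  define lo where "lo l v = fc l (g (\<Sum>i\<in>F. E i (pcoef i v)))" for l v
  define a where "a j v = (if j \<in> F then lo j v else pcoef j (v - comb F (\<lambda>l. lo l v)))" for j v
  have b_lo: "pcoef i (v - comb F (\<lambda>l. lo l v)) = 0" if "i \<in> F" for i v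
    using g(2)[OF that, of "\<lambda>i. pcoef i v"] by (simp add: lo_def linear_diff[OF linear_pcoef])
  have lin_lo: "linear (lo l)" for l
    unfolding lo_def
    by (rule linearI)
       (simp_all add: linear_add[OF linear_pcoef] linear_scale[OF linear_pcoef] linear_add[OF linear_E]
         linear_scale[OF linear_E] sum.distrib linear_add[OF g(1)] linear_scale[OF g(1)]
         linear_add[OF linear_fc] linear_scale[OF linear_fc] flip: scaleR_sum_right)
  have lin_a: "linear (a j)" for j
  proof (cases "j \<in> F")
    case True
    then show ?thesis using lin_lo[of j] by (simp add: a_def[abs_def])
  next
    case False
    have "linear (\<lambda>v. pcoef j (v - comb F (\<lambda>l. lo l v)))"
      by (rule linearI)
         (simp_all add: linear_add[OF lin_lo] linear_scale[OF lin_lo] comb_add comb_scaleR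
           linear_add[OF linear_pcoef] linear_diff[OF linear_pcoef] linear_scale[OF linear_pcoef] scaleR_diff_right)
    with False show ?thesis by (simp add: a_def[abs_def])
  qed
  \<comment> \<open>The 2 is the bound of \<open>pcoef\<close>; the sum bounds the real linear map
    \<open>g\<close> on the low modes through its values at the real basis 1, \<open>\<i>\<close> of
    the coefficients.\<close>
  define M where "M = 2 * (\<Sum>i\<in>F. norm (g (E i 1)) + norm (g (E i \<i>)))"
  have norm_lo: "norm (lo l v) \<le> M * norm v" for l v
  proof -
    have E1: "g (E i z) = Re z *\<^sub>R g (E i 1) + Im z *\<^sub>R g (E i \<i>)" for i z
    proof -
      have "g (E i z) = g (E i (Re z *\<^sub>R 1 + Im z *\<^sub>R \<i>))"
        by (rule arg_cong[of _ _ "\<lambda>z. g (E i z)"]) (simp add: complex_eq_iff)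
      then show ?thesis
        by (simp only: linear_add[OF linear_E] linear_scale[OF linear_E] linear_add[OF g(1)] linear_scale[OF g(1)])
    qed
    have E2: "norm (g (E i z)) \<le> norm z * (norm (g (E i 1)) + norm (g (E i \<i>)))" for i z
    proof -
      have "norm (g (E i z)) \<le> \<bar>Re z\<bar> * norm (g (E i 1)) + \<bar>Im z\<bar> * norm (g (E i \<i>))"
        unfolding E1[of i z] using norm_triangle_ineq[of "Re z *\<^sub>R g (E i 1)" "Im z *\<^sub>R g (E i \<i>)"] by simp
      also have "\<dots> \<le> norm z * norm (g (E i 1)) + norm z * norm (g (E i \<i>))"
        by (intro add_mono mult_right_mono abs_Re_le_cmod abs_Im_le_cmod) auto
      finally show ?thesis by (simp add: algebra_simps)
    qed
    have "norm (lo l v) \<le> norm (\<Sum>i\<in>F. g (E i (pcoef i v)))"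
      unfolding lo_def using norm_fc by (simp add: linear_sum[OF g(1)])
    also have "\<dots> \<le> (\<Sum>i\<in>F. norm (g (E i (pcoef i v))))" by (rule norm_sum)
    also have "\<dots> \<le> (\<Sum>i\<in>F. (2 * norm v) * (norm (g (E i 1)) + norm (g (E i \<i>))))"
      by (intro sum_mono order_trans[OF E2] mult_right_mono norm_pcoef) auto
    also have "\<dots> = M * norm v" unfolding M_def by (simp add: sum_distrib_left mult_ac)
    finally show ?thesis .
  qed
  have M: "M \<ge> 0" unfolding M_def by (auto intro!: sum_nonneg)
  define q where "q = (\<Sum>i\<in>F. 1 + \<eta> i)"
  have q: "q \<ge> 0" unfolding q_def using eta_nonneg by (auto intro!: sum_nonneg)
  have norm_G: "norm (G j z) \<le> (1 + \<eta> j) * norm z" for j z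
    using norm_triangle_ineq[of "G j z - E j z" "E j z"] close[of j z] norm_E[of j z]
    by (simp add: algebra_simps)
  have norm_comb: "norm (comb F (\<lambda>l. lo l v)) \<le> q * (M * norm v)" for v
  proof -
    have "norm (comb F (\<lambda>l. lo l v)) \<le> (\<Sum>l\<in>F. norm (G l (lo l v)))"
      unfolding comb_def by (rule norm_sum)
    also have "\<dots> \<le> (\<Sum>l\<in>F. (1 + \<eta> l) * (M * norm v))"
      using eta_nonneg by (intro sum_mono order_trans[OF norm_G] mult_left_mono norm_lo) (auto intro: add_nonneg_nonneg)
    finally show ?thesis by (simp add: q_def sum_distrib_right)
  qed
  have na: "norm (a j v) \<le> (M + 2 * (1 + q * M)) * norm v" for j v
  proof (cases "j \<in> F")
    case True
    have "0 \<le> (2 * (1 + q * M)) * norm v" using M q by auto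
    then show ?thesis using True norm_lo[of j v] by (simp add: a_def algebra_simps)
  next
    case False
    then have "norm (a j v) \<le> 2 * norm (v - comb F (\<lambda>l. lo l v))"
      using norm_pcoef by (simp add: a_def)
    also have "\<dots> \<le> 2 * (norm v + q * (M * norm v))"
      using norm_triangle_ineq4[of v "comb F (\<lambda>l. lo l v)"] norm_comb[of v] by simp
    also have "\<dots> \<le> M * norm v + 2 * (norm v + q * (M * norm v))" using M by simp
    finally show ?thesis by (simp add: algebra_simps)
  qed
  have bi: "a i (G j z) = (if i = j then z else 0)" for i j z
  proof (cases "j \<in> F")
    case True
    \<comment> \<open>Expected minus computed low coefficients of \<open>G j z\<close>. Their
      combination has no low hybrid coordinates, so \<open>low_independent\<close> makes them
      zero.\<close>
    define y where "y l = (if l = j then z else 0) - lo l (G j z)" for l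
    have "comb F (\<lambda>l. if l = j then z else 0) = comb {j} (\<lambda>l. if l = j then z else 0)"
      using True finite_F by (intro comb_subset) auto
    then have y: "comb F y = G j z - comb F (\<lambda>l. lo l (G j z))"
      unfolding y_def comb_diff by (simp add: comb_def)
    have "pcoef i (comb F y) = 0" if "i \<in> F" for i
      unfolding y using b_lo that by blast
    then have y0: "y l = 0" if "l \<in> F" for l using low_independent that by blast
    then have "comb F y = 0"
      unfolding comb_def by (intro sum.neutral) (auto simp: linear_0[OF linear_G])
    moreover have "lo i (G j z) = (if i = j then z else 0)" if "i \<in> F"
      using y0[OF that] unfolding y_def by (simp split: if_splits)
    ultimately show ?thesis
      using True unfolding a_def y[symmetric] by (auto simp: linear_0[OF linear_pcoef])
  next
    case False
    then have "pcoef i (G j z) = 0" if "i \<in> F" for i using that pcoef_G by auto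
    then have "lo l (G j z) = 0" for l
      by (simp add: lo_def linear_0[OF linear_E] linear_0[OF linear_fc] linear_0[OF g(1)])
    then show ?thesis using False pcoef_G by (auto simp: a_def comb_def linear_0[OF linear_G])
  qed
  have to: "v = 0" if v: "v \<in> S" "\<forall>j. a j v = 0" for v
  proof -
    have "lo l v = 0" if "l \<in> F" for l using v(2) that by (metis a_def)
    then have c0: "comb F (\<lambda>l. lo l v) = 0"
      unfolding comb_def by (intro sum.neutral) (auto simp: linear_0[OF linear_G])
    have "pcoef i v = 0" for i
    proof (cases "i \<in> F")
      case True
      then show ?thesis using b_lo[of i v] c0 by simp
    next
      case False
      then show ?thesis using v(2) c0 by (metis a_def diff_zero)
    qed
    then show ?thesis using pcoef_total v(1) by blast
  qed
  have de: "\<exists>A z. finite A \<and> norm (v - (\<Sum>j\<in>A. G j (z j))) < \<epsilon>" if v: "v \<in> S" "\<epsilon> > 0" for v \<epsilon>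
  proof -
    let ?v = "v - comb F (\<lambda>l. lo l v)"
    have S: "?v \<in> S" using v comb_in subspace_S subspace_diff by blast
    obtain A z where A: "finite A" "A \<inter> F = {}" "norm (?v - comb A z) < \<epsilon>"
      using approx_high[OF S b_lo v(2)] by auto
    define y where "y l = (if l \<in> F then lo l v else z l)" for l
    have "comb (A \<union> F) y = comb A y + comb F y"
      unfolding comb_def using A finite_F by (intro sum.union_disjoint) auto
    also have "comb A y = comb A z"
      unfolding comb_def y_def using A by (intro sum.cong) auto
    also have "comb F y = comb F (\<lambda>l. lo l v)"
      unfolding comb_def y_def by (intro sum.cong) auto
    finally have "v - comb (A \<union> F) y = ?v - comb A z" by simp
    with A(3) have "norm (v - comb (A \<union> F) y) < \<epsilon>" by (simp only:)
    with A(1) finite_F show ?thesis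
      by (intro exI[of _ "A \<union> F"] exI[of _ y]) (simp add: comb_def)
  qed
  show ?thesis
    by (intro exI[of _ a] exI[of _ "M + 2 * (1 + q * M)"] conjI allI ballI impI lin_a na bi de)
       (rule to)
qed

end

theorem biorthogonal_functionals:
  "\<exists>a B. (\<forall>j. bounded_linear (a j)) \<and> (\<forall>j v. norm (a j v) \<le> B * norm v) \<and>
     (\<forall>i j z. a i (G j z) = (if i = j then z else 0)) \<and>
     (\<forall>v\<in>S. (\<forall>j. a j v = 0) \<longrightarrow> v = 0) \<and>
     (\<forall>v\<in>S. \<forall>\<epsilon>>0. \<exists>A z. finite A \<and> norm (v - (\<Sum>j\<in>A. G j (z j))) < \<epsilon>)"
proof -
  obtain F where F: "finite F"
    "\<forall>A. finite A \<and> A \<inter> F = {} \<longrightarrow> (\<Sum>j\<in>A. (\<eta> j)\<^sup>2) \<le> 1/4"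
    using tail_small by (elim exE conjE)
  obtain a B where a: "\<forall>j. linear (a j)" "\<forall>j v. norm (a j v) \<le> B * norm v"
     "\<forall>i j z. a i (G j z) = (if i = j then z else 0)"
     "\<forall>v\<in>S. (\<forall>j. a j v = 0) \<longrightarrow> v = 0"
     "\<forall>v\<in>S. \<forall>\<epsilon>>0. \<exists>A z. finite A \<and> norm (v - (\<Sum>j\<in>A. G j (z j))) < \<epsilon>"
    using biorthogonal_aux[OF F] by (elim exE conjE)
  have bl: "\<forall>j. bounded_linear (a j)"
    using a(1,2) by (intro allI bounded_linear_intro[where K = B]) (auto simp: linear_add linear_scale mult.commute)
  show ?thesis
    by (rule exI[of _ a], rule exI[of _ B], intro conjI) (fact bl a)+
qed

end

section \<open>Fourier modes in the space of continuous periodic functions\<close>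

lemma periodic2pi_int:
  assumes "periodic2pi f"
  shows "f (t + 2 * pi * of_int n) = f t"
proof (induction n rule: int_induct[where k = 0])
  case (step1 i)
  have "f (t + 2 * pi * of_int (i + 1)) = f ((t + 2 * pi * of_int i) + 2 * pi)"
    by (simp add: algebra_simps)
  with step1 assms show ?case by (simp add: periodic2pi_def)
next
  case (step2 i)
  have "f (t + 2 * pi * of_int i) = f ((t + 2 * pi * of_int (i - 1)) + 2 * pi)"
    by (simp add: algebra_simps)
  with step2 assms show ?case by (simp add: periodic2pi_def)
qed simp

lemma periodic2pi_cis_eq:
  assumes "periodic2pi f" "cis s = cis t"
  shows "f s = f t"
proof -
  have "sin s = sin t \<and> cos s = cos t" using assms(2) by (simp add: complex_eq_iff)
  then obtain n :: int where "s = t + 2 * pi * n" using sin_cos_eq_iff by blast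
  then show ?thesis using periodic2pi_int[OF assms(1)] by simp
qed

lemma periodic2pi_reduce:
  assumes "periodic2pi f"
  obtains s where "0 \<le> s" "s < 2 * pi" "f s = f t"
proof -
  have "cis (Arg2pi (cis t)) = cis t"
    using Arg2pi_eq[of "cis t"] by (simp add: cis_conv_exp)
  then show thesis
    using that[of "Arg2pi (cis t)"] Arg2pi[of "cis t"] periodic2pi_cis_eq[OF assms] by blast
qed

lemma periodic2pi_bcontfun:
  fixes f :: "real \<Rightarrow> complex"
  assumes "continuous_on UNIV f" "periodic2pi f"
  shows "f \<in> bcontfun"
proof -
  have "bounded (f ` {0..2*pi})"
    using assms(1) by (intro compact_imp_bounded compact_continuous_image) (auto intro: continuous_on_subset)
  then obtain B where B: "\<And>t. t \<in> {0..2*pi} \<Longrightarrow> norm (f t) \<le> B"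
    unfolding bounded_iff by blast
  have "norm (f t) \<le> B" for t
  proof -
    obtain s where "0 \<le> s" "s < 2 * pi" "f s = f t" by (rule periodic2pi_reduce[OF assms(2)])
    with B[of s] show ?thesis by simp
  qed
  then show ?thesis using assms(1) by (intro bcontfun_normI)
qed

text \<open>The circle is not a type of its own. Periodic functions form a closed subspace of the
  bounded continuous functions on the line, from which they take the sup norm and
  completeness.\<close>

definition circle_functions :: "(real \<Rightarrow>\<^sub>C complex) set" where
  "circle_functions = {v. periodic2pi (apply_bcontfun v)}"

definition circle_fun :: "(real \<Rightarrow> complex) \<Rightarrow> (real \<Rightarrow>\<^sub>C complex)" where
  "circle_fun f = Bcontfun f"

lemma apply_circle_fun:
  "continuous_on UNIV f \<Longrightarrow> periodic2pi f \<Longrightarrow> apply_bcontfun (circle_fun f) = f"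
  unfolding circle_fun_def by (simp add: Bcontfun_inverse periodic2pi_bcontfun)

lemma circle_fun_in:
  "continuous_on UNIV f \<Longrightarrow> periodic2pi f \<Longrightarrow> circle_fun f \<in> circle_functions"
  by (simp add: circle_functions_def apply_circle_fun)

lemma bounded_linear_apply_bcontfun: "bounded_linear (\<lambda>v :: real \<Rightarrow>\<^sub>C complex. apply_bcontfun v t)"
  by (rule bounded_linear_intro[where K = 1]) (auto simp: norm_bounded)

lemma subspace_circle_functions: "subspace circle_functions"
  by (auto simp: subspace_def circle_functions_def periodic2pi_def)

lemma apply_bcontfun_sum:
  "apply_bcontfun (\<Sum>j\<in>A. f j) t = (\<Sum>j\<in>A. apply_bcontfun (f j :: real \<Rightarrow>\<^sub>C complex) t)"
  by (rule linear_sum[OF bounded_linear.linear[OF bounded_linear_apply_bcontfun]])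

lemma closed_circle_functions: "closed circle_functions"
proof -
  have eq: "circle_functions = (\<Inter>t. {v. apply_bcontfun v (t + 2 * pi) = apply_bcontfun v t})"
    by (auto simp: circle_functions_def periodic2pi_def)
  show ?thesis
    unfolding eq
    by (intro closed_INT ballI closed_Collect_eq linear_continuous_on bounded_linear_apply_bcontfun)
qed

lemma circle_functions_norm_le:
  assumes "v \<in> circle_functions" "\<And>t. t \<in> {0..2*pi} \<Longrightarrow> norm (apply_bcontfun v t) \<le> B"
  shows "norm v \<le> B"
proof (rule norm_bound)
  fix t
  obtain s where "0 \<le> s" "s < 2 * pi" "apply_bcontfun v s = apply_bcontfun v t"
    using assms(1) periodic2pi_reduce[of "apply_bcontfun v"] by (auto simp: circle_functions_def)
  with assms(2)[of s] show "norm (apply_bcontfun v t) \<le> B" by simp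
qed

section \<open>Fourier modes and Fourier coefficients\<close>

definition mode :: "int \<Rightarrow> complex \<Rightarrow> (real \<Rightarrow>\<^sub>C complex)" where
  "mode j z = circle_fun (\<lambda>t. z * cis (of_int j * t))"

lemma mode_continuous: "continuous_on UNIV (\<lambda>t. z * cis (of_int j * t))"
  by (intro continuous_intros)

lemma mode_periodic: "periodic2pi (\<lambda>t. z * cis (of_int j * t))"
proof -
  have "cis (of_int j * (t + 2 * pi)) = cis (of_int j * t)" for t
    using cis_multiple_2pi[of "of_int j"] by (simp add: distrib_left mult.commute flip: cis_mult)
  then show ?thesis by (simp add: periodic2pi_def)
qed

lemma apply_mode: "apply_bcontfun (mode j z) t = z * cis (of_int j * t)"
  unfolding mode_def by (subst apply_circle_fun[OF mode_continuous mode_periodic]) simp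

lemma mode_in: "mode j z \<in> circle_functions"
  unfolding mode_def by (rule circle_fun_in[OF mode_continuous mode_periodic])

lemma linear_mode: "linear (mode j)"
  by (rule linearI) (auto intro!: bcontfun_eqI simp: apply_mode algebra_simps)

lemma norm_mode: "norm (mode j z) \<le> norm z"
  by (rule norm_bound) (simp add: apply_mode norm_mult)

lemma cis_has_integral:
  "((\<lambda>t. cis (of_int k * t)) has_integral (if k = 0 then 2 * pi else 0)) {0..2*pi}"
proof (cases "k = 0")
  case True
  then show ?thesis using has_integral_const_real[of "1::complex" 0 "2*pi"] by (simp add: scaleR_conv_of_real)
next
  case False
  let ?F = "\<lambda>t. cis (of_int k * t) / (\<i> * of_int k)"
  have "((\<lambda>t. cis (of_int k * t)) has_integral (?F (2*pi) - ?F 0)) {0..2*pi}"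
  proof (rule fundamental_theorem_of_calculus)
    fix t assume "t \<in> {0..2*pi}"
    have "((\<lambda>z. exp (\<i> * of_int k * z) / (\<i> * of_int k)) has_field_derivative exp (\<i> * of_int k * of_real t))
        (at (of_real t))"
      using False by (auto intro!: derivative_eq_intros)
    from has_vector_derivative_real_field[OF this]
    show "(?F has_vector_derivative cis (of_int k * t)) (at t within {0..2*pi})"
      by (simp add: cis_conv_exp mult.assoc o_def)
  qed simp
  moreover have "cis (of_int k * (2 * pi)) = 1"
    using cis_multiple_2pi[of "of_int k"] by (simp add: mult.commute)
  ultimately show ?thesis using False by simp
qed

definition fcoef :: "int \<Rightarrow> (real \<Rightarrow>\<^sub>C complex) \<Rightarrow> complex" where
  "fcoef j v = integral {0..2*pi} (\<lambda>t. apply_bcontfun v t * cis (- of_int j * t)) / (2 * pi)"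

lemma fcoef_has_integral:
  "((\<lambda>t. apply_bcontfun v t * cis (- of_int j * t)) has_integral (2 * pi * fcoef j v)) {0..2*pi}"
  unfolding fcoef_def
  by (simp, intro integrable_integral integrable_continuous_real continuous_intros continuous_on_apply_bcontfun)

lemma fcoefI:
  fixes c :: complex
  assumes "((\<lambda>t. apply_bcontfun v t * cis (- of_int j * t)) has_integral (2 * pi * c)) {0..2*pi}"
  shows "fcoef j v = c"
  using has_integral_unique[OF assms fcoef_has_integral] by simp

lemma fcoef_mode: "fcoef i (mode j z) = (if i = j then z else 0)"
proof (rule fcoefI)
  have "((\<lambda>t. z * cis (of_int (j - i) * t)) has_integral (z * (if j - i = 0 then 2 * pi else 0))) {0..2*pi}"
    by (rule has_integral_mult_right[OF cis_has_integral])
  moreover have "apply_bcontfun (mode j z) t * cis (- of_int i * t) = z * cis (of_int (j - i) * t)" for t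
    by (simp add: apply_mode mult.assoc cis_mult algebra_simps)
  ultimately show "((\<lambda>t. apply_bcontfun (mode j z) t * cis (- of_int i * t)) has_integral
      (2 * pi * (if i = j then z else 0))) {0..2*pi}"
    by (auto simp: mult.commute)
qed

lemma linear_fcoef: "linear (fcoef j)"
proof (rule linearI)
  fix v w :: "real \<Rightarrow>\<^sub>C complex" and c :: real
  show "fcoef j (v + w) = fcoef j v + fcoef j w"
    using has_integral_add[OF fcoef_has_integral fcoef_has_integral, of v j w j]
    by (intro fcoefI) (simp add: algebra_simps)
  show "fcoef j (c *\<^sub>R v) = c *\<^sub>R fcoef j v"
    using has_integral_cmul[OF fcoef_has_integral, of c v j]
    by (intro fcoefI) (simp add: algebra_simps)
qed

lemma has_integral_mult_cnj:
  "((\<lambda>t. apply_bcontfun v t * cnj (apply_bcontfun v t)) has_integral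
     of_real (integral {0..2*pi} (\<lambda>t. (norm (apply_bcontfun v t))\<^sup>2))) {0..2*pi}"
proof -
  have "((\<lambda>t. (norm (apply_bcontfun v t))\<^sup>2) has_integral
     (integral {0..2*pi} (\<lambda>t. (norm (apply_bcontfun v t))\<^sup>2))) {0..2*pi}"
    by (intro integrable_integral integrable_continuous_real continuous_intros continuous_on_apply_bcontfun)
  from has_integral_linear[OF this, of complex_of_real, OF bounded_linear_of_real] show ?thesis
    by (simp only: o_def complex_norm_square)
qed

lemma integral_square_le: "integral {0..2*pi} (\<lambda>t. (norm (apply_bcontfun v t))\<^sup>2) \<le> 2 * pi * (norm v)\<^sup>2"
proof -
  have "integral {0..2*pi} (\<lambda>t. (norm (apply_bcontfun v t))\<^sup>2) \<le> integral {0..2*pi} (\<lambda>t. (norm v)\<^sup>2)"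
    by (intro integral_le integrable_continuous_real continuous_intros continuous_on_apply_bcontfun power_mono norm_bounded)
       auto
  then show ?thesis by simp
qed

text \<open>Bessel's inequality in mean square: with \<open>s\<close> the Fourier sum over
  \<open>A\<close>, the integral for \<open>v - s\<close> is that for \<open>v\<close> minus
  \<open>2 * pi\<close> times the left side. The sup norm on the right comes from
  \<open>integral_square_le\<close>.\<close>

lemma fcoef_bessel:
  assumes "finite A"
  shows "(\<Sum>j\<in>A. (norm (fcoef j v))\<^sup>2) \<le> (norm v)\<^sup>2"
proof -
  let ?c = "\<lambda>j. fcoef j v" and ?Q = "\<lambda>v. integral {0..2*pi} (\<lambda>t. (norm (apply_bcontfun v t))\<^sup>2)"
  define s where "s = (\<Sum>j\<in>A. mode j (?c j))"
  have s: "apply_bcontfun s t = (\<Sum>j\<in>A. ?c j * cis (of_int j * t))" for t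
    unfolding s_def by (simp add: apply_mode apply_bcontfun_sum)
  have c: "cnj (cis x) = cis (- x)" for x by (simp add: cis_cnj)
  let ?S = "of_real (\<Sum>j\<in>A. (norm (?c j))\<^sup>2) :: complex"
  have 1: "((\<lambda>t. apply_bcontfun v t * cnj (apply_bcontfun s t)) has_integral (2 * pi * ?S)) {0..2*pi}"
  proof -
    have "((\<lambda>t. \<Sum>j\<in>A. cnj (?c j) * (apply_bcontfun v t * cis (- of_int j * t))) has_integral
        (\<Sum>j\<in>A. cnj (?c j) * (2 * pi * ?c j))) {0..2*pi}"
      by (intro has_integral_sum assms has_integral_mult_right fcoef_has_integral)
    moreover have "(\<Sum>j\<in>A. cnj (?c j) * (2 * pi * ?c j)) = 2 * pi * ?S"
      by (simp add: sum_distrib_left complex_norm_square mult_ac del: of_real_power)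
    moreover have "apply_bcontfun v t * cnj (apply_bcontfun s t)
        = (\<Sum>j\<in>A. cnj (?c j) * (apply_bcontfun v t * cis (- of_int j * t)))" for t
      by (simp add: s cnj_sum sum_distrib_left c mult_ac)
    ultimately show ?thesis by simp
  qed
  have 2: "((\<lambda>t. cnj (apply_bcontfun v t) * apply_bcontfun s t) has_integral (2 * pi * ?S)) {0..2*pi}"
    using has_integral_cnj[THEN iffD2, OF 1] by (simp add: o_def)
  have 3: "((\<lambda>t. apply_bcontfun s t * cnj (apply_bcontfun s t)) has_integral (2 * pi * ?S)) {0..2*pi}"
  proof -
    have sc: "fcoef j s = ?c j" if "j \<in> A" for j
      using that assms by (simp add: s_def linear_sum[OF linear_fcoef] fcoef_mode sum.delta')
    have "((\<lambda>t. \<Sum>j\<in>A. cnj (?c j) * (apply_bcontfun s t * cis (- of_int j * t))) has_integral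
        (\<Sum>j\<in>A. cnj (?c j) * (2 * pi * fcoef j s))) {0..2*pi}"
      by (intro has_integral_sum assms has_integral_mult_right fcoef_has_integral)
    moreover have "(\<Sum>j\<in>A. cnj (?c j) * (2 * pi * fcoef j s)) = 2 * pi * ?S"
      by (simp add: sc sum_distrib_left complex_norm_square mult_ac del: of_real_power)
    moreover have "apply_bcontfun s t * cnj (apply_bcontfun s t)
        = (\<Sum>j\<in>A. cnj (?c j) * (apply_bcontfun s t * cis (- of_int j * t)))" for t
      by (subst (2) s) (simp add: cnj_sum sum_distrib_left c mult_ac)
    ultimately show ?thesis by simp
  qed
  have "((\<lambda>t. apply_bcontfun v t * cnj (apply_bcontfun v t) - apply_bcontfun v t * cnj (apply_bcontfun s t)
      - cnj (apply_bcontfun v t) * apply_bcontfun s t + apply_bcontfun s t * cnj (apply_bcontfun s t))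
      has_integral (of_real (?Q v) - 2 * pi * ?S - 2 * pi * ?S + 2 * pi * ?S)) {0..2*pi}"
    by (intro has_integral_add has_integral_diff has_integral_mult_cnj 1 2 3)
  moreover have "apply_bcontfun v t * cnj (apply_bcontfun v t) - apply_bcontfun v t * cnj (apply_bcontfun s t)
      - cnj (apply_bcontfun v t) * apply_bcontfun s t + apply_bcontfun s t * cnj (apply_bcontfun s t)
      = apply_bcontfun (v - s) t * cnj (apply_bcontfun (v - s) t)" for t
    by (simp add: algebra_simps)
  ultimately have "of_real (?Q v) - 2 * pi * ?S - 2 * pi * ?S + 2 * pi * ?S = of_real (?Q (v - s))"
    using has_integral_unique has_integral_mult_cnj[of "v - s"] by simp
  then have "complex_of_real (?Q v - 2 * pi * (\<Sum>j\<in>A. (norm (?c j))\<^sup>2)) = of_real (?Q (v - s))"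
    by (simp add: algebra_simps)
  then have "?Q v - 2 * pi * (\<Sum>j\<in>A. (norm (?c j))\<^sup>2) = ?Q (v - s)"
    using of_real_eq_iff by blast
  moreover have "?Q (v - s) \<ge> 0"
    by (intro integral_nonneg integrable_continuous_real continuous_intros continuous_on_apply_bcontfun) auto
  ultimately have "2 * pi * (\<Sum>j\<in>A. (norm (?c j))\<^sup>2) \<le> 2 * pi * (norm v)\<^sup>2"
    using integral_square_le[of v] by linarith
  then show ?thesis by simp
qed

lemma bounded_linear_fcoef: "bounded_linear (fcoef j)"
proof (rule bounded_linear_intro[where K = 1])
  fix v
  show "norm (fcoef j v) \<le> norm v * 1"
    using fcoef_bessel[of "{j}" v] by (simp add: power_mono_iff)
qed (auto simp: linear_add[OF linear_fcoef] linear_scale[OF linear_fcoef])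

section \<open>Density and completeness of the Fourier modes\<close>

inductive trig_polynomial :: "(real \<Rightarrow> complex) \<Rightarrow> bool" where
  monomial: "trig_polynomial (\<lambda>t. z * cis (of_int j * t))"
| add: "trig_polynomial f \<Longrightarrow> trig_polynomial g \<Longrightarrow> trig_polynomial (\<lambda>t. f t + g t)"

lemma trig_polynomial_const: "trig_polynomial (\<lambda>t. c)"
  using trig_polynomial.monomial[of c 0] by simp

lemma trig_polynomial_mult:
  assumes "trig_polynomial f" "trig_polynomial g"
  shows "trig_polynomial (\<lambda>t. f t * g t)"
  using assms(1)
proof induction
  case (monomial z j)
  show ?case using assms(2)
  proof induction
    case (monomial z' j')
    have "z * cis (of_int j * t) * (z' * cis (of_int j' * t)) = (z * z') * cis (of_int (j + j') * t)" for t
      by (simp add: distrib_right flip: cis_mult)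
    then show ?case using trig_polynomial.monomial by presburger
  next
    case (add f g)
    then show ?case using trig_polynomial.add by (simp add: distrib_left)
  qed
next
  case (add f g)
  then show ?case using trig_polynomial.add by (simp add: distrib_right)
qed

lemma trig_polynomial_sum:
  assumes "trig_polynomial f"
  shows "\<exists>A z. finite A \<and> (\<forall>t. f t = (\<Sum>j\<in>A. z j * cis (of_int j * t)))"
  using assms
proof induction
  case (monomial z j)
  then show ?case by (intro exI[of _ "{j}"] exI[of _ "\<lambda>_. z"]) auto
next
  case (add f g)
  then obtain A y B z where f: "finite A" "\<And>t. f t = (\<Sum>j\<in>A. y j * cis (of_int j * t))"
    and g: "finite B" "\<And>t. g t = (\<Sum>j\<in>B. z j * cis (of_int j * t))" by auto
  define x where "x j = (if j \<in> A then y j else 0) + (if j \<in> B then z j else 0)" for j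
  have "f t + g t = (\<Sum>j\<in>A \<union> B. x j * cis (of_int j * t))" for t
  proof -
    have "f t = (\<Sum>j\<in>A \<union> B. (if j \<in> A then y j else 0) * cis (of_int j * t))"
      unfolding f(2) using f(1) g(1) by (intro sum.mono_neutral_cong_left) auto
    moreover have "g t = (\<Sum>j\<in>A \<union> B. (if j \<in> B then z j else 0) * cis (of_int j * t))"
      unfolding g(2) using f(1) g(1) by (intro sum.mono_neutral_cong_left) auto
    ultimately show ?thesis by (simp add: x_def distrib_right sum.distrib)
  qed
  then show ?case using f(1) g(1) by (intro exI[of _ "A \<union> B"] exI[of _ x]) auto
qed

text \<open>A real linear function on the plane restricted to the unit circle combines
  \<open>cis t\<close> and \<open>cis (- t)\<close>; closure under sums and products does the
  rest.\<close>

lemma trig_polynomial_real_polynomial: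
  assumes "real_polynomial_function p"
  shows "trig_polynomial (\<lambda>t. of_real (p (cis t)))"
  using assms
proof induction
  case (linear f)
  have "complex_of_real (f (cis t)) = ((of_real (f 1) - \<i> * of_real (f \<i>)) / 2) * cis (of_int 1 * t)
      + ((of_real (f 1) + \<i> * of_real (f \<i>)) / 2) * cis (of_int (-1) * t)" for t
  proof -
    have "cis t = cos t *\<^sub>R 1 + sin t *\<^sub>R \<i>" by (simp add: complex_eq_iff)
    then have "f (cis t) = cos t * f 1 + sin t * f \<i>"
      using linear_add[OF bounded_linear.linear[OF linear]] linear_scale[OF bounded_linear.linear[OF linear]]
      by simp
    then show ?thesis by (simp add: complex_eq_iff field_simps)
  qed
  then show ?case
    using trig_polynomial.add[OF trig_polynomial.monomial trig_polynomial.monomial] by presburger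
next
  case (const c)
  then show ?case using trig_polynomial_const by simp
next
  case (add f g)
  then show ?case using trig_polynomial.add by simp
next
  case (mult f g)
  then show ?case using trig_polynomial_mult by simp
qed

text \<open>Stone-Weierstrass on the unit circle in the plane, to which \<open>v\<close> is carried
  by the argument; polynomials restricted to the circle are trigonometric.\<close>

lemma modes_dense:
  assumes v: "v \<in> circle_functions" and "0 < \<epsilon>"
  shows "\<exists>A z. finite A \<and> norm (v - (\<Sum>j\<in>A. mode j (z j))) < \<epsilon>"
proof -
  have per: "periodic2pi (apply_bcontfun v)" using v by (simp add: circle_functions_def)
  let ?f = "\<lambda>z. apply_bcontfun v (Arg z)"
  have cont: "continuous_on (sphere 0 1) ?f"
  proof (rule continuous_at_imp_continuous_on, rule ballI)
    fix z :: complex assume z: "z \<in> sphere 0 1"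
    have contv: "isCont (apply_bcontfun v) t" for t
      using continuous_on_eq_continuous_at[OF open_UNIV, THEN iffD1, OF continuous_on_apply_bcontfun] by blast
    show "isCont ?f z"
    proof (cases "z \<in> \<real>\<^sub>\<le>\<^sub>0")
      case False
      show ?thesis by (rule isCont_o2[OF continuous_at_Arg[OF False] contv])
    next
      case True
      then have nz: "z \<notin> \<real>\<^sub>\<ge>\<^sub>0" using z by (auto simp: complex_nonpos_Reals_iff complex_nonneg_Reals_iff cmod_def)
      \<comment> \<open>\<open>Arg\<close> jumps on the negative axis. There \<open>Arg2pi\<close>
        is continuous, and periodicity of \<open>v\<close> makes both choices of the argument give
        the same value.\<close>
      have "isCont (\<lambda>z. apply_bcontfun v (Arg2pi z)) z"
        by (rule isCont_o2[OF continuous_at_Arg2pi[OF nz] contv])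
      moreover have "apply_bcontfun v (Arg2pi z) = apply_bcontfun v (Arg z)" if "z \<noteq> 0" for z
      proof (rule periodic2pi_cis_eq[OF per])
        have "of_real (norm z) * cis (Arg2pi z) = of_real (norm z) * cis (Arg z)"
          using Arg2pi_eq[of z] Arg_eq[OF that] by (simp add: cis_conv_exp)
        then show "cis (Arg2pi z) = cis (Arg z)" using that by simp
      qed
      moreover have "\<forall>\<^sub>F z in nhds z. z \<noteq> 0"
        using z by (intro t1_space_nhds) auto
      ultimately show ?thesis
        by (subst isCont_cong[of _ "\<lambda>z. apply_bcontfun v (Arg2pi z)"]) (auto elim: eventually_mono)
    qed
  qed
  obtain g where g: "polynomial_function g" "\<And>z. z \<in> sphere 0 1 \<Longrightarrow> norm (?f z - g z) < \<epsilon> / 2"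
    using Stone_Weierstrass_polynomial_function[OF compact_sphere cont, of "\<epsilon> / 2"] \<open>0 < \<epsilon>\<close> by auto
  have "real_polynomial_function (\<lambda>z. Re (g z))" "real_polynomial_function (\<lambda>z. Im (g z))"
    using g(1) bounded_linear_Re bounded_linear_Im unfolding polynomial_function_def o_def by blast+
  then have "trig_polynomial (\<lambda>t. of_real (Re (g (cis t))) + \<i> * of_real (Im (g (cis t))))"
    by (intro trig_polynomial.add trig_polynomial_mult trig_polynomial_const trig_polynomial_real_polynomial)
  then have "trig_polynomial (\<lambda>t. g (cis t))"
    by (simp flip: complex_eq)
  then obtain A z where A: "finite A" "\<And>t. g (cis t) = (\<Sum>j\<in>A. z j * cis (of_int j * t))"
    using trig_polynomial_sum by blast
  have "norm (v - (\<Sum>j\<in>A. mode j (z j))) \<le> \<epsilon> / 2"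
  proof (rule norm_bound)
    fix t
    have "apply_bcontfun v (Arg (cis t)) = apply_bcontfun v t"
      using Arg_eq[of "cis t"] by (intro periodic2pi_cis_eq[OF per]) (simp add: cis_conv_exp)
    moreover have "apply_bcontfun (\<Sum>j\<in>A. mode j (z j)) t = g (cis t)"
      by (simp add: apply_mode apply_bcontfun_sum A(2))
    ultimately show "norm (apply_bcontfun (v - (\<Sum>j\<in>A. mode j (z j))) t) \<le> \<epsilon> / 2"
      using g(2)[of "cis t"] by simp
  qed
  then show ?thesis using A(1) \<open>0 < \<epsilon>\<close> by (intro exI[of _ A] exI[of _ z]) auto
qed

text \<open>Being orthogonal to every trigonometric sum \<open>s\<close>, the function
  \<open>v\<close> has mean square equal to its product with \<open>v - s\<close>, which density
  makes arbitrarily small.\<close>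

lemma fcoef_total:
  assumes v: "v \<in> circle_functions" and 0: "\<And>j. fcoef j v = 0"
  shows "v = 0"
proof -
  let ?Q = "integral {0..2*pi} (\<lambda>t. (norm (apply_bcontfun v t))\<^sup>2)"
  have Q0: "?Q \<ge> 0"
    by (intro integral_nonneg integrable_continuous_real continuous_intros continuous_on_apply_bcontfun) auto
  have "?Q \<le> 0 + \<epsilon>" if "\<epsilon> > 0" for \<epsilon>
  proof -
    \<comment> \<open>Chosen so that \<open>norm v * \<epsilon>'\<close> times the length
      \<open>2 * pi\<close> is at most \<open>\<epsilon>\<close>; the summand 1 keeps the
      denominator positive.\<close>
    define \<epsilon>' where "\<epsilon>' = \<epsilon> / (2 * pi * (norm v + 1))"
    have e: "\<epsilon>' > 0" unfolding \<epsilon>'_def using that by (intro divide_pos_pos mult_pos_pos) (auto intro: add_nonneg_pos)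
    obtain A z where A: "finite A" "norm (v - (\<Sum>j\<in>A. mode j (z j))) < \<epsilon>'"
      using modes_dense[OF v e] by blast
    define s where "s = (\<Sum>j\<in>A. mode j (z j))"
    have s: "apply_bcontfun s t = (\<Sum>j\<in>A. z j * cis (of_int j * t))" for t
      unfolding s_def by (simp add: apply_mode apply_bcontfun_sum)
    have "((\<lambda>t. \<Sum>j\<in>A. cnj (z j) * (apply_bcontfun v t * cis (- of_int j * t))) has_integral
        (\<Sum>j\<in>A. cnj (z j) * (2 * pi * fcoef j v))) {0..2*pi}"
      by (intro has_integral_sum A has_integral_mult_right fcoef_has_integral)
    moreover have "apply_bcontfun v t * cnj (apply_bcontfun s t)
        = (\<Sum>j\<in>A. cnj (z j) * (apply_bcontfun v t * cis (- of_int j * t)))" for t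
      by (simp add: s cnj_sum sum_distrib_left cis_cnj mult_ac)
    ultimately have "((\<lambda>t. apply_bcontfun v t * cnj (apply_bcontfun s t)) has_integral 0) {0..2*pi}"
      by (simp add: 0)
    from has_integral_diff[OF has_integral_mult_cnj this]
    have I: "((\<lambda>t. apply_bcontfun v t * cnj (apply_bcontfun (v - s) t)) has_integral of_real ?Q) {0..2*pi}"
      by (simp add: algebra_simps)
    have "norm (complex_of_real ?Q) \<le> (norm v * \<epsilon>') * measure lborel {0..2*pi}"
    proof (rule has_integral_bound_real[OF _ _ I, of _ "{}"])
      show "0 \<le> norm v * \<epsilon>'" using e by simp
      fix t
      show "norm (apply_bcontfun v t * cnj (apply_bcontfun (v - s) t)) \<le> norm v * \<epsilon>'"
        unfolding norm_mult complex_mod_cnj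
        using norm_bounded[of v t] norm_bounded[of "v - s" t] A(2)
        by (intro mult_mono) (auto simp: s_def)
    qed simp
    also have "\<dots> = \<epsilon> * (norm v / (norm v + 1))" by (simp add: \<epsilon>'_def)
    also have "\<dots> \<le> \<epsilon> * 1"
      using that by (intro mult_left_mono) (auto simp: divide_le_eq_1_pos add_nonneg_pos)
    finally show ?thesis using Q0 by simp
  qed
  then have "?Q \<le> 0" by (rule field_le_epsilon)
  then have Q: "?Q = 0" using Q0 by simp
  have cont: "continuous_on {0..2*pi} (\<lambda>t. (norm (apply_bcontfun v t))\<^sup>2)"
    by (intro continuous_on_power continuous_on_norm continuous_on_apply_bcontfun)
  have "apply_bcontfun v t = 0" if "t \<in> {0..2*pi}" for t
    using integral_eq_0_iff[OF cont] Q that by simp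
  then have "norm v \<le> 0" by (intro circle_functions_norm_le[OF v]) auto
  then show ?thesis by simp
qed

section \<open>The operator on the circle\<close>

definition smooth_circle :: "(real \<Rightarrow> complex) \<Rightarrow> bool" where
  "smooth_circle g \<longleftrightarrow> periodic2pi g \<and> (\<forall>t. g differentiable at t) \<and>
     continuous_on UNIV (\<lambda>t. vector_derivative g (at t))"

lemma smooth_circleI:
  assumes "periodic2pi g" "\<And>t. (g has_vector_derivative g' t) (at t)" "continuous_on UNIV g'"
  shows "smooth_circle g"
proof -
  have "(\<lambda>t. vector_derivative g (at t)) = g'"
    using assms(2) by (auto simp: vector_derivative_at)
  then show ?thesis
    using assms by (auto simp: smooth_circle_def intro: differentiableI_vector)
qed

lemma smooth_circle_deriv:
  "smooth_circle g \<Longrightarrow> (g has_vector_derivative vector_derivative g (at t)) (at t)"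
  by (simp add: smooth_circle_def vector_derivative_works[symmetric])

lemma smooth_circle_continuous:
  assumes "smooth_circle g"
  shows "continuous_on UNIV g"
  by (intro continuous_at_imp_continuous_on ballI has_vector_derivative_continuous[OF smooth_circle_deriv[OF assms]])

lemma smooth_circle_periodic: "smooth_circle g \<Longrightarrow> periodic2pi g"
  by (simp add: smooth_circle_def)

lemma smooth_circle_deriv_periodic:
  assumes "smooth_circle g"
  shows "periodic2pi (\<lambda>t. vector_derivative g (at t))"
proof -
  have "vector_derivative g (at (t + 2 * pi)) = vector_derivative g (at t)" for t
  proof -
    have "((\<lambda>s. g (s + 2 * pi)) has_vector_derivative vector_derivative g (at (t + 2 * pi))) (at t)"
    proof -
      have "((\<lambda>s. s + 2 * pi) has_vector_derivative 1) (at t)"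
        unfolding has_real_derivative_iff_has_vector_derivative[symmetric]
        by (auto intro!: derivative_eq_intros)
      from vector_diff_chain_at[OF this smooth_circle_deriv[OF assms]] show ?thesis
        by (simp add: o_def)
    qed
    moreover have "(\<lambda>s. g (s + 2 * pi)) = g"
      using smooth_circle_periodic[OF assms] by (auto simp: periodic2pi_def)
    ultimately show ?thesis by (simp add: vector_derivative_at)
  qed
  then show ?thesis by (simp add: periodic2pi_def)
qed

lemma periodic2pi_add: "periodic2pi f \<Longrightarrow> periodic2pi g \<Longrightarrow> periodic2pi (\<lambda>t. f t + g t)"
  by (simp add: periodic2pi_def)

lemma smooth_circle_add:
  assumes "smooth_circle f" "smooth_circle g"
  shows "smooth_circle (\<lambda>t. f t + g t)"
  using assms smooth_circle_deriv[OF assms(1)] smooth_circle_deriv[OF assms(2)]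
  by (intro smooth_circleI[where g' = "\<lambda>t. vector_derivative f (at t) + vector_derivative g (at t)"]
      has_vector_derivative_add periodic2pi_add continuous_on_add)
     (auto simp: smooth_circle_def)

lemma smooth_circle_scaleR:
  assumes "smooth_circle f"
  shows "smooth_circle (\<lambda>t. x *\<^sub>R f t)"
  using assms bounded_linear.has_vector_derivative[OF bounded_linear_scaleR_right smooth_circle_deriv[OF assms]]
  by (intro smooth_circleI[where g' = "\<lambda>t. x *\<^sub>R vector_derivative f (at t)"])
     (auto simp: smooth_circle_def periodic2pi_def intro!: continuous_intros)

lemma smooth_circle_zero: "smooth_circle (\<lambda>t. 0)"
  by (rule smooth_circleI[where g' = "\<lambda>t. 0"]) (auto simp: periodic2pi_def)

lemma smooth_circle_max:
  assumes "smooth_circle g"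
  obtains t where "\<And>s. norm (g s) \<le> norm (g t)"
proof -
  have "continuous_on {0..2*pi} (\<lambda>t. norm (g t))"
    using smooth_circle_continuous[OF assms] by (intro continuous_on_norm) (rule continuous_on_subset, auto)
  then obtain t where t: "\<And>s. s \<in> {0..2*pi} \<Longrightarrow> norm (g s) \<le> norm (g t)"
    using continuous_attains_sup[of "{0..2*pi}" "\<lambda>t. norm (g t)"] by force
  have "norm (g s) \<le> norm (g t)" for s
  proof -
    obtain s' where "0 \<le> s'" "s' < 2 * pi" "g s' = g s"
      using periodic2pi_reduce[OF smooth_circle_periodic[OF assms]] by blast
    with t[of s'] show ?thesis by simp
  qed
  with that show thesis by blast
qed

locale circle_operator =
  fixes lam :: complex and nu :: real and c :: "real \<Rightarrow> complex"
  assumes Re_lam: "0 < Re lam" and Im_lam: "Im lam \<noteq> 0"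
    and c_periodic: "periodic2pi c" and c_continuous: "continuous_on UNIV c"
begin

definition P :: "(real \<Rightarrow> complex) \<Rightarrow> real \<Rightarrow> complex" where
  "P g t = - \<i> * lam * vector_derivative g (at t) + lam * of_real nu * g t + \<i> * c t * cnj (g t)"

lemma lam_nonzero: "lam \<noteq> 0"
  using Re_lam by auto

lemma P_continuous:
  assumes "smooth_circle g"
  shows "continuous_on UNIV (P g)"
  unfolding P_def[abs_def] using assms smooth_circle_continuous[OF assms] c_continuous
  by (intro continuous_intros) (auto simp: smooth_circle_def)

lemma P_periodic:
  assumes "smooth_circle g"
  shows "periodic2pi (P g)"
  using smooth_circle_deriv_periodic[OF assms] smooth_circle_periodic[OF assms] c_periodic
  by (simp add: P_def periodic2pi_def)

lemma P_add:
  assumes "smooth_circle f" "smooth_circle g"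
  shows "P (\<lambda>t. f t + g t) t = P f t + P g t"
proof -
  have "vector_derivative (\<lambda>t. f t + g t) (at t) = vector_derivative f (at t) + vector_derivative g (at t)"
    using smooth_circle_deriv[OF assms(1)] smooth_circle_deriv[OF assms(2)]
    by (intro vector_derivative_at has_vector_derivative_add)
  then show ?thesis by (simp add: P_def algebra_simps)
qed

lemma P_scaleR:
  assumes "smooth_circle f"
  shows "P (\<lambda>t. x *\<^sub>R f t) t = x *\<^sub>R P f t"
proof -
  have "vector_derivative (\<lambda>t. x *\<^sub>R f t) (at t) = x *\<^sub>R vector_derivative f (at t)"
    by (intro vector_derivative_at bounded_linear.has_vector_derivative[OF bounded_linear_scaleR_right]
        smooth_circle_deriv[OF assms])
  then show ?thesis by (simp add: P_def algebra_simps)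
qed

lemma P_zero: "P (\<lambda>t. 0) t = 0"
  by (simp add: P_def)

lemma deriv_P:
  assumes "smooth_circle g"
  shows "(g has_vector_derivative \<i> * (P g t / lam) - \<i> * of_real nu * g t + c t / lam * cnj (g t)) (at t)"
proof -
  have "\<i> * (P g t / lam) - \<i> * of_real nu * g t + c t / lam * cnj (g t) = vector_derivative g (at t)"
    unfolding P_def using lam_nonzero by (simp add: field_simps)
  then show ?thesis using smooth_circle_deriv[OF assms] by simp
qed

section \<open>The maximum principle and Wronskian identities\<close>

lemma cnj_mult_deriv:
  assumes "smooth_circle u" "smooth_circle v"
  shows "((\<lambda>t. cnj (u t) * v t) has_vector_derivative
     cnj (u t) * (\<i> * (P v t / lam) - \<i> * of_real nu * v t + c t / lam * cnj (v t))
     + cnj (\<i> * (P u t / lam) - \<i> * of_real nu * u t + c t / lam * cnj (u t)) * v t) (at t)"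
  by (intro has_vector_derivative_mult bounded_linear.has_vector_derivative[OF bounded_linear_cnj] deriv_P assms)

lemma Re_i_over_lam: "Re (\<i> / lam) = Im lam / (norm lam)\<^sup>2"
  by (simp add: Re_divide cmod_power2)

lemma c_bounded: "\<exists>B\<ge>0. \<forall>t. norm (c t) \<le> B"
  using norm_bounded[of "circle_fun c"] apply_circle_fun[OF c_continuous c_periodic] norm_ge_zero
  by metis

definition cbound :: real where "cbound = (SOME B. 0 \<le> B \<and> (\<forall>t. norm (c t) \<le> B))"

lemma cbound: "0 \<le> cbound" "norm (c t) \<le> cbound"
  unfolding cbound_def using someI_ex[of "\<lambda>B. 0 \<le> B \<and> (\<forall>t. norm (c t) \<le> B)"] c_bounded by blast+

text \<open>Chosen so that \<open>mu * Im lam / (norm lam)\<^sup>2\<close> equals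
  \<open>(cbound + 1) / norm lam\<close>, whatever the sign of \<open>Im lam\<close>. The part
  \<open>cbound\<close> absorbs the term with \<open>c\<close>; the part 1 makes the constant in the
  a priori estimate exactly 1.\<close>

definition mu :: real where "mu = (cbound + 1) * norm lam / Im lam"

text \<open>Maximum principle: at a maximum of the modulus the derivative of its square vanishes, and for this
  large real shift the zeroth order term dominates.\<close>

lemma apriori_estimate:
  assumes g: "smooth_circle g" and B: "\<And>t. norm (P g t - mu *\<^sub>R g t) \<le> B"
  shows "norm (g t) \<le> B"
proof -
  obtain t0 where t0: "\<And>s. norm (g s) \<le> norm (g t0)" using smooth_circle_max[OF g] by blast
  let ?d = "\<i> * (P g t0 / lam) - \<i> * of_real nu * g t0 + c t0 / lam * cnj (g t0)"
  let ?f = "P g t0 - mu *\<^sub>R g t0"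
  let ?n = "norm (g t0)"
  have "((\<lambda>t. Re (cnj (g t) * g t)) has_vector_derivative Re (cnj (g t0) * ?d + cnj ?d * g t0)) (at t0)"
    by (rule bounded_linear.has_vector_derivative[OF bounded_linear_Re cnj_mult_deriv[OF g g]])
  moreover have "Re (cnj z * z) = (norm z)\<^sup>2" for z
    by (simp add: cmod_power2 flip: power2_eq_square)
  ultimately have "((\<lambda>t. (norm (g t))\<^sup>2) has_real_derivative Re (cnj (g t0) * ?d + cnj ?d * g t0)) (at t0)"
    by (simp only: has_real_derivative_iff_has_vector_derivative)
  then have "Re (cnj (g t0) * ?d + cnj ?d * g t0) = 0"
    by (rule DERIV_local_max[where d = 1]) (use t0 in \<open>auto intro!: power_mono\<close>)
  moreover have "Re (cnj a * b) = Re (cnj b * a)" for a b by (simp add: mult.commute)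
  then have "Re (cnj ?d * g t0) = Re (cnj (g t0) * ?d)" .
  ultimately have 0: "Re (cnj (g t0) * ?d) = 0" by simp
  have "cnj (g t0) * ?d = \<i> / lam * ?f * cnj (g t0) + mu *\<^sub>R (\<i> / lam * (g t0 * cnj (g t0)))
      - \<i> * of_real nu * (g t0 * cnj (g t0)) + c t0 / lam * (cnj (g t0))\<^sup>2"
    by (simp add: algebra_simps power2_eq_square scaleR_conv_of_real)
  also have "\<dots> = \<i> / lam * ?f * cnj (g t0) + (mu * ?n\<^sup>2) *\<^sub>R (\<i> / lam)
      - (nu * ?n\<^sup>2) *\<^sub>R \<i> + c t0 / lam * (cnj (g t0))\<^sup>2"
    unfolding complex_norm_square[symmetric] by (simp add: scaleR_conv_of_real mult_ac)
  \<comment> \<open>The term with \<open>nu\<close> is purely imaginary and drops out of the real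
    part.\<close>
  finally have "0 = Re (\<i> / lam * ?f * cnj (g t0)) + mu * ?n\<^sup>2 * (Im lam / (norm lam)\<^sup>2)
      + Re (c t0 / lam * (cnj (g t0))\<^sup>2)"
    using 0 Re_i_over_lam by simp
  then have "mu * ?n\<^sup>2 * (Im lam / (norm lam)\<^sup>2) \<le>
      norm (\<i> / lam * ?f * cnj (g t0)) + norm (c t0 / lam * (cnj (g t0))\<^sup>2)"
    using abs_Re_le_cmod[of "\<i> / lam * ?f * cnj (g t0)"] abs_Re_le_cmod[of "c t0 / lam * (cnj (g t0))\<^sup>2"]
    by linarith
  also have "\<dots> = norm ?f * ?n / norm lam + norm (c t0) * ?n\<^sup>2 / norm lam"
    by (simp add: norm_mult norm_divide norm_power)
  also have "\<dots> \<le> B * ?n / norm lam + cbound * ?n\<^sup>2 / norm lam"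
    using B[of t0] cbound(2)[of t0] by (intro add_mono divide_right_mono mult_right_mono) auto
  also have "mu * ?n\<^sup>2 * (Im lam / (norm lam)\<^sup>2) = (cbound + 1) * ?n\<^sup>2 / norm lam"
    using Im_lam lam_nonzero by (simp add: mu_def power2_eq_square)
  finally have "(cbound + 1) * ?n\<^sup>2 / norm lam \<le> (B * ?n + cbound * ?n\<^sup>2) / norm lam"
    by (simp add: add_divide_distrib)
  then have "(cbound + 1) * ?n\<^sup>2 \<le> B * ?n + cbound * ?n\<^sup>2"
    using lam_nonzero by (simp add: divide_le_cancel)
  then have "?n * ?n \<le> B * ?n"
    by (simp add: algebra_simps power2_eq_square)
  moreover have "0 \<le> B" using B[of t0] norm_ge_zero order_trans by blast
  ultimately have "?n \<le> B"
    by (cases "?n = 0") auto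
  then show ?thesis using t0[of t] by linarith
qed

text \<open>In the derivative of \<open>cnj u * v\<close> the terms with \<open>nu\<close> cancel,
  and the two terms with \<open>c\<close> are conjugate to each other, so they have no imaginary
  part.\<close>

lemma wronskian_deriv:
  assumes u: "smooth_circle u" and v: "smooth_circle v"
  shows "((\<lambda>t. Im (cnj (u t) * v t)) has_real_derivative
     Re (cnj (u t) * P v t / lam) - Re (cnj (v t) * P u t / lam)) (at t)"
proof -
  have aux: "Im (cnj a * (\<i> * y - \<i> * of_real nu * b + z * cnj b)
     + cnj (\<i> * x - \<i> * of_real nu * a + z * cnj a) * b) = Re (cnj a * y) - Re (cnj b * x)" for a b x y z
    by (simp add: algebra_simps)
  show ?thesis
    using bounded_linear.has_vector_derivative[OF bounded_linear_Im cnj_mult_deriv[OF u v], of t, unfolded aux]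
    by (simp only: has_real_derivative_iff_has_vector_derivative times_divide_eq_right)
qed

text \<open>The real form of an eigenvector: in the coordinate
  \<open>z \<mapsto> Re z *\<^sub>R u + Im z *\<^sub>R v\<close> the operator \<open>P\<close> is
  multiplication by the complex number with real part \<alpha> and imaginary part \<beta>.\<close>

definition spectral_pair :: "real \<Rightarrow> real \<Rightarrow> (real \<Rightarrow> complex) \<Rightarrow> (real \<Rightarrow> complex) \<Rightarrow> bool" where
  "spectral_pair \<alpha> \<beta> u v \<longleftrightarrow> smooth_circle u \<and> smooth_circle v \<and>
     (\<forall>t. P u t = \<alpha> *\<^sub>R u t + \<beta> *\<^sub>R v t) \<and> (\<forall>t. P v t = \<alpha> *\<^sub>R v t - \<beta> *\<^sub>R u t)"

text \<open>The exponential weight is the integrating factor of the equation satisfied by the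
  Wronskian of a spectral pair.\<close>

definition energy :: "real \<Rightarrow> (real \<Rightarrow> complex) \<Rightarrow> (real \<Rightarrow> complex) \<Rightarrow> real" where
  "energy \<alpha> u v = integral {0..2*pi}
     (\<lambda>t. exp (- (2 * \<alpha> * Im lam / (norm lam)\<^sup>2) * t) * ((norm (u t))\<^sup>2 + (norm (v t))\<^sup>2))"

lemma energy_nonneg: 
  assumes "smooth_circle u" "smooth_circle v"
  shows "energy \<alpha> u v \<ge> 0"
    and "energy \<alpha> u v = 0 \<Longrightarrow> u t = 0 \<and> v t = 0"
proof -
  let ?f = "\<lambda>t. exp (- (2 * \<alpha> * Im lam / (norm lam)\<^sup>2) * t) * ((norm (u t))\<^sup>2 + (norm (v t))\<^sup>2)"
  have cont: "continuous_on {0..2*pi} ?f"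
    using smooth_circle_continuous[OF assms(1)] smooth_circle_continuous[OF assms(2)]
    by (intro continuous_intros) (auto intro: continuous_on_subset)
  show "energy \<alpha> u v \<ge> 0"
    unfolding energy_def by (intro integral_nonneg integrable_continuous_real cont) auto
  assume "energy \<alpha> u v = 0"
  then have *: "u s = 0 \<and> v s = 0" if "s \<in> {0..2*pi}" for s
    using integral_eq_0_iff[OF cont] that unfolding energy_def by (auto simp: add_nonneg_eq_0_iff)
  obtain s where s: "0 \<le> s" "s < 2 * pi" "(\<lambda>t. (u t, v t)) s = (\<lambda>t. (u t, v t)) t"
    using periodic2pi_reduce[of "\<lambda>t. (u t, v t)"] smooth_circle_periodic[OF assms(1)]
      smooth_circle_periodic[OF assms(2)] by (auto simp: periodic2pi_def)
  with *[of s] show "u t = 0 \<and> v t = 0" by simp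
qed

text \<open>Integrating the Wronskian identity of a spectral pair over a period.\<close>

lemma spectral_pair_wronskian:
  assumes "spectral_pair \<alpha> \<beta> u v"
  shows "Im (cnj (u 0) * v 0) * (exp (- (2 * \<alpha> * Im lam / (norm lam)\<^sup>2) * (2 * pi)) - 1)
     = - (\<beta> * Re lam / (norm lam)\<^sup>2) * energy \<alpha> u v"
proof -
  have u: "smooth_circle u" and v: "smooth_circle v" using assms by (auto simp: spectral_pair_def)
  define \<kappa> where "\<kappa> = 2 * \<alpha> * Im lam / (norm lam)\<^sup>2"
  define k where "k = \<beta> * Re lam / (norm lam)\<^sup>2"
  let ?W = "\<lambda>t. Im (cnj (u t) * v t)" and ?N = "\<lambda>t. (norm (u t))\<^sup>2 + (norm (v t))\<^sup>2"
  have W: "(?W has_real_derivative \<kappa> * ?W t - k * ?N t) (at t)" for t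
  proof -
    have eqs: "P v t = \<alpha> *\<^sub>R v t - \<beta> *\<^sub>R u t" "P u t = \<alpha> *\<^sub>R u t + \<beta> *\<^sub>R v t"
      using assms by (auto simp: spectral_pair_def)
    have "cnj (u t) * P v t / lam - cnj (v t) * P u t / lam
        = (\<alpha> *\<^sub>R (cnj (u t) * v t - cnj (v t) * u t) - \<beta> *\<^sub>R (u t * cnj (u t) + v t * cnj (v t))) / lam"
      unfolding eqs
      by (simp add: algebra_simps diff_divide_distrib add_divide_distrib scaleR_conv_of_real)
    also have "cnj (u t) * v t - cnj (v t) * u t = of_real (2 * ?W t) * \<i>"
      by (simp add: complex_eq_iff)
    also have "u t * cnj (u t) + v t * cnj (v t) = of_real (?N t)"
      by (simp add: complex_norm_square del: of_real_power)
    finally have "Re (cnj (u t) * P v t / lam) - Re (cnj (v t) * P u t / lam)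
        = Re ((\<alpha> *\<^sub>R (of_real (2 * ?W t) * \<i>) - \<beta> *\<^sub>R of_real (?N t)) / lam)"
      by (metis minus_complex.simps(1))
    also have "(\<alpha> *\<^sub>R (of_real (2 * ?W t) * \<i>) - \<beta> *\<^sub>R of_real (?N t)) / lam
        = (\<alpha> * (2 * ?W t)) *\<^sub>R (\<i> / lam) - (\<beta> * ?N t) *\<^sub>R (1 / lam)"
      by (simp add: scaleR_conv_of_real diff_divide_distrib)
    also have "Re \<dots> = \<kappa> * ?W t - k * ?N t"
      unfolding minus_complex.simps scaleR_complex.simps Re_i_over_lam
      by (simp add: \<kappa>_def k_def Re_divide cmod_power2 algebra_simps add_divide_distrib diff_divide_distrib)
    finally show ?thesis using wronskian_deriv[OF u v, of t] by simp
  qed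
  have "((\<lambda>t. exp (- \<kappa> * t) * ?W t) has_vector_derivative - k * (exp (- \<kappa> * t) * ?N t)) (at t within {0..2*pi})" for t
  proof -
    have "((\<lambda>t. exp (- \<kappa> * t) * ?W t) has_real_derivative
       (exp (- \<kappa> * t) * (- \<kappa>)) * ?W t + (\<kappa> * ?W t - k * ?N t) * exp (- \<kappa> * t)) (at t)"
      by (rule DERIV_mult[OF _ W]) (auto intro!: derivative_eq_intros)
    moreover have "(E * (- \<kappa>)) * W + (\<kappa> * W - k * N) * E = - k * (E * N)" for E W N
      by (simp add: algebra_simps)
    ultimately show ?thesis
      unfolding has_real_derivative_iff_has_vector_derivative
      by (simp only: has_vector_derivative_at_within)
  qed
  then have I: "((\<lambda>t. - k * (exp (- \<kappa> * t) * ?N t)) has_integral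
      (exp (- \<kappa> * (2 * pi)) * ?W (2 * pi) - exp (- \<kappa> * 0) * ?W 0)) {0..2*pi}"
    by (intro fundamental_theorem_of_calculus) auto
  have per: "?W (2 * pi) = ?W 0"
  proof -
    have "u (0 + 2 * pi) = u 0" "v (0 + 2 * pi) = v 0"
      using smooth_circle_periodic[OF u] smooth_circle_periodic[OF v] unfolding periodic2pi_def by blast+
    then show ?thesis by simp
  qed
  have "e * w - exp (- \<kappa> * 0) * w = w * (e - 1)" for e w :: real
    by (simp add: algebra_simps)
  then have "integral {0..2*pi} (\<lambda>t. - k * (exp (- \<kappa> * t) * ?N t)) = ?W 0 * (exp (- \<kappa> * (2 * pi)) - 1)"
    unfolding integral_unique[OF I] per .
  then show ?thesis by (simp add: energy_def \<kappa>_def k_def)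
qed

text \<open>With a vanishing left side, the integrated identity forces the energy to be zero,
  because \<open>\<beta> * Re lam \<noteq> 0\<close>.\<close>

lemma spectral_pair_zero:
  assumes "spectral_pair \<alpha> \<beta> u v" "\<beta> \<noteq> 0" "Im (cnj (u 0) * v 0) = 0"
  shows "u t = 0 \<and> v t = 0"
proof -
  have "energy \<alpha> u v = 0"
    using spectral_pair_wronskian[OF assms(1)] assms(2,3) Re_lam lam_nonzero by simp
  then show ?thesis using energy_nonneg(2) assms(1) by (auto simp: spectral_pair_def)
qed

text \<open>Both integrated identities contain the same factor \<open>E\<close>, multiplied by a
  positive Wronskian. Their right sides have opposite signs, as the energies are positive and
  \<beta> changes sign.\<close>

lemma spectral_pair_opposite:
  assumes "spectral_pair \<alpha> \<beta> u v" "spectral_pair \<alpha> (- \<beta>) u' v'"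
    and "Im (cnj (u 0) * v 0) > 0" "Im (cnj (u' 0) * v' 0) > 0"
  shows "\<beta> = 0"
proof (rule ccontr)
  assume "\<beta> \<noteq> 0"
  define E where "E = exp (- (2 * \<alpha> * Im lam / (norm lam)\<^sup>2) * (2 * pi)) - 1"
  define k where "k = \<beta> * Re lam / (norm lam)\<^sup>2"
  have k: "k \<noteq> 0" using \<open>\<beta> \<noteq> 0\<close> Re_lam lam_nonzero by (simp add: k_def)
  have pos: "energy \<alpha> u v > 0" "energy \<alpha> u' v' > 0"
    using assms energy_nonneg[of u v \<alpha>] energy_nonneg[of u' v' \<alpha>]
    by (auto simp: spectral_pair_def order_less_le)
  have 1: "Im (cnj (u 0) * v 0) * E = - k * energy \<alpha> u v"
    using spectral_pair_wronskian[OF assms(1)] by (simp add: E_def k_def)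
  have 2: "Im (cnj (u' 0) * v' 0) * E = k * energy \<alpha> u' v'"
    using spectral_pair_wronskian[OF assms(2)] by (simp add: E_def k_def)
  show False
  proof (cases "k > 0")
    case True
    with 1 2 pos assms(3,4) have "E < 0" "E > 0"
      by (metis mult_minus_left mult_pos_pos neg_less_0_iff_less zero_less_mult_pos mult_less_0_iff order_less_asym)+
    then show False by simp
  next
    case False
    with k have "k < 0" by simp
    with 1 2 pos assms(3,4) have "E > 0" "E < 0"
      by (metis mult_minus_left mult_neg_pos neg_0_less_iff_less zero_less_mult_pos mult_less_0_iff order_less_asym)+
    then show False by simp
  qed
qed

end

section \<open>Basic solutions and winding numbers\<close>

text \<open>If the winding numbers differ, the phase difference \<open>D\<close> changes by at least
  a full turn over one period, so \<open>sin (D t)\<close> takes the values 1 and -1 and the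
  imaginary part changes sign.\<close>

lemma has_winding_unique:
  assumes "has_winding f i" "has_winding g j"
    and sgn: "(\<forall>t. 0 \<le> Im (cnj (f t) * g t)) \<or> (\<forall>t. Im (cnj (f t) * g t) \<le> 0)"
  shows "i = j"
proof (rule ccontr)
  assume "i \<noteq> j"
  obtain \<theta> where \<theta>: "continuous_on UNIV \<theta>" "\<And>t. f t = of_real (norm (f t)) * cis (\<theta> t)"
     "\<And>t. \<theta> (t + 2 * pi) - \<theta> t = 2 * pi * of_int i"
    using assms(1) unfolding has_winding_def cis_conv_exp by blast
  obtain \<theta>' where \<theta>': "continuous_on UNIV \<theta>'" "\<And>t. g t = of_real (norm (g t)) * cis (\<theta>' t)"
     "\<And>t. \<theta>' (t + 2 * pi) - \<theta>' t = 2 * pi * of_int j"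
    using assms(2) unfolding has_winding_def cis_conv_exp by blast
  have nz: "f t \<noteq> 0" "g t \<noteq> 0" for t using assms(1,2) by (auto simp: has_winding_def)
  define D where "D t = \<theta>' t - \<theta> t" for t
  have contD: "continuous_on S D" for S
    unfolding D_def using \<theta>(1) \<theta>'(1) by (intro continuous_on_diff) (auto intro: continuous_on_subset)
  have "cnj (f t) * g t = of_real (norm (f t) * norm (g t)) * cis (D t)" for t
  proof -
    have "cnj (f t) * g t = cnj (of_real (norm (f t)) * cis (\<theta> t)) * (of_real (norm (g t)) * cis (\<theta>' t))"
      using \<theta>(2)[of t] \<theta>'(2)[of t] by simp
    also have "\<dots> = of_real (norm (f t) * norm (g t)) * (cis (- \<theta> t) * cis (\<theta>' t))"
      by (simp add: cis_cnj mult_ac)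
    finally show ?thesis by (simp add: cis_mult D_def)
  qed
  then have ImD: "Im (cnj (f t) * g t) = norm (f t) * norm (g t) * sin (D t)" for t
    by simp
  define a where "a = min (D 0) (D (2 * pi))"
  have len: "D (2 * pi) - D 0 = 2 * pi * of_int (j - i)"
    using \<theta>(3)[of 0] \<theta>'(3)[of 0] by (simp add: D_def algebra_simps)
  have "1 \<le> \<bar>real_of_int (j - i)\<bar>" using \<open>i \<noteq> j\<close> by linarith
  then have "2 * pi * 1 \<le> 2 * pi * \<bar>real_of_int (j - i)\<bar>" by (intro mult_left_mono) auto
  then have len': "2 * pi \<le> \<bar>D (2 * pi) - D 0\<bar>"
    unfolding len by (simp add: abs_mult)
  have hit: "\<exists>t. D t = y" if "a \<le> y" "y \<le> a + 2 * pi" for y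
  proof (cases "D 0 \<le> D (2 * pi)")
    case True
    then have "D 0 \<le> y" "y \<le> D (2 * pi)" using that len' by (auto simp: a_def)
    then show ?thesis using IVT'[of D 0 y "2 * pi"] contD by auto
  next
    case False
    then have "D (2 * pi) \<le> y" "y \<le> D 0" using that len' by (auto simp: a_def)
    then show ?thesis using IVT2'[of D "2 * pi" y 0] contD by auto
  qed
  have hit_sin: "\<exists>t. sin (D t) = sin x" for x
  proof -
    \<comment> \<open>The number of turns that moves \<open>x\<close> into the interval from
      \<open>a\<close> to \<open>a + 2 * pi\<close>, all of whose points are values of
      \<open>D\<close>.\<close>
    define n where "n = \<lceil>(a - x) / (2 * pi)\<rceil>"
    have 1: "(a - x) / (2 * pi) \<le> of_int n" unfolding n_def by (rule le_of_int_ceiling)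
    have 2: "of_int n < (a - x) / (2 * pi) + 1" unfolding n_def using ceiling_correct[of "(a - x) / (2 * pi)"] by linarith
    have "a \<le> x + 2 * pi * of_int n" using 1 by (simp add: field_simps)
    moreover have "x + 2 * pi * of_int n \<le> a + 2 * pi" using 2 by (simp add: field_simps)
    ultimately obtain t where "D t = x + 2 * pi * of_int n" using hit by blast
    then have "sin (D t) = sin x" using sin_cos_eq_iff[of "D t" x] by blast
    then show ?thesis by blast
  qed
  obtain t1 where t1: "sin (D t1) = 1" using hit_sin[of "pi / 2"] by auto
  obtain t2 where t2: "sin (D t2) = -1" using hit_sin[of "- (pi / 2)"] by auto
  have "Im (cnj (f t1) * g t1) > 0" "Im (cnj (f t2) * g t2) < 0"
    unfolding ImD t1 t2 using nz by auto
  then show False using sgn by (meson not_less)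
qed

lemma has_winding_scale:
  assumes "has_winding f j" "0 < x"
  shows "has_winding (\<lambda>t. of_real x * f t) j"
proof -
  obtain \<theta> where \<theta>: "continuous_on UNIV \<theta>" "\<And>t. f t = of_real (norm (f t)) * exp (\<i> * of_real (\<theta> t))"
     "\<And>t. \<theta> (t + 2 * pi) - \<theta> t = 2 * pi * of_int j"
    using assms(1) unfolding has_winding_def by blast
  have "of_real x * f t = of_real (norm (of_real x * f t)) * exp (\<i> * of_real (\<theta> t))" for t
    using arg_cong[OF \<theta>(2), of "(*) (of_real x)"] assms(2) by (simp add: norm_mult mult.assoc)
  with \<theta>(1,3) show ?thesis
    using assms unfolding has_winding_def by (auto intro!: continuous_intros)
qed

lemma of_real_powr_polar:
  "0 < r \<Longrightarrow> (of_real r :: complex) powr s = of_real (r powr Re s) * cis (Im s * ln r)"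
proof -
  assume r: "0 < r"
  then have "(of_real r :: complex) powr s = exp (s * of_real (ln r))"
    by (simp add: powr_def Ln_of_real)
  also have "\<dots> = of_real (exp (Re s * ln r)) * cis (Im s * ln r)"
    by (subst exp_eq_polar) simp
  finally show ?thesis using r by (simp add: powr_def)
qed

section \<open>Slices of solutions, and basic solutions as spectral pairs\<close>

context circle_operator
begin

text \<open>Multiplying the equation by \<open>- \<i>\<close> isolates \<open>P (u r)\<close> and
  leaves the radial derivative times \<open>r\<close>.\<close>

lemma L_solution_slice:
  assumes "L_solution lam nu c \<delta> R u"
  obtains ur where "continuous_on (cyl \<delta> R) (\<lambda>(r, t). ur r t)"
    "\<And>r t. (r, t) \<in> cyl \<delta> R \<Longrightarrow> ((\<lambda>\<rho>. u \<rho> t) has_vector_derivative ur r t) (at r)"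
    "\<And>r t. (r, t) \<in> cyl \<delta> R \<Longrightarrow> P (u r) t = r *\<^sub>R ur r t"
    "\<And>r t. (r, t) \<in> cyl \<delta> R \<Longrightarrow> smooth_circle (u r)"
proof -
  obtain ur ut where per: "\<forall>r t. (r, t) \<in> cyl \<delta> R \<longrightarrow> u r (t + 2 * pi) = u r t"
    and cur: "continuous_on (cyl \<delta> R) (\<lambda>(r, t). ur r t)"
    and cut: "continuous_on (cyl \<delta> R) (\<lambda>(r, t). ut r t)"
    and eq: "\<forall>r t. (r, t) \<in> cyl \<delta> R \<longrightarrow>
           ((\<lambda>\<rho>. u \<rho> t) has_vector_derivative ur r t) (at r) \<and>
           ((\<lambda>s. u r s) has_vector_derivative ut r t) (at t) \<and>
           lam * ut r t - \<i> * of_real r * ur r t + \<i> * lam * of_real nu * u r t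
             - c t * cnj (u r t) = 0"
    using assms unfolding L_solution_def by blast
  have cyl: "(r, s) \<in> cyl \<delta> R" if "(r, t) \<in> cyl \<delta> R" for r s t
    using that by (simp add: cyl_def)
  show thesis
  proof (rule that[OF cur])
    fix r t assume rt: "(r, t) \<in> cyl \<delta> R"
    show "((\<lambda>\<rho>. u \<rho> t) has_vector_derivative ur r t) (at r)" using eq rt by blast
    have d: "(u r has_vector_derivative ut r s) (at s)" for s using eq cyl[OF rt] by blast
    have e: "lam * ut r t - \<i> * of_real r * ur r t + \<i> * lam * of_real nu * u r t - c t * cnj (u r t) = 0"
      using eq rt by blast
    have "vector_derivative (u r) (at t) = ut r t" using d by (rule vector_derivative_at)
    then have "P (u r) t - r *\<^sub>R ur r t =
        - \<i> * (lam * ut r t - \<i> * of_real r * ur r t + \<i> * lam * of_real nu * u r t - c t * cnj (u r t))"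
      by (simp add: P_def algebra_simps scaleR_conv_of_real)
    then show "P (u r) t = r *\<^sub>R ur r t" unfolding e by simp
    have "continuous_on UNIV (\<lambda>s. (case (r, s) of (r, t) \<Rightarrow> ut r t))"
      by (rule continuous_on_compose2[OF cut]) (auto intro!: continuous_intros cyl[OF rt])
    then show "smooth_circle (u r)"
      using per cyl[OF rt] by (intro smooth_circleI[OF _ d]) (auto simp: periodic2pi_def)
  qed
qed

text \<open>The radial derivative times \<open>r\<close> acts on the two factors with cosine and
  sine by a 2 by 2 matrix with entries \<open>\<alpha>\<close> and \<open>\<beta>\<close>; by
  uniqueness of the derivative this is also \<open>P\<close> of the slice. Only the slices of
  \<open>w\<close> are known to be smooth, so no regularity of \<open>u\<close> and \<open>v\<close>
  enters.\<close>

lemma P_of_separated: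
  assumes L: "L_solution lam nu c 0 PInfty w"
    and w: "\<And>r t. 0 < r \<Longrightarrow> w r t = (r powr \<alpha>) *\<^sub>R (cos (\<beta> * ln r) *\<^sub>R u t + sin (\<beta> * ln r) *\<^sub>R v t)"
    and r: "0 < r"
  shows "smooth_circle (w r)"
    and "P (w r) t = (r powr \<alpha>) *\<^sub>R (cos (\<beta> * ln r) *\<^sub>R (\<alpha> *\<^sub>R u t + \<beta> *\<^sub>R v t)
           + sin (\<beta> * ln r) *\<^sub>R (\<alpha> *\<^sub>R v t - \<beta> *\<^sub>R u t))"
proof -
  obtain ur where ur: "\<And>r t. (r, t) \<in> cyl 0 PInfty \<Longrightarrow> ((\<lambda>\<rho>. w \<rho> t) has_vector_derivative ur r t) (at r)"
    "\<And>r t. (r, t) \<in> cyl 0 PInfty \<Longrightarrow> P (w r) t = r *\<^sub>R ur r t"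
    "\<And>r t. (r, t) \<in> cyl 0 PInfty \<Longrightarrow> smooth_circle (w r)"
    using L_solution_slice[OF L] by metis
  have cyl: "(r, t) \<in> cyl 0 PInfty" for t using r by (simp add: cyl_def)
  show "smooth_circle (w r)" by (rule ur(3)[OF cyl])
  let ?C = "cos (\<beta> * ln r)" and ?S = "sin (\<beta> * ln r)"
  have d1: "((\<lambda>r. r powr \<alpha> * cos (\<beta> * ln r)) has_real_derivative
      (r powr \<alpha> / r) * (\<alpha> * ?C - \<beta> * ?S)) (at r)"
    using r by (auto intro!: derivative_eq_intros simp: powr_diff field_simps)
  have d2: "((\<lambda>r. r powr \<alpha> * sin (\<beta> * ln r)) has_real_derivative
      (r powr \<alpha> / r) * (\<alpha> * ?S + \<beta> * ?C)) (at r)"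
    using r by (auto intro!: derivative_eq_intros simp: powr_diff field_simps)
  have "((\<lambda>r. (r powr \<alpha> * cos (\<beta> * ln r)) *\<^sub>R u t + (r powr \<alpha> * sin (\<beta> * ln r)) *\<^sub>R v t) has_vector_derivative
      ((r powr \<alpha> / r) * (\<alpha> * ?C - \<beta> * ?S)) *\<^sub>R u t + ((r powr \<alpha> / r) * (\<alpha> * ?S + \<beta> * ?C)) *\<^sub>R v t) (at r)"
    using d1 d2 unfolding has_real_derivative_iff_has_vector_derivative
    by (intro has_vector_derivative_add bounded_linear.has_vector_derivative[OF bounded_linear_scaleR_left])
  then have "((\<lambda>\<rho>. w \<rho> t) has_vector_derivative
      ((r powr \<alpha> / r) * (\<alpha> * ?C - \<beta> * ?S)) *\<^sub>R u t + ((r powr \<alpha> / r) * (\<alpha> * ?S + \<beta> * ?C)) *\<^sub>R v t) (at r)"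
  proof (rule has_vector_derivative_transform_within_open[of _ _ _ "{0<..}"])
    fix x :: real assume "x \<in> {0<..}"
    then show "(x powr \<alpha> * cos (\<beta> * ln x)) *\<^sub>R u t + (x powr \<alpha> * sin (\<beta> * ln x)) *\<^sub>R v t = w x t"
      by (simp add: w scaleR_add_right)
  qed (use r in auto)
  with ur(1)[OF cyl] have "ur r t =
      ((r powr \<alpha> / r) * (\<alpha> * ?C - \<beta> * ?S)) *\<^sub>R u t + ((r powr \<alpha> / r) * (\<alpha> * ?S + \<beta> * ?C)) *\<^sub>R v t"
    using vector_derivative_unique_at by blast
  then have "P (w r) t = (r powr \<alpha> * (\<alpha> * ?C - \<beta> * ?S)) *\<^sub>R u t + (r powr \<alpha> * (\<alpha> * ?S + \<beta> * ?C)) *\<^sub>R v t"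
    using ur(2)[OF cyl, of t] r by (simp add: scaleR_add_right)
  then show "P (w r) t = (r powr \<alpha>) *\<^sub>R (?C *\<^sub>R (\<alpha> *\<^sub>R u t + \<beta> *\<^sub>R v t) + ?S *\<^sub>R (\<alpha> *\<^sub>R v t - \<beta> *\<^sub>R u t))"
    by (simp add: algebra_simps)
qed

text \<open>For a nonreal exponent the partner is
  \<open>v t = \<i> * (\<phi> t - cnj (\<psi> t))\<close>. Then \<open>w 1 t - \<i> * v t\<close> is
  twice \<open>\<phi> t\<close>, which carries the winding number, and the Wronskian is the positive
  difference of the squared moduli of \<open>\<phi>\<close> and \<open>\<psi>\<close>. For a real
  exponent the partner is 0.\<close>

lemma basic_solution_pair:
  assumes "basic_solution lam nu c w \<sigma> j"
  shows "\<exists>v. spectral_pair (Re \<sigma>) (Im \<sigma>) (w 1) v \<and>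
    (\<forall>r t. 0 < r \<longrightarrow>
       w r t = (r powr Re \<sigma>) *\<^sub>R (cos (Im \<sigma> * ln r) *\<^sub>R w 1 t + sin (Im \<sigma> * ln r) *\<^sub>R v t)) \<and>
    (\<sigma> \<in> \<real> \<longrightarrow> has_winding (w 1) j) \<and>
    (\<sigma> \<notin> \<real> \<longrightarrow> has_winding (\<lambda>t. w 1 t - \<i> * v t) j \<and> (\<forall>t. 0 < Im (cnj (w 1 t) * v t)))"
proof (cases "\<sigma> \<in> \<real>")
  case True
  then have Im: "Im \<sigma> = 0" by (simp add: complex_is_Real_iff)
  obtain f where L: "L_solution lam nu c 0 PInfty w" and f: "has_winding f j"
      "\<And>r t. 0 < r \<Longrightarrow> w r t = of_real (r powr Re \<sigma>) * f t"
    using assms True unfolding basic_solution_def by auto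
  have w1: "w 1 = f" using f(2)[of 1] by auto
  have w: "w r t = (r powr Re \<sigma>) *\<^sub>R (cos (Im \<sigma> * ln r) *\<^sub>R w 1 t + sin (Im \<sigma> * ln r) *\<^sub>R 0)"
    if "0 < r" for r t
    using f(2)[OF that] by (simp add: Im w1 scaleR_conv_of_real)
  have "spectral_pair (Re \<sigma>) (Im \<sigma>) (w 1) (\<lambda>t. 0)"
    unfolding spectral_pair_def
    using P_of_separated[OF L w, of 1] by (simp add: Im smooth_circle_zero P_zero)
  then show ?thesis
    using w f(1) w1 True by (intro exI[of _ "\<lambda>t. 0"] conjI) auto
next
  case False
  then have Im: "Im \<sigma> \<noteq> 0" by (simp add: complex_is_Real_iff)
  obtain \<phi> \<psi> where L: "L_solution lam nu c 0 PInfty w" and per: "periodic2pi \<phi>" "periodic2pi \<psi>"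
    and wind: "has_winding \<phi> j" and less: "\<And>t. norm (\<psi> t) < norm (\<phi> t)"
    and w: "\<And>r t. 0 < r \<Longrightarrow> w r t = (of_real r) powr \<sigma> * \<phi> t + cnj ((of_real r) powr \<sigma> * \<psi> t)"
    using assms False unfolding basic_solution_def by auto
  define v where "v t = \<i> * (\<phi> t - cnj (\<psi> t))" for t
  have w1: "w 1 t = \<phi> t + cnj (\<psi> t)" for t using w[of 1 t] by simp
  have w': "w r t = (r powr Re \<sigma>) *\<^sub>R (cos (Im \<sigma> * ln r) *\<^sub>R w 1 t + sin (Im \<sigma> * ln r) *\<^sub>R v t)"
    if "0 < r" for r t
  proof -
    let ?C = "cos (Im \<sigma> * ln r)" and ?S = "sin (Im \<sigma> * ln r)"
    have "w r t = (r powr Re \<sigma>) *\<^sub>R (cis (Im \<sigma> * ln r) * \<phi> t + cnj (cis (Im \<sigma> * ln r) * \<psi> t))"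
      unfolding w[OF that] of_real_powr_polar[OF that] by (simp add: scaleR_conv_of_real algebra_simps)
    also have "cis (Im \<sigma> * ln r) * \<phi> t + cnj (cis (Im \<sigma> * ln r) * \<psi> t) = ?C *\<^sub>R w 1 t + ?S *\<^sub>R v t"
      unfolding w1 v_def by (simp add: complex_eq_iff algebra_simps)
    finally show ?thesis .
  qed
  \<comment> \<open>At this radius the cosine vanishes and the sine is 1. So \<open>v\<close> is a
    rescaled slice of \<open>w\<close> and inherits its smoothness, although \<open>\<phi>\<close>
    and \<open>\<psi>\<close> are not known to be differentiable.\<close>
  define r1 where "r1 = exp (pi / (2 * Im \<sigma>))"
  have r1: "0 < r1" "Im \<sigma> * ln r1 = pi / 2" using Im by (auto simp: r1_def)
  have v: "v = (\<lambda>t. inverse (r1 powr Re \<sigma>) *\<^sub>R w r1 t)"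
    using w'[OF r1(1)] r1 by (auto simp: fun_eq_iff)
  note P1 = P_of_separated[OF L w', of 1] and Pr1 = P_of_separated[OF L w' r1(1)]
  have sp: "spectral_pair (Re \<sigma>) (Im \<sigma>) (w 1) v"
    unfolding spectral_pair_def
  proof (intro conjI allI)
    show "smooth_circle (w 1)" using P1 by simp
    show "smooth_circle v" unfolding v by (intro smooth_circle_scaleR Pr1)
    show "P (w 1) t = Re \<sigma> *\<^sub>R w 1 t + Im \<sigma> *\<^sub>R v t" for t using P1(2)[of t] by simp
    have "P v t = inverse (r1 powr Re \<sigma>) *\<^sub>R P (w r1) t" for t
      unfolding v by (intro P_scaleR Pr1)
    then show "P v t = Re \<sigma> *\<^sub>R v t - Im \<sigma> *\<^sub>R w 1 t" for t
      using Pr1(2)[of t] r1 by simp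
  qed
  have wi: "has_winding (\<lambda>t. w 1 t - \<i> * v t) j"
  proof -
    have "w 1 t - \<i> * v t = of_real 2 * \<phi> t" for t
      by (simp add: w1 v_def complex_eq_iff)
    then show ?thesis using has_winding_scale[OF wind, of 2] by simp
  qed
  have po: "0 < Im (cnj (w 1 t) * v t)" for t
  proof -
    have "Im (cnj (w 1 t) * v t) = (norm (\<phi> t))\<^sup>2 - (norm (\<psi> t))\<^sup>2"
      unfolding cmod_power2 by (simp add: w1 v_def power2_eq_square algebra_simps)
    then show ?thesis using less[of t] by (simp add: power_strict_mono)
  qed
  have re: "\<sigma> \<in> \<real> \<Longrightarrow> has_winding (w 1) j" using False by simp
  show ?thesis
    by (rule exI[of _ v], intro conjI allI impI) (rule sp, erule w', erule re, rule wi, rule po)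
qed

text \<open>Spectral pairs with the same exponent form a complex vector space: the coefficients are
  the complex numbers with parts \<open>a\<close>, \<open>b\<close> and \<open>a'\<close>,
  \<open>b'\<close>.\<close>

lemma spectral_pair_combine:
  assumes "spectral_pair \<alpha> \<beta> u v" "spectral_pair \<alpha> \<beta> u' v'"
  shows "spectral_pair \<alpha> \<beta>
     (\<lambda>t. (a *\<^sub>R u t + b *\<^sub>R v t) + (a' *\<^sub>R u' t + b' *\<^sub>R v' t))
     (\<lambda>t. (a *\<^sub>R v t + (- b) *\<^sub>R u t) + (a' *\<^sub>R v' t + (- b') *\<^sub>R u' t))"
proof -
  have s: "smooth_circle u" "smooth_circle v" "smooth_circle u'" "smooth_circle v'"
    and e: "\<And>t. P u t = \<alpha> *\<^sub>R u t + \<beta> *\<^sub>R v t" "\<And>t. P v t = \<alpha> *\<^sub>R v t - \<beta> *\<^sub>R u t"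
     "\<And>t. P u' t = \<alpha> *\<^sub>R u' t + \<beta> *\<^sub>R v' t" "\<And>t. P v' t = \<alpha> *\<^sub>R v' t - \<beta> *\<^sub>R u' t"
    using assms by (auto simp: spectral_pair_def)
  show ?thesis
    unfolding spectral_pair_def
  proof (intro conjI allI)
    fix t
    have "P (\<lambda>t. (a *\<^sub>R u t + b *\<^sub>R v t) + (a' *\<^sub>R u' t + b' *\<^sub>R v' t)) t
       = (a *\<^sub>R P u t + b *\<^sub>R P v t) + (a' *\<^sub>R P u' t + b' *\<^sub>R P v' t)"
      by (simp only: P_add P_scaleR smooth_circle_add smooth_circle_scaleR s)
    then show "P (\<lambda>t. (a *\<^sub>R u t + b *\<^sub>R v t) + (a' *\<^sub>R u' t + b' *\<^sub>R v' t)) t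
       = \<alpha> *\<^sub>R ((a *\<^sub>R u t + b *\<^sub>R v t) + (a' *\<^sub>R u' t + b' *\<^sub>R v' t))
       + \<beta> *\<^sub>R ((a *\<^sub>R v t + (- b) *\<^sub>R u t) + (a' *\<^sub>R v' t + (- b') *\<^sub>R u' t))"
      by (simp add: e algebra_simps)
    have "P (\<lambda>t. (a *\<^sub>R v t + (- b) *\<^sub>R u t) + (a' *\<^sub>R v' t + (- b') *\<^sub>R u' t)) t
       = (a *\<^sub>R P v t + (- b) *\<^sub>R P u t) + (a' *\<^sub>R P v' t + (- b') *\<^sub>R P u' t)"
      by (simp only: P_add P_scaleR smooth_circle_add smooth_circle_scaleR s)
    then show "P (\<lambda>t. (a *\<^sub>R v t + (- b) *\<^sub>R u t) + (a' *\<^sub>R v' t + (- b') *\<^sub>R u' t)) t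
       = \<alpha> *\<^sub>R ((a *\<^sub>R v t + (- b) *\<^sub>R u t) + (a' *\<^sub>R v' t + (- b') *\<^sub>R u' t))
       - \<beta> *\<^sub>R ((a *\<^sub>R u t + b *\<^sub>R v t) + (a' *\<^sub>R u' t + b' *\<^sub>R v' t))"
      by (simp add: e algebra_simps)
  qed (intro smooth_circle_add smooth_circle_scaleR s)+
qed

text \<open>A nonreal exponent has, up to complex multiples, only one eigenvector: some combination of two of them
  has vanishing Wronskian at 0, hence vanishes.\<close>

lemma spectral_pair_unique:
  assumes p: "spectral_pair \<alpha> \<beta> u v" "spectral_pair \<alpha> \<beta> u' v'" and \<beta>: "\<beta> \<noteq> 0"
    and pos: "\<And>t. 0 < Im (cnj (u t) * v t)" "\<And>t. 0 < Im (cnj (u' t) * v' t)"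
  shows "\<exists>z. z \<noteq> 0 \<and> (\<forall>t. u' t = Re z *\<^sub>R u t + Im z *\<^sub>R v t \<and> v' t = Re z *\<^sub>R v t - Im z *\<^sub>R u t)"
proof -
  define \<Phi> where "\<Phi> t = u t - \<i> * v t" for t
  define \<Psi> where "\<Psi> t = cnj (u t + \<i> * v t)" for t
  define \<Phi>' where "\<Phi>' t = u' t - \<i> * v' t" for t
  define \<Psi>' where "\<Psi>' t = cnj (u' t + \<i> * v' t)" for t
  have n: "(norm (\<Phi> t))\<^sup>2 - (norm (\<Psi> t))\<^sup>2 = 4 * Im (cnj (u t) * v t)"
       "(norm (\<Phi>' t))\<^sup>2 - (norm (\<Psi>' t))\<^sup>2 = 4 * Im (cnj (u' t) * v' t)" for t
    unfolding cmod_power2 by (simp_all add: \<Phi>_def \<Psi>_def \<Phi>'_def \<Psi>'_def power2_eq_square algebra_simps)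
  have ne: "\<Phi> 0 \<noteq> \<Psi> 0" "\<Phi>' 0 \<noteq> \<Psi>' 0"
    using n[of 0] pos[of 0] by auto
  \<comment> \<open>With these \<open>x\<close> and \<open>y\<close> the combined
    \<open>\<Phi>\<close> and \<open>\<Psi>\<close> agree at 0. The Wronskian is a quarter of the
    difference of their squared moduli, hence zero there.\<close>
  define x where "x = \<Psi>' 0 - \<Phi>' 0"
  define y where "y = \<Phi> 0 - \<Psi> 0"
  have xy: "x \<noteq> 0" "y \<noteq> 0" using ne by (auto simp: x_def y_def)
  let ?U = "\<lambda>t. (Re x *\<^sub>R u t + Im x *\<^sub>R v t) + (Re y *\<^sub>R u' t + Im y *\<^sub>R v' t)"
  let ?V = "\<lambda>t. (Re x *\<^sub>R v t + (- Im x) *\<^sub>R u t) + (Re y *\<^sub>R v' t + (- Im y) *\<^sub>R u' t)"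
  have UV: "?U t - \<i> * ?V t = x * \<Phi> t + y * \<Phi>' t" "cnj (?U t + \<i> * ?V t) = x * \<Psi> t + y * \<Psi>' t" for t
    by (simp_all add: \<Phi>_def \<Psi>_def \<Phi>'_def \<Psi>'_def complex_eq_iff algebra_simps)
  have "x * \<Phi> 0 + y * \<Phi>' 0 = x * \<Psi> 0 + y * \<Psi>' 0"
    by (simp add: x_def y_def algebra_simps)
  then have "norm (?U 0 - \<i> * ?V 0) = norm (?U 0 + \<i> * ?V 0)"
    using UV[of 0] by (metis complex_mod_cnj)
  then have 0: "(norm (?U 0 - \<i> * ?V 0))\<^sup>2 - (norm (?U 0 + \<i> * ?V 0))\<^sup>2 = 0"
    by (simp only: diff_self)
  have W: "(norm (a - \<i> * b))\<^sup>2 - (norm (a + \<i> * b))\<^sup>2 = 4 * Im (cnj a * b)" for a b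
    unfolding cmod_power2 by (simp add: power2_eq_square algebra_simps)
  have "Im (cnj (?U 0) * ?V 0) = 0" using 0 unfolding W by simp
  then have zero: "?U t = 0 \<and> ?V t = 0" for t
    by (rule spectral_pair_zero[OF spectral_pair_combine[OF p] \<beta>])
  have \<Phi>0: "x * \<Phi> t + y * \<Phi>' t = 0" and \<Psi>0: "x * \<Psi> t + y * \<Psi>' t = 0" for t
    using zero[of t] UV(1)[of t] UV(2)[of t] by (simp_all only: mult_zero_right diff_self complex_cnj_zero add_0)
  define z where "z = - x / y"
  have z: "\<Phi>' t = z * \<Phi> t" "\<Psi>' t = z * \<Psi> t" for t
    using \<Phi>0[of t] \<Psi>0[of t] xy by (auto simp: z_def field_simps eq_neg_iff_add_eq_0)
  show ?thesis
  proof (intro exI[of _ z] conjI allI)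
    show "z \<noteq> 0" using xy by (simp add: z_def)
    fix t
    have u: "u' t = (\<Phi>' t + cnj (\<Psi>' t)) / 2" and v: "v' t = \<i> * (\<Phi>' t - cnj (\<Psi>' t)) / 2"
      by (simp_all add: \<Phi>'_def \<Psi>'_def algebra_simps)
    show "u' t = Re z *\<^sub>R u t + Im z *\<^sub>R v t"
      unfolding u z by (simp add: \<Phi>_def \<Psi>_def complex_eq_iff field_simps)
    show "v' t = Re z *\<^sub>R v t - Im z *\<^sub>R u t"
      unfolding v z by (simp add: \<Phi>_def \<Psi>_def complex_eq_iff field_simps)
  qed
qed

text \<open>For a real exponent the Wronskian of the two solutions satisfies a homogeneous linear
  equation, so it never changes sign. For nonreal ones, conjugate exponents are excluded by
  \<open>spectral_pair_opposite\<close>, and for equal exponents the two \<open>\<phi>\<close> are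
  proportional. Either way \<open>has_winding_unique\<close> applies.\<close>

lemma basic_solution_winding_unique:
  assumes b: "basic_solution lam nu c w \<sigma> j" "basic_solution lam nu c w' \<sigma>' j'"
    and \<sigma>: "\<sigma>' = \<sigma> \<or> \<sigma>' = cnj \<sigma>"
  shows "j = j'"
proof -
  obtain v where v: "spectral_pair (Re \<sigma>) (Im \<sigma>) (w 1) v" "\<sigma> \<in> \<real> \<Longrightarrow> has_winding (w 1) j"
    "\<sigma> \<notin> \<real> \<Longrightarrow> has_winding (\<lambda>t. w 1 t - \<i> * v t) j" "\<And>t. \<sigma> \<notin> \<real> \<Longrightarrow> 0 < Im (cnj (w 1 t) * v t)"
    using basic_solution_pair[OF b(1)] by blast
  obtain v' where v': "spectral_pair (Re \<sigma>') (Im \<sigma>') (w' 1) v'" "\<sigma>' \<in> \<real> \<Longrightarrow> has_winding (w' 1) j'"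
    "\<sigma>' \<notin> \<real> \<Longrightarrow> has_winding (\<lambda>t. w' 1 t - \<i> * v' t) j'" "\<And>t. \<sigma>' \<notin> \<real> \<Longrightarrow> 0 < Im (cnj (w' 1 t) * v' t)"
    using basic_solution_pair[OF b(2)] by blast
  show ?thesis
  proof (cases "\<sigma> \<in> \<real>")
    case True
    then have Im: "Im \<sigma> = 0" by (simp add: complex_is_Real_iff)
    then have \<sigma>': "\<sigma>' = \<sigma>" using \<sigma> by (auto simp: complex_eq_iff)
    have s: "smooth_circle (w 1)" "smooth_circle (w' 1)"
      and e: "\<And>t. P (w 1) t = Re \<sigma> *\<^sub>R w 1 t" "\<And>t. P (w' 1) t = Re \<sigma> *\<^sub>R w' 1 t"
      using v(1) v'(1) by (auto simp: spectral_pair_def Im \<sigma>')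
    define \<kappa> where "\<kappa> = 2 * Re \<sigma> * Im lam / (norm lam)\<^sup>2"
    let ?W = "\<lambda>t. Im (cnj (w 1 t) * w' 1 t)"
    have W: "(?W has_real_derivative \<kappa> * ?W t) (at t)" for t
    proof -
      have "cnj a * (Re \<sigma> *\<^sub>R b) / lam - cnj b * (Re \<sigma> *\<^sub>R a) / lam = (Re \<sigma> * (2 * Im (cnj a * b))) *\<^sub>R (\<i> / lam)" for a b
      proof -
        have "cnj a * (Re \<sigma> *\<^sub>R b) / lam - cnj b * (Re \<sigma> *\<^sub>R a) / lam
            = of_real (Re \<sigma>) * (cnj a * b - cnj b * a) / lam"
          by (simp add: scaleR_conv_of_real algebra_simps diff_divide_distrib)
        also have "cnj a * b - cnj b * a = of_real (2 * Im (cnj a * b)) * \<i>" by (simp add: complex_eq_iff)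
        finally show ?thesis by (simp add: scaleR_conv_of_real)
      qed
      then have "Re (cnj a * (Re \<sigma> *\<^sub>R b) / lam) - Re (cnj b * (Re \<sigma> *\<^sub>R a) / lam) = \<kappa> * Im (cnj a * b)" for a b
        unfolding minus_complex.simps(1)[symmetric]
        by (simp only: scaleR_complex.simps Re_i_over_lam) (simp add: \<kappa>_def)
      then show ?thesis using wronskian_deriv[OF s, of t] unfolding e by (simp only:)
    qed
    have "((\<lambda>t. exp (- \<kappa> * t) * ?W t) has_real_derivative 0) (at t)" for t
    proof -
      have "((\<lambda>t. exp (- \<kappa> * t) * ?W t) has_real_derivative
         (exp (- \<kappa> * t) * (- \<kappa>)) * ?W t + (\<kappa> * ?W t) * exp (- \<kappa> * t)) (at t)"
        by (rule DERIV_mult[OF _ W]) (auto intro!: derivative_eq_intros)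
      moreover have "(E * (- \<kappa>)) * x + (\<kappa> * x) * E = 0" for E x by simp
      ultimately show ?thesis by (simp only:)
    qed
    then have const: "exp (- \<kappa> * t) * ?W t = exp (- \<kappa> * 0) * ?W 0" for t
      by (rule DERIV_isconst_all[rule_format, of "\<lambda>t. exp (- \<kappa> * t) * ?W t"])
    have W0: "?W t = exp (\<kappa> * t) * ?W 0" for t
    proof -
      have "?W t = exp (\<kappa> * t) * (exp (- \<kappa> * t) * ?W t)" by (simp add: exp_minus)
      also have "exp (- \<kappa> * t) * ?W t = exp (- \<kappa> * 0) * ?W 0" by (rule const)
      finally show ?thesis by simp
    qed
    have "(\<forall>t. 0 \<le> ?W t) \<or> (\<forall>t. ?W t \<le> 0)"
    proof (cases "0 \<le> ?W 0")
      case True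
      then have "0 \<le> exp (\<kappa> * t) * ?W 0" for t by (intro mult_nonneg_nonneg) auto
      then show ?thesis unfolding W0[symmetric] by blast
    next
      case False
      then have "exp (\<kappa> * t) * ?W 0 \<le> 0" for t by (intro mult_nonneg_nonpos) auto
      then show ?thesis unfolding W0[symmetric] by blast
    qed
    then show ?thesis
      using has_winding_unique[OF v(2)[OF True] v'(2)] True \<sigma>' by simp
  next
    case False
    then have Im: "Im \<sigma> \<noteq> 0" by (simp add: complex_is_Real_iff)
    have False': "\<sigma>' \<notin> \<real>" using False \<sigma> by (auto simp: complex_is_Real_iff)
    have "\<sigma>' \<noteq> cnj \<sigma>"
    proof
      assume "\<sigma>' = cnj \<sigma>"
      then have "spectral_pair (Re \<sigma>) (- Im \<sigma>) (w' 1) v'" using v'(1) by simp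
      from spectral_pair_opposite[OF v(1) this v(4)[OF False] v'(4)[OF False']] Im show False by simp
    qed
    then have \<sigma>': "\<sigma>' = \<sigma>" using \<sigma> by simp
    obtain z where z: "z \<noteq> 0" "\<And>t. w' 1 t = Re z *\<^sub>R w 1 t + Im z *\<^sub>R v t"
        "\<And>t. v' t = Re z *\<^sub>R v t - Im z *\<^sub>R w 1 t"
      using spectral_pair_unique[OF v(1) v'(1)[unfolded \<sigma>'] Im v(4)[OF False] v'(4)[OF False']] by blast
    have "w' 1 t - \<i> * v' t = z * (w 1 t - \<i> * v t)" for t
      unfolding z by (simp add: complex_eq_iff algebra_simps)
    then have "cnj (w 1 t - \<i> * v t) * (w' 1 t - \<i> * v' t) = z * of_real ((norm (w 1 t - \<i> * v t))\<^sup>2)" for t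
      unfolding complex_norm_square by (simp add: mult_ac)
    then have "Im (cnj (w 1 t - \<i> * v t) * (w' 1 t - \<i> * v' t)) = Im z * (norm (w 1 t - \<i> * v t))\<^sup>2" for t
      by (simp del: of_real_power)
    then have "(\<forall>t. 0 \<le> Im (cnj (w 1 t - \<i> * v t) * (w' 1 t - \<i> * v' t)))
        \<or> (\<forall>t. Im (cnj (w 1 t - \<i> * v t) * (w' 1 t - \<i> * v' t)) \<le> 0)"
      by (cases "0 \<le> Im z") (auto intro: mult_nonneg_nonneg mult_nonpos_nonneg)
    then show ?thesis
      by (rule has_winding_unique[OF v(3)[OF False] v'(3)[OF False']])
  qed
qed

end

section \<open>Block decompositions\<close>

instance bcontfun :: (metric_space, banach) banach ..

lemma summable_on_int_nat_abs:
  fixes f :: "nat \<Rightarrow> real"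
  assumes "summable f" "\<And>n. 0 \<le> f n"
  shows "(\<lambda>j::int. f (nat \<bar>j\<bar>)) summable_on UNIV"
proof -
  have 1: "f summable_on UNIV" using assms by (subst summable_on_UNIV_nonneg_real_iff) auto
  have "(\<lambda>j::int. f (nat \<bar>j\<bar>)) summable_on (int ` UNIV)"
    using 1 by (subst summable_on_reindex) (auto simp: o_def)
  moreover have "(\<lambda>j::int. f (nat \<bar>j\<bar>)) summable_on ((\<lambda>n. - int (Suc n)) ` UNIV)"
  proof -
    have "(\<lambda>n. f (Suc n)) summable_on UNIV"
      using assms summable_Suc_iff[of f] by (subst summable_on_UNIV_nonneg_real_iff) auto
    then show ?thesis
      by (subst summable_on_reindex) (auto simp: o_def inj_on_def simp del: of_nat_Suc)
  qed
  moreover have "int ` UNIV \<union> (\<lambda>n. - int (Suc n)) ` UNIV = (UNIV :: int set)"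
  proof (intro equalityI subsetI UNIV_I)
    fix j :: int
    show "j \<in> int ` UNIV \<union> (\<lambda>n. - int (Suc n)) ` UNIV"
      by (cases j rule: int_cases) auto
  qed
  moreover have "int ` UNIV \<inter> (\<lambda>n. - int (Suc n)) ` UNIV = {}" by auto
  ultimately show ?thesis
    by (metis summable_on_Un_disjoint)
qed

context circle_operator
begin

lemma smooth_circle_sum_P:
  assumes "finite A" "\<And>j. j \<in> A \<Longrightarrow> smooth_circle (f j)"
  shows "smooth_circle (\<lambda>t. \<Sum>j\<in>A. f j t) \<and> (\<forall>t. P (\<lambda>t. \<Sum>j\<in>A. f j t) t = (\<Sum>j\<in>A. P (f j) t))"
  using assms
proof (induction A rule: finite_induct)
  case empty
  then show ?case by (simp add: smooth_circle_zero P_zero)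
next
  case (insert x A)
  then show ?case by (simp add: smooth_circle_add P_add)
qed

end

text \<open>Block \<open>j\<close> is the real plane spanned by \<open>U j\<close> and
  \<open>V j\<close>. On it \<open>P\<close> is multiplication by \<open>s1 j\<close> if that is
  nonreal, and diagonal with entries \<open>s1 j\<close>, \<open>s2 j\<close> otherwise. For high
  \<open>j\<close> the vectors approach \<open>cis (j * t)\<close> and
  \<open>\<i> * cis (j * t)\<close>, so the complex coordinate of the block matches that of the
  Fourier mode.\<close>

locale circle_blocks = circle_operator +
  fixes s1 s2 :: "int \<Rightarrow> complex" and U V :: "int \<Rightarrow> real \<Rightarrow> complex" and N :: int and M :: real
  assumes smooth_U: "smooth_circle (U j)" and smooth_V: "smooth_circle (V j)"
    and nonreal_pair: "s1 j \<notin> \<real> \<Longrightarrow> s2 j = s1 j \<and> spectral_pair (Re (s1 j)) (Im (s1 j)) (U j) (V j)"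
    and real_pair: "s1 j \<in> \<real> \<Longrightarrow> s2 j \<in> \<real> \<and>
       (\<forall>t. P (U j) t = Re (s1 j) *\<^sub>R U j t \<and> P (V j) t = Re (s2 j) *\<^sub>R V j t)"
    and independent_UV: "(\<And>t. x *\<^sub>R U j t + y *\<^sub>R V j t = 0) \<Longrightarrow> x = 0 \<and> y = 0"
    and disjoint_spectra: "i \<noteq> j \<Longrightarrow> s \<in> {s1 i, s2 i} \<Longrightarrow> s' \<in> {s1 j, s2 j} \<Longrightarrow> s \<noteq> s' \<and> s \<noteq> cnj s'"
    and N_ge_1: "1 \<le> N"
    and U_close: "N \<le> \<bar>j\<bar> \<Longrightarrow> norm (U j t - cis (of_int j * t)) \<le> M / \<bar>of_int j\<bar>"
    and V_close: "N \<le> \<bar>j\<bar> \<Longrightarrow> norm (V j t - \<i> * cis (of_int j * t)) \<le> M / \<bar>of_int j\<bar>"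
    and s1_close: "N \<le> \<bar>j\<bar> \<Longrightarrow> norm (s1 j - lam * of_int j) \<le> M"
    and s1_nonreal: "N \<le> \<bar>j\<bar> \<Longrightarrow> s1 j \<notin> \<real>"
begin

definition Gf :: "int \<Rightarrow> complex \<Rightarrow> real \<Rightarrow> complex" where
  "Gf j z t = Re z *\<^sub>R U j t + Im z *\<^sub>R V j t"

definition G :: "int \<Rightarrow> complex \<Rightarrow> (real \<Rightarrow>\<^sub>C complex)" where
  "G j z = circle_fun (Gf j z)"

text \<open>Functional calculus on a block, for functions that are real at real points. The identity
  function gives \<open>P\<close>, \<open>kap\<close> the inverse of \<open>P - mu\<close>, and
  exponentials give the evolution in \<open>r\<close>.\<close>

definition act :: "(complex \<Rightarrow> complex) \<Rightarrow> int \<Rightarrow> complex \<Rightarrow> complex" where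
  "act f j z = (if s1 j \<in> \<real> then Complex (Re (f (s1 j)) * Re z) (Re (f (s2 j)) * Im z) else f (s1 j) * z)"

lemma smooth_Gf: "smooth_circle (Gf j z)"
  unfolding Gf_def[abs_def] by (intro smooth_circle_add smooth_circle_scaleR smooth_U smooth_V)

lemma apply_G: "apply_bcontfun (G j z) t = Gf j z t"
  unfolding G_def
  by (simp add: apply_circle_fun[OF smooth_circle_continuous[OF smooth_Gf] smooth_circle_periodic[OF smooth_Gf]])

lemma G_in: "G j z \<in> circle_functions"
  unfolding G_def by (intro circle_fun_in smooth_circle_continuous smooth_circle_periodic smooth_Gf)

lemma linear_G: "linear (G j)"
  by (rule linearI) (auto intro!: bcontfun_eqI simp: apply_G Gf_def algebra_simps)

lemma P_Gf: "P (Gf j z) t = Gf j (act (\<lambda>s. s) j z) t"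
proof -
  have "P (Gf j z) t = Re z *\<^sub>R P (U j) t + Im z *\<^sub>R P (V j) t"
    unfolding Gf_def[abs_def]
    by (simp only: P_add P_scaleR smooth_circle_scaleR smooth_U smooth_V)
  also have "\<dots> = Gf j (act (\<lambda>s. s) j z) t"
  proof (cases "s1 j \<in> \<real>")
    case True
    then show ?thesis using real_pair[OF True] by (simp add: Gf_def act_def mult_ac)
  next
    case False
    then have e: "P (U j) t = Re (s1 j) *\<^sub>R U j t + Im (s1 j) *\<^sub>R V j t"
      "P (V j) t = Re (s1 j) *\<^sub>R V j t - Im (s1 j) *\<^sub>R U j t"
      using nonreal_pair by (auto simp: spectral_pair_def)
    show ?thesis unfolding e using False by (simp add: Gf_def act_def algebra_simps)
  qed
  finally show ?thesis .
qed

lemma smooth_eigen_mu: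
  assumes "smooth_circle g" "\<And>t. P g t = mu *\<^sub>R g t"
  shows "g t = 0"
  using apriori_estimate[OF assms(1), of 0] assms(2) by simp

text \<open>An exponent equal to \<open>mu\<close> would be real, and the a priori estimate
  annihilates its eigenfunction, against the independence of \<open>U j\<close> and
  \<open>V j\<close>.\<close>

lemma spectrum_not_mu: "s1 j \<noteq> of_real mu" "s2 j \<noteq> of_real mu"
proof -
  have "s1 j \<noteq> of_real mu \<and> s2 j \<noteq> of_real mu"
  proof (cases "s1 j \<in> \<real>")
    case True
    have "s1 j \<noteq> of_real mu"
    proof
      assume "s1 j = of_real mu"
      then have "U j t = 0" for t
        using real_pair[OF True] by (intro smooth_eigen_mu smooth_U) auto
      then show False using independent_UV[of 1 j 0] by simp
    qed
    moreover have "s2 j \<noteq> of_real mu"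
    proof
      assume "s2 j = of_real mu"
      then have "V j t = 0" for t
        using real_pair[OF True] by (intro smooth_eigen_mu smooth_V) auto
      then show False using independent_UV[of 0 j 1] by simp
    qed
    ultimately show ?thesis by simp
  next
    case False
    then show ?thesis using nonreal_pair[OF False] by (auto simp: complex_is_Real_iff)
  qed
  then show "s1 j \<noteq> of_real mu" "s2 j \<noteq> of_real mu" by auto
qed

definition kap :: "complex \<Rightarrow> complex" where "kap s = 1 / (s - of_real mu)"

definition delta :: "int \<Rightarrow> complex \<Rightarrow> complex" where "delta j = act kap j"

lemma linear_act: "linear (act f j)"
  by (rule linearI) (auto simp: act_def complex_eq_iff algebra_simps)

lemma act_kap_inverse: "act (\<lambda>s. s) j (delta j z) - mu *\<^sub>R delta j z = z"
proof (cases "s1 j \<in> \<real>")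
  case True
  obtain x y where xy: "s1 j = of_real x" "s2 j = of_real y"
    using True real_pair[OF True] by (auto elim!: Reals_cases)
  have "x \<noteq> mu" "y \<noteq> mu" using spectrum_not_mu[of j] xy by auto
  moreover have "Re (kap (of_real w)) = 1 / (w - mu)" for w
    by (simp add: kap_def Re_divide power2_eq_square)
  moreover have "w * (1 / (w - mu) * q) - mu * (1 / (w - mu) * q) = q" if "w \<noteq> mu" for w q
  proof -
    have "w * (1 / (w - mu) * q) - mu * (1 / (w - mu) * q) = (w - mu) * (1 / (w - mu) * q)"
      by (simp only: left_diff_distrib)
    then show ?thesis using that by simp
  qed
  ultimately show ?thesis
    by (simp add: xy delta_def act_def complex_eq_iff)
next
  case False
  then show ?thesis using spectrum_not_mu(1)[of j]
    by (simp add: delta_def act_def kap_def scaleR_conv_of_real divide_simps) (simp add: algebra_simps)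
qed

lemma P_Gf_delta: "P (Gf j (delta j z)) t - mu *\<^sub>R Gf j (delta j z) t = Gf j z t"
proof -
  have "Gf j a t - mu *\<^sub>R Gf j b t = Gf j (a - mu *\<^sub>R b) t" for a b
    by (simp add: Gf_def algebra_simps)
  then show ?thesis using act_kap_inverse[of j z] by (simp add: P_Gf)
qed

text \<open>By \<open>P_Gf_delta\<close> the operator \<open>P - mu\<close> maps the combination on
  the left to the one on the right, so the maximum principle gives the constant 1.\<close>

lemma apriori_G:
  assumes "finite A"
  shows "norm (\<Sum>j\<in>A. G j (delta j (y j))) \<le> 1 * norm (\<Sum>j\<in>A. G j (y j))"
proof -
  let ?g = "\<lambda>t. \<Sum>j\<in>A. Gf j (delta j (y j)) t"
  have g: "smooth_circle ?g" "\<And>t. P ?g t = (\<Sum>j\<in>A. P (Gf j (delta j (y j))) t)"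
    using smooth_circle_sum_P[OF assms, of "\<lambda>j. Gf j (delta j (y j))"] smooth_Gf by auto
  have "P ?g t - mu *\<^sub>R ?g t = apply_bcontfun (\<Sum>j\<in>A. G j (y j)) t" for t
    by (simp add: g(2) apply_bcontfun_sum apply_G scaleR_sum_right P_Gf_delta flip: sum_subtractf)
  then have "norm (?g t) \<le> norm (\<Sum>j\<in>A. G j (y j))" for t
    using apriori_estimate[OF g(1)] norm_bounded by metis
  then show ?thesis
    by (intro norm_bound) (simp add: apply_bcontfun_sum apply_G)
qed

lemma inj_G: "G j z = 0 \<Longrightarrow> z = 0"
proof -
  assume "G j z = 0"
  then have "Gf j z t = 0" for t using apply_G[of j z t] by simp
  then show "z = 0" using independent_UV[of "Re z" j "Im z"] by (simp add: Gf_def complex_eq_iff)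
qed

definition eta :: "int \<Rightarrow> real" where
  "eta j = norm (G j 1 - mode j 1) + norm (G j \<i> - mode j \<i>)"

lemma eta_nonneg: "0 \<le> eta j"
  by (simp add: eta_def)

lemma G_close: "norm (G j z - mode j z) \<le> eta j * norm z"
proof -
  have z: "z = Re z *\<^sub>R 1 + Im z *\<^sub>R \<i>" by (simp add: complex_eq_iff)
  have "G j z - mode j z = G j (Re z *\<^sub>R 1 + Im z *\<^sub>R \<i>) - mode j (Re z *\<^sub>R 1 + Im z *\<^sub>R \<i>)"
    using z by simp
  also have "\<dots> = Re z *\<^sub>R (G j 1 - mode j 1) + Im z *\<^sub>R (G j \<i> - mode j \<i>)"
    by (simp only: linear_add[OF linear_G] linear_add[OF linear_mode] linear_scale[OF linear_G]
        linear_scale[OF linear_mode]) (simp add: scaleR_diff_right)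
  also have "norm \<dots> \<le> \<bar>Re z\<bar> * norm (G j 1 - mode j 1) + \<bar>Im z\<bar> * norm (G j \<i> - mode j \<i>)"
    using norm_triangle_ineq[of "Re z *\<^sub>R (G j 1 - mode j 1)" "Im z *\<^sub>R (G j \<i> - mode j \<i>)"] by simp
  also have "\<dots> \<le> norm z * norm (G j 1 - mode j 1) + norm z * norm (G j \<i> - mode j \<i>)"
    by (intro add_mono mult_right_mono abs_Re_le_cmod abs_Im_le_cmod) auto
  finally show ?thesis by (simp add: eta_def algebra_simps)
qed

lemma eta_le:
  assumes "N \<le> \<bar>j\<bar>"
  shows "eta j \<le> 2 * M / \<bar>of_int j\<bar>"
proof -
  have "norm (G j 1 - mode j 1) \<le> M / \<bar>of_int j\<bar>"
    by (rule norm_bound) (use U_close[OF assms] in \<open>simp add: apply_G apply_mode Gf_def\<close>)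
  moreover have "norm (G j \<i> - mode j \<i>) \<le> M / \<bar>of_int j\<bar>"
    by (rule norm_bound) (use V_close[OF assms] in \<open>simp add: apply_G apply_mode Gf_def\<close>)
  ultimately show ?thesis by (simp add: eta_def)
qed

lemma M_nonneg: "0 \<le> M"
  using s1_close[of N] N_ge_1 norm_ge_zero[of "s1 N - lam * of_int N"] by linarith

lemma finite_low: "finite {j::int. \<bar>j\<bar> < N}"
  by (rule finite_subset[of _ "{-N..N}"]) auto

lemma eta_summable: "(\<lambda>j. (eta j)\<^sup>2) summable_on UNIV"
proof -
  \<comment> \<open>At \<open>j = 0\<close> this term is 0 by the convention for division; since
    \<open>1 \<le> N\<close>, that index is covered by the finite correction below.\<close>
  have "(\<lambda>j::int. (2 * M)\<^sup>2 * (1 / (real (nat \<bar>j\<bar>))\<^sup>2)) summable_on UNIV"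
    using inverse_power_summable[of 2, where 'a = real]
    by (intro summable_on_cmult_right summable_on_int_nat_abs[of "\<lambda>n. 1 / (real n)\<^sup>2"]) (auto simp: inverse_eq_divide)
  moreover have "(\<lambda>j. if \<bar>j\<bar> < N then (eta j)\<^sup>2 else 0) summable_on UNIV"
    by (rule finite_nonzero_values_imp_summable_on) (rule finite_subset[OF _ finite_low], auto)
  ultimately have "(\<lambda>j. (2 * M)\<^sup>2 * (1 / (real (nat \<bar>j\<bar>))\<^sup>2) + (if \<bar>j\<bar> < N then (eta j)\<^sup>2 else 0)) summable_on UNIV"
    by (rule summable_on_add)
  then show ?thesis
  proof (rule summable_on_comparison_test)
    fix j
    show "(eta j)\<^sup>2 \<le> (2 * M)\<^sup>2 * (1 / (real (nat \<bar>j\<bar>))\<^sup>2) + (if \<bar>j\<bar> < N then (eta j)\<^sup>2 else 0)"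
    proof (cases "\<bar>j\<bar> < N")
      case False
      then have "(eta j)\<^sup>2 \<le> (2 * M / \<bar>of_int j\<bar>)\<^sup>2"
        using eta_le[of j] eta_nonneg[of j] by (intro power_mono) auto
      with False show ?thesis by (simp add: power_divide)
    qed simp
  qed auto
qed

section \<open>Characteristic polynomials of the blocks\<close>

definition pp :: "int \<Rightarrow> real" where
  "pp j = (if s1 j \<in> \<real> then Re (kap (s1 j)) + Re (kap (s2 j)) else 2 * Re (kap (s1 j)))"

definition mm :: "int \<Rightarrow> real" where
  "mm j = (if s1 j \<in> \<real> then Re (kap (s1 j)) * Re (kap (s2 j)) else (norm (kap (s1 j)))\<^sup>2)"

lemma kap_real: "s \<in> \<real> \<Longrightarrow> kap s = of_real (Re (kap s))"
proof -
  assume "s \<in> \<real>"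
  then obtain x where "s = of_real x" by (auto elim: Reals_cases)
  then have "kap s = of_real (1 / (x - mu))" by (simp add: kap_def)
  then show ?thesis by simp
qed

lemma kap_inj: "s \<noteq> of_real mu \<Longrightarrow> s' \<noteq> of_real mu \<Longrightarrow> kap s = kap s' \<longleftrightarrow> s = s'"
  by (auto simp: kap_def field_simps)

lemma kap_cnj: "kap (cnj s) = cnj (kap s)"
  by (simp add: kap_def)

lemma quad_factor:
  "x * x - of_real (pp j) * x + of_real (mm j)
     = (x - kap (s1 j)) * (x - (if s1 j \<in> \<real> then kap (s2 j) else cnj (kap (s1 j))))"
proof (cases "s1 j \<in> \<real>")
  case True
  have k: "kap (s1 j) = of_real (Re (kap (s1 j)))" "kap (s2 j) = of_real (Re (kap (s2 j)))"
    using kap_real True real_pair[OF True] by auto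
  define a b where "a = Re (kap (s1 j))" and "b = Re (kap (s2 j))"
  have "kap (s1 j) = of_real a" "kap (s2 j) = of_real b" using k by (simp_all add: a_def b_def)
  with True show ?thesis by (simp add: pp_def mm_def algebra_simps)
next
  case False
  have "of_real (mm j) = kap (s1 j) * cnj (kap (s1 j))"
    using False by (simp add: mm_def complex_norm_square del: of_real_power)
  moreover have "of_real (pp j) = kap (s1 j) + cnj (kap (s1 j))"
    using False by (simp add: pp_def complex_add_cnj)
  ultimately show ?thesis using False by (simp add: algebra_simps)
qed

lemma delta_quad:
  "delta i (delta i z) - a *\<^sub>R delta i z + b *\<^sub>R z =
     act (\<lambda>s. kap s * kap s - of_real a * kap s + of_real b) i z"
proof (cases "s1 i \<in> \<real>")
  case True
  obtain x y where "kap (s1 i) = of_real x" "kap (s2 i) = of_real y"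
    using kap_real True real_pair[OF True] by metis
  with True show ?thesis by (simp add: delta_def act_def complex_eq_iff algebra_simps)
next
  case False
  then show ?thesis by (simp add: delta_def act_def scaleR_conv_of_real algebra_simps)
qed

lemma delta_annihilate: "delta j (delta j z) - pp j *\<^sub>R delta j z + mm j *\<^sub>R z = 0"
  unfolding delta_quad quad_factor by (simp add: act_def complex_eq_iff)

text \<open>The map \<open>kap\<close> is injective away from \<open>mu\<close> and commutes with
  conjugation. Exponents of different blocks are neither equal nor conjugate, so neither linear
  factor of the polynomial vanishes.\<close>

lemma delta_separate:
  assumes "i \<noteq> j" "delta i (delta i z) - pp j *\<^sub>R delta i z + mm j *\<^sub>R z = 0"
  shows "z = 0"
proof -
  define q where "q s = (kap s - kap (s1 j)) * (kap s - (if s1 j \<in> \<real> then kap (s2 j) else cnj (kap (s1 j))))" for s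
  have q0: "q s \<noteq> 0" if "s \<in> {s1 i, s2 i}" for s
  proof -
    have mu: "s \<noteq> of_real mu" using that spectrum_not_mu[of i] by auto
    have c: "cnj (s1 j) \<noteq> of_real mu" using spectrum_not_mu(1)[of j] by (metis complex_cnj_cnj complex_cnj_complex_of_real)
    have "kap s \<noteq> kap (s1 j)" "kap s \<noteq> kap (s2 j)" "kap s \<noteq> kap (cnj (s1 j))"
      using kap_inj[OF mu spectrum_not_mu(1)[of j]] kap_inj[OF mu spectrum_not_mu(2)[of j]] kap_inj[OF mu c]
        disjoint_spectra[OF assms(1) that, of "s1 j"] disjoint_spectra[OF assms(1) that, of "s2 j"]
      by auto
    then show ?thesis by (simp add: q_def kap_cnj)
  qed
  have 0: "act q i z = 0"
    using assms(2) unfolding delta_quad quad_factor q_def[abs_def] .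
  show ?thesis
  proof (cases "s1 i \<in> \<real>")
    case True
    \<comment> \<open>On a block with real exponents \<open>act\<close> sees only real parts, so
      \<open>q s \<noteq> 0\<close> has to be sharpened to a nonzero real part.\<close>
    have "Im (q s) = 0" if "s \<in> {s1 i, s2 i}" for s
    proof -
      have "s \<in> \<real>" using that True real_pair[OF True] by auto
      then have "kap s = of_real (Re (kap s))" by (rule kap_real)
      then obtain x where x: "kap s = of_real x" by blast
      have "q s = of_real (x * x - pp j * x + mm j)"
        using quad_factor[of x j] by (simp add: q_def x)
      then show ?thesis by simp
    qed
    then have "Re (q s) \<noteq> 0" if "s \<in> {s1 i, s2 i}" for s
      using q0[OF that] that by (auto simp: complex_eq_iff)
    then show ?thesis using 0 True by (simp add: act_def complex_eq_iff)
  next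
    case False
    then show ?thesis using 0 q0[of "s1 i"] by (simp add: act_def)
  qed
qed

lemma linear_delta: "linear (delta j)"
  unfolding delta_def by (rule linear_act)

sublocale perturbed_expansion circle_functions mode G fcoef delta pp mm eta 1
  by (rule perturbed_expansion.intro)
    (fact subspace_circle_functions closed_circle_functions linear_mode linear_G mode_in G_in
     bounded_linear_fcoef fcoef_mode norm_mode fcoef_bessel modes_dense fcoef_total G_close eta_nonneg
     eta_summable linear_delta apriori_G delta_annihilate delta_separate inj_G zero_le_one)+

end

section \<open>Expansion of solutions\<close>

context circle_blocks
begin

text \<open>For the intertwining put \<open>f = (P - mu) g\<close> and approximate \<open>f\<close>
  by a finite combination of blocks. The combination with coefficients transformed by
  \<open>delta\<close> is mapped to it by \<open>P - mu\<close>, so the maximum principle makes it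
  approximate \<open>g\<close> with the same error. Comparing functionals gives
  \<open>a i g = delta i (a i f)\<close>, and inverting \<open>delta i\<close> is the claim.\<close>

lemma functionals:
  "\<exists>a B. (\<forall>j. bounded_linear (a j)) \<and> (\<forall>j v. norm (a j v) \<le> B * norm v) \<and>
    (\<forall>i j z. a i (G j z) = (if i = j then z else 0)) \<and>
    (\<forall>v\<in>circle_functions. (\<forall>j. a j v = 0) \<longrightarrow> v = 0) \<and>
    (\<forall>j g. smooth_circle g \<longrightarrow> act (\<lambda>s. s) j (a j (circle_fun g)) = a j (circle_fun (P g)))"
proof -
  obtain a B where a': "\<forall>j. bounded_linear (a j)" "\<forall>j v. norm (a j v) \<le> B * norm v"
    "\<forall>i j z. a i (G j z) = (if i = j then z else 0)"
    "\<forall>v\<in>circle_functions. (\<forall>j. a j v = 0) \<longrightarrow> v = 0"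
    "\<forall>v\<in>circle_functions. \<forall>\<epsilon>>0. \<exists>A z. finite A \<and> norm (v - (\<Sum>j\<in>A. G j (z j))) < \<epsilon>"
    using biorthogonal_functionals by (elim exE conjE)
  note a = a'[rule_format]
  have B: "0 \<le> B"
  proof -
    have "0 \<le> B * norm (const_bcontfun 1 :: real \<Rightarrow>\<^sub>C complex)" using a(2) norm_ge_zero order_trans by blast
    moreover have "1 \<le> norm (const_bcontfun 1 :: real \<Rightarrow>\<^sub>C complex)"
      using norm_bounded[of "const_bcontfun 1 :: real \<Rightarrow>\<^sub>C complex" 0] by (simp add: const_bcontfun.rep_eq)
    ultimately show ?thesis by (auto simp: zero_le_mult_iff)
  qed
  have lin: "linear (a j)" for j using a(1) bounded_linear.linear by blast
  have a_sum: "a i (\<Sum>j\<in>A. G j (z j)) = (if i \<in> A then z i else 0)" if "finite A" for i A z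
    using that by (simp add: linear_sum[OF lin] a(3) sum.delta')
  have "act (\<lambda>s. s) i (a i (circle_fun g)) = a i (circle_fun (P g))" if g: "smooth_circle g" for i g
  proof -
    have cg: "continuous_on UNIV g" "periodic2pi g" "continuous_on UNIV (P g)" "periodic2pi (P g)"
      using smooth_circle_continuous smooth_circle_periodic P_continuous P_periodic g by auto
    define f where "f = circle_fun (P g) - mu *\<^sub>R circle_fun g"
    have f: "f \<in> circle_functions"
      unfolding f_def using subspace_circle_functions cg
      by (intro subspace_diff subspace_scale circle_fun_in) auto
    obtain D where D: "\<And>z. norm (delta i z) \<le> D * norm z" "0 < D"
      using linear_bounded_pos[OF linear_delta] by metis
    have "norm (a i (circle_fun g) - delta i (a i f)) \<le> 0 + \<epsilon>" if "\<epsilon> > 0" for \<epsilon>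
    proof -
      \<comment> \<open>\<open>B * \<epsilon>'\<close> bounds the error in the functional of
        \<open>g\<close>, and \<open>D * B * \<epsilon>'\<close> that in the functional of
        \<open>f\<close> after \<open>delta i\<close>; the 1 keeps the denominator positive.\<close>
      define \<epsilon>' where "\<epsilon>' = \<epsilon> / (B + D * B + 1)"
      have q: "B + D * B + 1 > 0" using B D(2) by (intro add_nonneg_pos add_nonneg_nonneg) auto
      have e': "\<epsilon>' > 0" using that q by (simp add: \<epsilon>'_def)
      obtain A y where A: "finite A" "norm (f - (\<Sum>j\<in>A. G j (y j))) < \<epsilon>'"
        using a(5)[OF f e'] by blast
      let ?h = "\<lambda>t. g t + (-1) *\<^sub>R (\<Sum>j\<in>A. Gf j (delta j (y j)) t)"
      have s: "smooth_circle (\<lambda>t. \<Sum>j\<in>A. Gf j (delta j (y j)) t)"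
        "\<And>t. P (\<lambda>t. \<Sum>j\<in>A. Gf j (delta j (y j)) t) t = (\<Sum>j\<in>A. P (Gf j (delta j (y j))) t)"
        using smooth_circle_sum_P[OF A(1), of "\<lambda>j. Gf j (delta j (y j))"] smooth_Gf by auto
      have h: "smooth_circle ?h" by (intro smooth_circle_add smooth_circle_scaleR g s)
      have Ph: "P ?h t - mu *\<^sub>R ?h t = apply_bcontfun (f - (\<Sum>j\<in>A. G j (y j))) t" for t
      proof -
        have "P ?h t = P g t + (-1) *\<^sub>R (\<Sum>j\<in>A. P (Gf j (delta j (y j))) t)"
          by (simp only: P_add P_scaleR smooth_circle_scaleR g s)
        then have "P ?h t - mu *\<^sub>R ?h t = (P g t - mu *\<^sub>R g t)
            - ((\<Sum>j\<in>A. P (Gf j (delta j (y j))) t) - mu *\<^sub>R (\<Sum>j\<in>A. Gf j (delta j (y j)) t))"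
          by (simp add: algebra_simps)
        also have "(\<Sum>j\<in>A. P (Gf j (delta j (y j))) t) - mu *\<^sub>R (\<Sum>j\<in>A. Gf j (delta j (y j)) t)
            = (\<Sum>j\<in>A. Gf j (y j) t)"
          by (simp only: scaleR_sum_right sum_subtractf[symmetric] P_Gf_delta)
        finally show ?thesis
          using cg by (simp add: f_def apply_bcontfun_sum apply_G apply_circle_fun)
      qed
      have aB: "norm (a i v) \<le> B * \<epsilon>'" if "norm v \<le> \<epsilon>'" for v
        by (rule order_trans[OF a(2)]) (intro mult_left_mono B that)
      have hb: "norm (?h t) \<le> \<epsilon>'" for t
      proof (rule apriori_estimate[OF h])
        fix t
        show "norm (P ?h t - mu *\<^sub>R ?h t) \<le> \<epsilon>'"
          unfolding Ph using norm_bounded[of "f - (\<Sum>j\<in>A. G j (y j))" t] A(2) by linarith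
      qed
      have "norm (circle_fun g - (\<Sum>j\<in>A. G j (delta j (y j)))) \<le> \<epsilon>'"
        by (rule norm_bound) (use hb cg in \<open>simp add: apply_bcontfun_sum apply_G apply_circle_fun\<close>)
      from aB[OF this] have 1: "norm (a i (circle_fun g) - (if i \<in> A then delta i (y i) else 0)) \<le> B * \<epsilon>'"
        by (simp add: linear_diff[OF lin] a_sum[OF A(1)])
      have "norm ((\<Sum>j\<in>A. G j (y j)) - f) \<le> \<epsilon>'"
        using A(2) by (simp add: norm_minus_commute)
      from aB[OF this] have "norm ((if i \<in> A then y i else 0) - a i f) \<le> B * \<epsilon>'"
        by (simp add: linear_diff[OF lin] a_sum[OF A(1)])
      then have "D * norm ((if i \<in> A then y i else 0) - a i f) \<le> D * (B * \<epsilon>')"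
        using D(2) by (intro mult_left_mono) auto
      with D(1) have "norm (delta i ((if i \<in> A then y i else 0) - a i f)) \<le> D * (B * \<epsilon>')"
        by (rule order_trans)
      then have 2: "norm ((if i \<in> A then delta i (y i) else 0) - delta i (a i f)) \<le> D * (B * \<epsilon>')"
        by (auto simp: linear_diff[OF linear_delta] linear_0[OF linear_delta])
      have "norm (a i (circle_fun g) - delta i (a i f)) \<le> B * \<epsilon>' + D * (B * \<epsilon>')"
        using norm_triangle_ineq[of "a i (circle_fun g) - (if i \<in> A then delta i (y i) else 0)"
            "(if i \<in> A then delta i (y i) else 0) - delta i (a i f)"] 1 2 by simp
      also have "\<dots> = (B + D * B) * \<epsilon>'" by (simp add: algebra_simps)
      also have "\<dots> \<le> (B + D * B + 1) * \<epsilon>'" using e' by (intro mult_right_mono) auto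
      also have "\<dots> = \<epsilon>" using q by (simp add: \<epsilon>'_def)
      finally show ?thesis by simp
    qed
    then have "norm (a i (circle_fun g) - delta i (a i f)) \<le> 0" by (rule field_le_epsilon)
    then have "a i (circle_fun g) = delta i (a i f)" by simp
    then have "act (\<lambda>s. s) i (a i (circle_fun g)) - mu *\<^sub>R a i (circle_fun g) = a i f"
      using act_kap_inverse by simp
    then show ?thesis
      by (simp add: f_def linear_diff[OF lin] linear_scale[OF lin])
  qed
  then show ?thesis
    by (intro exI[of _ a] exI[of _ B] conjI a'(1-4)) auto
qed

text \<open>By the intertwining each functional of \<open>f\<close> is an eigenvector of its block
  with eigenvalue \<open>\<tau>\<close>, which is no exponent of the block; so all functionals
  vanish. This serves to rule out mixed blocks.\<close>

lemma eigenfunction_exponent: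
  assumes f: "smooth_circle f" "\<And>t. P f t = \<tau> *\<^sub>R f t" and \<tau>: "\<And>j. of_real \<tau> \<noteq> s1 j" "\<And>j. of_real \<tau> \<noteq> s2 j"
  shows "f t = 0"
proof -
  obtain a B where a': "\<forall>j. bounded_linear (a j)" "\<forall>j v. norm (a j v) \<le> B * norm v"
    "\<forall>i j z. a i (G j z) = (if i = j then z else 0)"
    "\<forall>v\<in>circle_functions. (\<forall>j. a j v = 0) \<longrightarrow> v = 0"
    "\<forall>j g. smooth_circle g \<longrightarrow> act (\<lambda>s. s) j (a j (circle_fun g)) = a j (circle_fun (P g))"
    using functionals by (elim exE conjE)
  note a = a'[rule_format]
  have cf: "continuous_on UNIV f" "periodic2pi f" using smooth_circle_continuous smooth_circle_periodic f by auto
  have Pf: "circle_fun (P f) = \<tau> *\<^sub>R circle_fun f"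
    using cf P_continuous[OF f(1)] P_periodic[OF f(1)] by (intro bcontfun_eqI) (simp add: apply_circle_fun f(2))
  have "a j (circle_fun f) = 0" for j
  proof -
    let ?x = "a j (circle_fun f)"
    have e: "act (\<lambda>s. s) j ?x = \<tau> *\<^sub>R ?x"
      using a(5)[OF f(1)] by (simp add: Pf linear_scale[OF bounded_linear.linear[OF a(1)]])
    show ?thesis
    proof (cases "s1 j \<in> \<real>")
      case True
      then have "Re (s1 j) \<noteq> \<tau>" "Re (s2 j) \<noteq> \<tau>"
        using \<tau>[of j] real_pair[OF True] by (auto simp: complex_eq_iff complex_is_Real_iff)
      then show ?thesis using e True by (auto simp: act_def complex_eq_iff)
    next
      case False
      then have "(s1 j - of_real \<tau>) * ?x = 0" using e by (simp add: act_def scaleR_conv_of_real algebra_simps)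
      then show ?thesis using \<tau>(1)[of j] by auto
    qed
  qed
  then have "circle_fun f = 0" using a(4) circle_fun_in[OF cf] by blast
  then show ?thesis using apply_circle_fun[OF cf] by (metis zero_bcontfun.rep_eq)
qed

text \<open>The functionals need differentiability in the sup norm, while a solution provides it
  only for each fixed \<open>t\<close>. Uniform continuity of the radial derivative on a compact
  rectangle makes the linearisation error uniform in \<open>t\<close>.\<close>

lemma solution_curve:
  assumes \<delta>: "0 \<le> \<delta>" and L: "L_solution lam nu c \<delta> R u" and r: "\<delta> < r" "ereal r < R"
  shows "smooth_circle (u r) \<and>
    ((\<lambda>\<rho>. circle_fun (u \<rho>)) has_vector_derivative inverse r *\<^sub>R circle_fun (P (u r))) (at r)"
proof -
  obtain ur where cur: "continuous_on (cyl \<delta> R) (\<lambda>(r, t). ur r t)"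
    and ur: "\<And>r t. (r, t) \<in> cyl \<delta> R \<Longrightarrow> ((\<lambda>\<rho>. u \<rho> t) has_vector_derivative ur r t) (at r)"
    and Pu: "\<And>r t. (r, t) \<in> cyl \<delta> R \<Longrightarrow> P (u r) t = r *\<^sub>R ur r t"
    and sm: "\<And>r t. (r, t) \<in> cyl \<delta> R \<Longrightarrow> smooth_circle (u r)"
    using L_solution_slice[OF L] by blast
  have r0: "0 < r" using \<delta> r by simp
  obtain r2 where r2: "r < r2" "ereal r2 < R" using ereal_dense2[OF r(2)] by auto
  define r1 where "r1 = (\<delta> + r) / 2"
  have r1: "\<delta> < r1" "r1 < r" using r by (auto simp: r1_def)
  have cyl: "(\<rho>, t) \<in> cyl \<delta> R" if "\<rho> \<in> {r1..r2}" for \<rho> t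
  proof -
    have "ereal \<rho> \<le> ereal r2" using that by simp
    then have "ereal \<rho> < R" using r2(2) by (rule order_le_less_trans)
    then show ?thesis using that r1 by (simp add: cyl_def)
  qed
  have smr: "smooth_circle (u \<rho>)" if "\<rho> \<in> {r1..r2}" for \<rho> using sm cyl[OF that] by blast
  have rin: "r \<in> {r1..r2}" using r1 r2 by simp
  have cf: "continuous_on UNIV (u \<rho>)" "periodic2pi (u \<rho>)" "continuous_on UNIV (P (u \<rho>))" "periodic2pi (P (u \<rho>))"
    if "\<rho> \<in> {r1..r2}" for \<rho>
    using smr[OF that] smooth_circle_continuous smooth_circle_periodic P_continuous P_periodic by auto
  have unif: "uniformly_continuous_on ({r1..r2} \<times> {0..2*pi}) (\<lambda>(r, t). ur r t)"
    by (intro compact_uniformly_continuous compact_Times continuous_on_subset[OF cur]) (auto intro: cyl)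
  let ?F = "\<lambda>\<rho>. circle_fun (u \<rho>)" and ?D = "inverse r *\<^sub>R circle_fun (P (u r))"
  have "(?F has_derivative (\<lambda>h. h *\<^sub>R ?D)) (at r)"
    unfolding has_derivative_at_alt
  proof (intro conjI allI impI bounded_linear_scaleR_left)
    fix e :: real assume "0 < e"
    then obtain d where d: "d > 0" "\<And>x x'. x \<in> {r1..r2} \<times> {0..2*pi} \<Longrightarrow> x' \<in> {r1..r2} \<times> {0..2*pi} \<Longrightarrow>
        dist x' x < d \<Longrightarrow> dist ((\<lambda>(r, t). ur r t) x') ((\<lambda>(r, t). ur r t) x) < e"
      using unif unfolding uniformly_continuous_on_def by metis
    define d' where "d' = min d (min (r - r1) (r2 - r))"
    have d': "d' > 0" using d(1) r1 r2 by (simp add: d'_def)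
    have "norm (?F y - ?F r - (y - r) *\<^sub>R ?D) \<le> e * norm (y - r)" if y: "norm (y - r) < d'" for y
    proof (rule circle_functions_norm_le)
      have yin: "y \<in> {r1..r2}" using y by (auto simp: d'_def)
      show "?F y - ?F r - (y - r) *\<^sub>R ?D \<in> circle_functions"
        using subspace_circle_functions cf yin rin
        by (intro subspace_diff subspace_scale circle_fun_in) auto
      fix t assume t: "t \<in> {0..2*pi}"
      have "norm (u y t - u r t - (y - r) *\<^sub>R ur r t) \<le> norm (y - r) * e"
      proof (rule vector_differentiable_bound_linearization[where S = "closed_segment r y"
            and f = "\<lambda>\<rho>. u \<rho> t" and f' = "\<lambda>\<rho>. ur \<rho> t" and ?x0.0 = r])
        let ?S = "closed_segment r y"
        have S: "\<rho> \<in> {r1..r2}" "\<bar>\<rho> - r\<bar> < d" if "\<rho> \<in> ?S" for \<rho>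
          using that y by (auto simp: closed_segment_eq_real_ivl d'_def split: if_splits)
        show "((\<lambda>\<rho>. u \<rho> t) has_vector_derivative ur \<rho> t) (at \<rho> within ?S)" if "\<rho> \<in> ?S" for \<rho>
          using ur[OF cyl[OF S(1)[OF that]]] by (rule has_vector_derivative_at_within)
        show "norm (ur \<rho> t - ur r t) \<le> e" if "\<rho> \<in> ?S" for \<rho>
          using d(2)[of "(r, t)" "(\<rho>, t)"] S[OF that] t rin
          by (auto simp: dist_norm less_imp_le norm_Pair)
        show "closed_segment r y \<subseteq> ?S" by simp
        show "r \<in> ?S" by simp
      qed
      moreover have D: "apply_bcontfun ?D t = ur r t"
        using Pu[OF cyl[OF rin]] cf[OF rin] r0 by (simp add: apply_circle_fun)
      moreover have "apply_bcontfun (?F y - ?F r - (y - r) *\<^sub>R v) t = u y t - u r t - (y - r) *\<^sub>R apply_bcontfun v t" for v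
        using cf[OF rin] cf[OF yin] by (simp add: apply_circle_fun)
      ultimately show "norm (apply_bcontfun (?F y - ?F r - (y - r) *\<^sub>R ?D) t) \<le> e * norm (y - r)"
        by (simp only: D mult.commute)
    qed
    with d' show "\<exists>d>0. \<forall>y. norm (y - r) < d \<longrightarrow> norm (?F y - ?F r - (y - r) *\<^sub>R ?D) \<le> e * norm (y - r)"
      by blast
  qed
  with smr[OF rin] show ?thesis by (simp add: has_vector_derivative_def)
qed

text \<open>The power \<open>r powr s\<close> on each block, that is, the evolution with
  \<open>r\<close> times the derivative equal to \<open>P\<close>, normalised to the identity at
  \<open>r = 1\<close>.\<close>

definition flow :: "real \<Rightarrow> int \<Rightarrow> complex \<Rightarrow> complex" where
  "flow r = act (\<lambda>s. exp (s * of_real (ln r)))"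

lemma flow_real:
  assumes "s1 j \<in> \<real>"
  shows "flow r j z = Complex (exp (Re (s1 j) * ln r) * Re z) (exp (Re (s2 j) * ln r) * Im z)"
proof -
  have e: "s = of_real (Re s) \<Longrightarrow> Re (exp (s * of_real x)) = exp (Re s * x)" for s x
    by (metis Re_complex_of_real exp_of_real of_real_mult)
  have "s1 j = of_real (Re (s1 j))" "s2 j = of_real (Re (s2 j))"
    using assms real_pair[OF assms] by (auto simp: complex_eq_iff complex_is_Real_iff)
  with assms show ?thesis by (simp add: flow_def act_def e del: Re_exp)
qed

text \<open>Multiplication by \<open>exp (- s * ln r)\<close>, in each real coordinate separately if
  the exponents are real, produces a function with zero derivative on a convex set.\<close>

lemma flow_constant:
  assumes "convex S" "S \<subseteq> {0<..}"
    and \<alpha>: "\<And>r. r \<in> S \<Longrightarrow> (\<alpha> has_vector_derivative inverse r *\<^sub>R act (\<lambda>s. s) j (\<alpha> r)) (at r)"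
  shows "\<exists>\<zeta>. \<forall>r\<in>S. \<alpha> r = flow r j \<zeta>"
proof (cases "s1 j \<in> \<real>")
  case True
  have comp: "\<exists>\<zeta>. \<forall>r\<in>S. f r = exp (x * ln r) * \<zeta>"
    if f: "\<And>r. r \<in> S \<Longrightarrow> (f has_real_derivative inverse r * (x * f r)) (at r)" for f :: "real \<Rightarrow> real" and x
  proof -
    have d0: "((\<lambda>r. exp (- x * ln r) * f r) has_vector_derivative 0) (at r within S)" if "r \<in> S" for r
    proof -
      have r: "r > 0" using that assms(2) by auto
      have "((\<lambda>r. exp (- x * ln r)) has_real_derivative exp (- x * ln r) * (- x * inverse r)) (at r)"
        using r by (auto intro!: derivative_eq_intros simp: inverse_eq_divide)
      from DERIV_mult[OF this f[OF that]]
      have "((\<lambda>r. exp (- x * ln r) * f r) has_real_derivative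
          exp (- x * ln r) * (- x * inverse r) * f r + inverse r * (x * f r) * exp (- x * ln r)) (at r)" .
      moreover have "exp (- x * ln r) * (- x * inverse r) * f r + inverse r * (x * f r) * exp (- x * ln r) = 0"
        by (simp add: mult_ac)
      ultimately show ?thesis
        by (simp only: has_real_derivative_iff_has_vector_derivative has_vector_derivative_at_within)
    qed
    obtain \<zeta> where "\<And>r. r \<in> S \<Longrightarrow> exp (- x * ln r) * f r = \<zeta>"
      using has_vector_derivative_zero_constant[OF assms(1) d0] by blast
    then have "f r = exp (x * ln r) * \<zeta>" if "r \<in> S" for r
      using that by (auto simp: exp_minus field_simps)
    then show ?thesis by blast
  qed
  have "(Re \<circ> \<alpha> has_real_derivative inverse r * (Re (s1 j) * (Re \<circ> \<alpha>) r)) (at r)" if "r \<in> S" for r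
    using bounded_linear.has_vector_derivative[OF bounded_linear_Re \<alpha>[OF that]] True
    by (simp add: has_real_derivative_iff_has_vector_derivative act_def o_def)
  from comp[OF this] obtain \<zeta>1 where 1: "\<And>r. r \<in> S \<Longrightarrow> Re (\<alpha> r) = exp (Re (s1 j) * ln r) * \<zeta>1" by auto
  have "(Im \<circ> \<alpha> has_real_derivative inverse r * (Re (s2 j) * (Im \<circ> \<alpha>) r)) (at r)" if "r \<in> S" for r
    using bounded_linear.has_vector_derivative[OF bounded_linear_Im \<alpha>[OF that]] True
    by (simp add: has_real_derivative_iff_has_vector_derivative act_def o_def)
  from comp[OF this] obtain \<zeta>2 where 2: "\<And>r. r \<in> S \<Longrightarrow> Im (\<alpha> r) = exp (Re (s2 j) * ln r) * \<zeta>2" by auto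
  show ?thesis
    by (rule exI[of _ "Complex \<zeta>1 \<zeta>2"]) (auto simp: flow_real[OF True] complex_eq_iff 1 2)
next
  case False
  let ?s = "s1 j"
  have d0: "((\<lambda>r. exp (- ?s * of_real (ln r)) * \<alpha> r) has_vector_derivative 0) (at r within S)" if "r \<in> S" for r
  proof -
    have r: "r > 0" using that assms(2) by auto
    have e1: "((\<lambda>x. exp (- ?s * of_real x)) has_vector_derivative (- ?s * exp (- ?s * of_real x))) (at x)" for x
    proof -
      have "((\<lambda>z. exp (- ?s * z)) has_field_derivative (- ?s * exp (- ?s * of_real x))) (at (of_real x))"
        by (auto intro!: derivative_eq_intros)
      from has_vector_derivative_real_field[OF this] show ?thesis by (simp add: o_def)
    qed
    have l1: "(ln has_vector_derivative inverse r) (at r)"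
      using r unfolding has_real_derivative_iff_has_vector_derivative[symmetric]
      by (auto intro!: derivative_eq_intros simp: inverse_eq_divide)
    have "((\<lambda>r. exp (- ?s * of_real (ln r))) has_vector_derivative
        inverse r *\<^sub>R (- ?s * exp (- ?s * of_real (ln r)))) (at r)"
      using vector_diff_chain_at[OF l1 e1] by (simp only: o_def)
    from has_vector_derivative_mult[OF this \<alpha>[OF that]]
    have "((\<lambda>r. exp (- ?s * of_real (ln r)) * \<alpha> r) has_vector_derivative
       exp (- ?s * of_real (ln r)) * (inverse r *\<^sub>R act (\<lambda>s. s) j (\<alpha> r))
       + inverse r *\<^sub>R (- ?s * exp (- ?s * of_real (ln r))) * \<alpha> r) (at r)" .
    moreover have "exp (- ?s * of_real (ln r)) * (inverse r *\<^sub>R act (\<lambda>s. s) j (\<alpha> r))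
       + inverse r *\<^sub>R (- ?s * exp (- ?s * of_real (ln r))) * \<alpha> r = 0"
      using False by (simp add: act_def scaleR_conv_of_real mult_ac)
    ultimately show ?thesis by (simp only: has_vector_derivative_at_within)
  qed
  obtain \<zeta> where \<zeta>: "\<And>r. r \<in> S \<Longrightarrow> exp (- ?s * of_real (ln r)) * \<alpha> r = \<zeta>"
    using has_vector_derivative_zero_constant[OF assms(1) d0] by blast
  have "\<alpha> r = flow r j \<zeta>" if "r \<in> S" for r
    using \<zeta>[OF that] False by (auto simp: flow_def act_def exp_minus field_simps)
  then show ?thesis by blast
qed

lemma norm_G_le:
  assumes "N \<le> \<bar>j\<bar>"
  shows "norm (G j z) \<le> (1 + 2 * M) * norm z"
proof -
  have "1 \<le> \<bar>real_of_int j\<bar>" using assms N_ge_1 by linarith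
  then have "2 * M / \<bar>of_int j\<bar> \<le> 2 * M / 1"
    using M_nonneg by (intro divide_left_mono) auto
  then have "eta j \<le> 2 * M" using eta_le[OF assms] by simp
  then have "eta j * norm z \<le> 2 * M * norm z" by (intro mult_right_mono) auto
  then show ?thesis
    using norm_triangle_ineq[of "G j z - mode j z" "mode j z"] G_close[of j z] norm_mode[of j z]
    by (simp add: algebra_simps)
qed

lemma norm_flow_high:
  assumes "N \<le> \<bar>j\<bar>"
  shows "norm (flow r j z) = exp (Re (s1 j) * ln r) * norm z"
  using s1_nonreal[OF assms] by (simp add: flow_def act_def norm_mult)

text \<open>The real part of the exponent is \<open>Re lam * j\<close> up to \<open>M\<close>.
  Comparison with the larger radius gives decay for \<open>0 \<le> j\<close>, comparison with the
  smaller one for \<open>j < 0\<close>; adding both majorants covers all high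
  \<open>j\<close>.\<close>

lemma flow_decay:
  fixes b :: real
  assumes \<rho>: "\<rho>1 < r" "r < \<rho>2" "0 < \<rho>1"
    and b: "\<And>j. norm (flow \<rho>1 j (\<zeta> j)) \<le> b" "\<And>j. norm (flow \<rho>2 j (\<zeta> j)) \<le> b"
  obtains K1 q1 K2 q2 where "0 \<le> K1" "0 \<le> q1" "q1 < 1" "0 \<le> K2" "0 \<le> q2" "q2 < 1"
    "\<And>j. N \<le> \<bar>j\<bar> \<Longrightarrow> norm (flow r j (\<zeta> j)) \<le> K1 * q1 ^ nat \<bar>j\<bar> + K2 * q2 ^ nat \<bar>j\<bar>"
proof -
  define d1 where "d1 = ln r - ln \<rho>1"
  define d2 where "d2 = ln \<rho>2 - ln r"
  have d: "0 < d1" "0 < d2" using \<rho> by (auto simp: d1_def d2_def)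
  have b0: "0 \<le> b" using b(1) norm_ge_zero order_trans by blast
  \<comment> \<open>The two ratios are \<open>(\<rho>1 / r) powr Re lam\<close> and
    \<open>(r / \<rho>2) powr Re lam\<close>; the factor \<open>exp (d * M)\<close> pays for the
    deviation of the exponent from \<open>lam * of_int j\<close>.\<close>
  let ?q = "\<lambda>d. exp (- d * Re lam)" and ?K = "\<lambda>d. b * exp (d * M)"
  have "norm (flow r j (\<zeta> j)) \<le> ?K d1 * ?q d1 ^ nat \<bar>j\<bar> + ?K d2 * ?q d2 ^ nat \<bar>j\<bar>" if j: "N \<le> \<bar>j\<bar>" for j
  proof -
    let ?s = "Re (s1 j)"
    have "\<bar>Re (s1 j - lam * of_int j)\<bar> \<le> M"
      using s1_close[OF j] abs_Re_le_cmod order_trans by blast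
    then have s: "\<bar>?s - Re lam * of_int j\<bar> \<le> M" by simp
    have step: "norm (flow r j (\<zeta> j)) \<le> exp (?s * (ln r - ln \<rho>)) * b"
      if "norm (flow \<rho> j (\<zeta> j)) \<le> b" for \<rho>
    proof -
      have "norm (flow r j (\<zeta> j)) = exp (?s * (ln r - ln \<rho>)) * norm (flow \<rho> j (\<zeta> j))"
        unfolding norm_flow_high[OF j] by (simp add: algebra_simps flip: exp_add mult.assoc)
      also have "\<dots> \<le> exp (?s * (ln r - ln \<rho>)) * b" using that by (intro mult_left_mono) auto
      finally show ?thesis .
    qed
    have geom: "exp (d * M) * ?q d ^ nat \<bar>j\<bar> = exp (d * (M - Re lam * \<bar>of_int j\<bar>))" for d
    proof -
      have "?q d ^ nat \<bar>j\<bar> = exp (real (nat \<bar>j\<bar>) * (- d * Re lam))" by (rule exp_of_nat_mult[symmetric])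
      then show ?thesis by (simp add: algebra_simps flip: exp_add)
    qed
    have nonneg: "0 \<le> ?K d * ?q d ^ nat \<bar>j\<bar>" for d using b0 by simp
    have K: "x * b \<le> ?K d * ?q d ^ nat \<bar>j\<bar>" if "x \<le> exp (d * (M - Re lam * \<bar>of_int j\<bar>))" for x d
      using mult_right_mono[OF that b0] geom[of d] by (simp add: mult_ac)
    show ?thesis
    proof (cases "0 \<le> j")
      case True
      then have "Re lam * \<bar>of_int j\<bar> - M \<le> ?s" using s by simp
      then have "d2 * (Re lam * \<bar>of_int j\<bar> - M) \<le> d2 * ?s" using d by (intro mult_left_mono) auto
      then have "?s * (ln r - ln \<rho>2) \<le> d2 * (M - Re lam * \<bar>of_int j\<bar>)" by (simp add: d2_def algebra_simps)
      then have "exp (?s * (ln r - ln \<rho>2)) * b \<le> ?K d2 * ?q d2 ^ nat \<bar>j\<bar>" by (intro K) simp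
      then show ?thesis using step[OF b(2)] nonneg[of d1] by linarith
    next
      case False
      then have "?s \<le> M - Re lam * \<bar>of_int j\<bar>" using s by simp
      then have "d1 * ?s \<le> d1 * (M - Re lam * \<bar>of_int j\<bar>)" using d by (intro mult_left_mono) auto
      then have "?s * (ln r - ln \<rho>1) \<le> d1 * (M - Re lam * \<bar>of_int j\<bar>)" by (simp add: d1_def algebra_simps)
      then have "exp (?s * (ln r - ln \<rho>1)) * b \<le> ?K d1 * ?q d1 ^ nat \<bar>j\<bar>" by (intro K) simp
      then show ?thesis using step[OF b(1)] nonneg[of d2] by linarith
    qed
  qed
  moreover have "?q d < 1" if "0 < d" for d using that Re_lam by simp
  ultimately show thesis using d b0 by (intro that[of "?K d1" "?q d1" "?K d2" "?q d2"]) auto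
qed

lemma solution_expansion:
  "\<exists>B>0. \<forall>\<delta> R u. 0 \<le> \<delta> \<and> L_solution lam nu c \<delta> R u \<longrightarrow>
     (\<exists>\<zeta>. (\<forall>r t. (r, t) \<in> cyl \<delta> R \<longrightarrow> ((\<lambda>j. Gf j (flow r j (\<zeta> j)) t) has_sum u r t) UNIV) \<and>
         (\<forall>r j. \<delta> < r \<and> ereal r < R \<longrightarrow> norm (flow r j (\<zeta> j)) \<le> B * (SUP \<theta>\<in>{0..2*pi}. norm (u r \<theta>))))"
proof -
  obtain a B where a': "\<forall>j. bounded_linear (a j)" "\<forall>j v. norm (a j v) \<le> B * norm v"
    "\<forall>i j z. a i (G j z) = (if i = j then z else 0)"
    "\<forall>v\<in>circle_functions. (\<forall>j. a j v = 0) \<longrightarrow> v = 0"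
    "\<forall>j g. smooth_circle g \<longrightarrow> act (\<lambda>s. s) j (a j (circle_fun g)) = a j (circle_fun (P g))"
    using functionals by (elim exE conjE)
  note a = a'[rule_format]
  have lin: "linear (a j)" for j using a(1) bounded_linear.linear by blast
  \<comment> \<open>A positive bound of the functionals, fixed before \<open>\<delta>\<close>,
    \<open>R\<close> and \<open>u\<close> appear, so the coefficient estimate is uniform over all
    solutions.\<close>
  define B' where "B' = \<bar>B\<bar> + 1"
  have aB: "norm (a j v) \<le> B' * norm v" for j v
    using a(2)[of j v] mult_right_mono[of B B' "norm v"] by (simp add: B'_def) (smt (verit))
  show ?thesis
  proof (intro exI[of _ B'] conjI allI impI)
    show "0 < B'" by (simp add: B'_def)
    fix \<delta> R u assume "0 \<le> \<delta> \<and> L_solution lam nu c \<delta> R u"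
    then have \<delta>: "0 \<le> \<delta>" and L: "L_solution lam nu c \<delta> R u" by auto
    define I where "I = {r. \<delta> < r \<and> ereal r < R}"
    have "convex I"
      unfolding is_interval_convex_1[symmetric] is_interval_1 I_def
      by (auto intro: order_le_less_trans[of "ereal _" "ereal _"])
    have I0: "I \<subseteq> {0<..}" using \<delta> by (auto simp: I_def)
    define \<alpha> where "\<alpha> j r = a j (circle_fun (u r))" for j r
    have sm: "smooth_circle (u r)" if "r \<in> I" for r
      using solution_curve[OF \<delta> L] that by (auto simp: I_def)
    have cf: "continuous_on UNIV (u r)" "periodic2pi (u r)" if "r \<in> I" for r
      using sm[OF that] smooth_circle_continuous smooth_circle_periodic by auto
    have "(\<alpha> j has_vector_derivative inverse r *\<^sub>R act (\<lambda>s. s) j (\<alpha> j r)) (at r)" if "r \<in> I" for j r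
    proof -
      have "((\<lambda>\<rho>. circle_fun (u \<rho>)) has_vector_derivative inverse r *\<^sub>R circle_fun (P (u r))) (at r)"
        using solution_curve[OF \<delta> L] that by (auto simp: I_def)
      from bounded_linear.has_vector_derivative[OF a(1) this, of j] show ?thesis
        by (simp add: \<alpha>_def[abs_def] a(5)[OF sm[OF that]] linear_scale[OF lin])
    qed
    then have "\<exists>\<zeta>. \<forall>r\<in>I. \<alpha> j r = flow r j \<zeta>" for j
      by (intro flow_constant \<open>convex I\<close> I0)
    then obtain \<zeta> where \<zeta>: "\<And>j r. r \<in> I \<Longrightarrow> flow r j (\<zeta> j) = \<alpha> j r" by metis
    have sup: "norm (circle_fun (u r)) \<le> (SUP \<theta>\<in>{0..2*pi}. norm (u r \<theta>))" if "r \<in> I" for r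
    proof (rule circle_functions_norm_le[OF circle_fun_in[OF cf[OF that]]])
      fix t assume t: "t \<in> {0..2*pi}"
      have "bdd_above ((\<lambda>\<theta>. norm (u r \<theta>)) ` {0..2*pi})"
        using norm_bounded[of "circle_fun (u r)"] apply_circle_fun[OF cf[OF that]]
        by (intro bdd_aboveI[of _ "norm (circle_fun (u r))"]) auto
      then show "norm (apply_bcontfun (circle_fun (u r)) t) \<le> (SUP \<theta>\<in>{0..2*pi}. norm (u r \<theta>))"
        unfolding apply_circle_fun[OF cf[OF that]] using t by (rule cSUP_upper2) auto
    qed
    have bound: "norm (flow r j (\<zeta> j)) \<le> B' * norm (circle_fun (u r))" if "r \<in> I" for r j
      unfolding \<zeta>[OF that] \<alpha>_def by (rule aB)
    have expand: "((\<lambda>j. Gf j (flow r j (\<zeta> j)) t) has_sum u r t) UNIV" if r: "r \<in> I" for r t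
    proof -
      \<comment> \<open>Two radii around \<open>r\<close> inside the interval: the coefficient
        bounds there become the geometric decay at \<open>r\<close>.\<close>
      obtain \<rho>2 where \<rho>2: "r < \<rho>2" "ereal \<rho>2 < R" using ereal_dense2[of r R] r by (auto simp: I_def)
      define \<rho>1 where "\<rho>1 = (\<delta> + r) / 2"
      have \<rho>1: "\<delta> < \<rho>1" "\<rho>1 < r" using r by (auto simp: \<rho>1_def I_def)
      have "ereal \<rho>1 < R" using \<rho>1(2) r by (auto simp: I_def intro: order_less_trans[of _ "ereal r"])
      then have \<rho>I: "\<rho>1 \<in> I" "\<rho>2 \<in> I" using \<rho>1 \<rho>2 r by (auto simp: I_def)
      define b where "b = B' * max (norm (circle_fun (u \<rho>1))) (norm (circle_fun (u \<rho>2)))"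
      have b: "norm (flow \<rho> j (\<zeta> j)) \<le> b" if "\<rho> = \<rho>1 \<or> \<rho> = \<rho>2" for \<rho> j
      proof -
        have "B' * norm (circle_fun (u \<rho>)) \<le> b"
          unfolding b_def using that by (intro mult_left_mono) (auto simp: B'_def)
        moreover have "\<rho> \<in> I" using that \<rho>I by auto
        ultimately show ?thesis using bound order_trans by blast
      qed
      obtain K1 q1 K2 q2 where Kq: "0 \<le> K1" "0 \<le> q1" "q1 < 1" "0 \<le> K2" "0 \<le> q2" "q2 < 1"
        "\<And>j. N \<le> \<bar>j\<bar> \<Longrightarrow> norm (flow r j (\<zeta> j)) \<le> K1 * q1 ^ nat \<bar>j\<bar> + K2 * q2 ^ nat \<bar>j\<bar>"
        using flow_decay[of \<rho>1 r \<rho>2 \<zeta> b] \<rho>1 \<rho>2 \<delta> b by (smt (verit, best))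
      let ?g = "\<lambda>j. G j (flow r j (\<zeta> j))"
      have "(\<lambda>j. (if \<bar>j\<bar> < N then norm (?g j) else 0) + (1 + 2 * M) * (K1 * q1 ^ nat \<bar>j\<bar> + K2 * q2 ^ nat \<bar>j\<bar>)) summable_on UNIV"
      proof (intro summable_on_add summable_on_cmult_right)
        show "(\<lambda>j. if \<bar>j\<bar> < N then norm (?g j) else 0) summable_on UNIV"
          by (rule finite_nonzero_values_imp_summable_on) (rule finite_subset[OF _ finite_low], auto)
        show "(\<lambda>j::int. q1 ^ nat \<bar>j\<bar>) summable_on UNIV" "(\<lambda>j::int. q2 ^ nat \<bar>j\<bar>) summable_on UNIV"
          using Kq by (auto intro!: summable_on_int_nat_abs summable_geometric)
      qed
      then have "(\<lambda>j. norm (?g j)) summable_on UNIV"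
      proof (rule summable_on_comparison_test)
        fix j
        show "norm (?g j) \<le> (if \<bar>j\<bar> < N then norm (?g j) else 0) + (1 + 2 * M) * (K1 * q1 ^ nat \<bar>j\<bar> + K2 * q2 ^ nat \<bar>j\<bar>)"
        proof (cases "\<bar>j\<bar> < N")
          case True
          have "0 \<le> (1 + 2 * M) * (K1 * q1 ^ nat \<bar>j\<bar> + K2 * q2 ^ nat \<bar>j\<bar>)"
            using Kq M_nonneg by simp
          with True show ?thesis by simp
        next
          case False
          then have "norm (?g j) \<le> (1 + 2 * M) * norm (flow r j (\<zeta> j))" by (intro norm_G_le) simp
          also have "\<dots> \<le> (1 + 2 * M) * (K1 * q1 ^ nat \<bar>j\<bar> + K2 * q2 ^ nat \<bar>j\<bar>)"
            using False M_nonneg by (intro mult_left_mono Kq(7)) auto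
          finally show ?thesis using False by simp
        qed
      qed auto
      then have "?g summable_on UNIV" by (rule abs_summable_summable)
      then obtain s where s: "(?g has_sum s) UNIV"
        unfolding summable_on_def by blast
      have "s \<in> circle_functions"
      proof (rule Lim_in_closed_set[OF closed_circle_functions])
        show "(sum ?g \<longlongrightarrow> s) (finite_subsets_at_top UNIV)" using s by (simp add: has_sum_def)
        show "\<forall>\<^sub>F A in finite_subsets_at_top UNIV. sum ?g A \<in> circle_functions"
          by (intro always_eventually allI subspace_sum subspace_circle_functions G_in)
      qed simp
      moreover have "a i s = a i (circle_fun (u r))" for i
      proof -
        have "((\<lambda>j. a i (?g j)) has_sum a i s) UNIV"
          using has_sum_bounded_linear[OF a(1) s] by (simp add: o_def)
        moreover have "((\<lambda>j. a i (?g j)) has_sum \<alpha> i r) UNIV"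
        proof -
          have "((\<lambda>j. a i (?g j)) has_sum (\<Sum>j\<in>{i}. a i (?g j))) {i}" by (rule has_sum_finite) simp
          moreover have "((\<lambda>j. a i (?g j)) has_sum (\<Sum>j\<in>{i}. a i (?g j))) {i} \<longleftrightarrow>
              ((\<lambda>j. a i (?g j)) has_sum (\<Sum>j\<in>{i}. a i (?g j))) UNIV"
            by (rule has_sum_cong_neutral) (auto simp: a(3))
          ultimately have "((\<lambda>j. a i (?g j)) has_sum (\<Sum>j\<in>{i}. a i (?g j))) UNIV" by simp
          then show ?thesis by (simp add: a(3) \<zeta>[OF r])
        qed
        ultimately show ?thesis unfolding \<alpha>_def by (rule has_sum_unique)
      qed
      ultimately have "s - circle_fun (u r) = 0"
        using circle_fun_in[OF cf[OF r]] subspace_circle_functions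
        by (intro a(4) subspace_diff) (auto simp: linear_diff[OF lin])
      then have "s = circle_fun (u r)" by simp
      from has_sum_bounded_linear[OF bounded_linear_apply_bcontfun s[unfolded this], of t]
      show ?thesis by (simp add: o_def apply_G apply_circle_fun[OF cf[OF r]])
    qed
    show "\<exists>\<zeta>. (\<forall>r t. (r, t) \<in> cyl \<delta> R \<longrightarrow> ((\<lambda>j. Gf j (flow r j (\<zeta> j)) t) has_sum u r t) UNIV) \<and>
         (\<forall>r j. \<delta> < r \<and> ereal r < R \<longrightarrow> norm (flow r j (\<zeta> j)) \<le> B' * (SUP \<theta>\<in>{0..2*pi}. norm (u r \<theta>)))"
    proof (intro exI[of _ \<zeta>] conjI allI impI)
      fix r t assume "(r, t) \<in> cyl \<delta> R"
      then show "((\<lambda>j. Gf j (flow r j (\<zeta> j)) t) has_sum u r t) UNIV"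
        by (intro expand) (simp add: I_def cyl_def)
    next
      fix r j assume "\<delta> < r \<and> ereal r < R"
      then have r: "r \<in> I" by (simp add: I_def)
      have "norm (flow r j (\<zeta> j)) \<le> B' * norm (circle_fun (u r))" by (rule bound[OF r])
      also have "\<dots> \<le> B' * (SUP \<theta>\<in>{0..2*pi}. norm (u r \<theta>))"
        using sup[OF r] by (intro mult_left_mono) (auto simp: B'_def)
      finally show "norm (flow r j (\<zeta> j)) \<le> B' * (SUP \<theta>\<in>{0..2*pi}. norm (u r \<theta>))" .
    qed
  qed
qed

end

section \<open>The family of basic solutions\<close>

text \<open>The function \<open>vp j s\<close> is the partner of the slice \<open>w j s 1\<close>
  provided by \<open>basic_solution_pair\<close>, and \<open>N\<close>, \<open>M\<close> are
  extracted from the asymptotic normalisation.\<close>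

locale circle_family = circle_operator +
  fixes w :: "int \<Rightarrow> bool \<Rightarrow> real \<Rightarrow> real \<Rightarrow> complex" and \<sigma> :: "int \<Rightarrow> bool \<Rightarrow> complex"
    and vp :: "int \<Rightarrow> bool \<Rightarrow> real \<Rightarrow> complex" and N :: int and M :: real
  assumes basic: "basic_solution lam nu c (w j s) (\<sigma> j s) j"
    and independent: "(\<And>r t. 0 < r \<Longrightarrow> of_real x * w j True r t + of_real y * w j False r t = 0)
            \<Longrightarrow> x = 0 \<and> y = 0"
    and same_exponent: "\<sigma> j True \<notin> \<real> \<Longrightarrow> \<sigma> j False = \<sigma> j True"
    and pair: "spectral_pair (Re (\<sigma> j s)) (Im (\<sigma> j s)) (w j s 1) (vp j s)"
    and w_formula: "0 < r \<Longrightarrow> w j s r t =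
       (r powr Re (\<sigma> j s)) *\<^sub>R (cos (Im (\<sigma> j s) * ln r) *\<^sub>R w j s 1 t + sin (Im (\<sigma> j s) * ln r) *\<^sub>R vp j s t)"
    and winding_real: "\<sigma> j s \<in> \<real> \<Longrightarrow> has_winding (w j s 1) j"
    and pair_pos: "\<sigma> j s \<notin> \<real> \<Longrightarrow> 0 < Im (cnj (w j s 1 t) * vp j s t)"
    and high_N: "1 \<le> N"
    and high_nonreal: "N \<le> \<bar>j\<bar> \<Longrightarrow> \<sigma> j True \<notin> \<real>"
    and high_exponent: "N \<le> \<bar>j\<bar> \<Longrightarrow> norm (\<sigma> j True - lam * of_int j) \<le> M"
    and high_w: "N \<le> \<bar>j\<bar> \<Longrightarrow> norm (w j True 1 t - cis (of_int j * t)) \<le> M / \<bar>of_int j\<bar>"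
    and high_vp: "N \<le> \<bar>j\<bar> \<Longrightarrow> norm (vp j True t - \<i> * cis (of_int j * t)) \<le> M / \<bar>of_int j\<bar>"
    and high_minus: "N \<le> \<bar>j\<bar> \<Longrightarrow> w j False 1 t = vp j True t"
begin

text \<open>The case of a real and a nonreal exponent with the same winding number is not excluded by the
  hypotheses; the block is then spanned by the nonreal pair, and the case is refuted once the blocks are
  known to be complete.\<close>

definition mixed :: "int \<Rightarrow> bool" where
  "mixed j \<longleftrightarrow> \<sigma> j True \<in> \<real> \<and> \<sigma> j False \<notin> \<real>"

definition e1 :: "int \<Rightarrow> complex" where "e1 j = (if mixed j then \<sigma> j False else \<sigma> j True)"

definition e2 :: "int \<Rightarrow> complex" where "e2 j = \<sigma> j False"

definition fU :: "int \<Rightarrow> real \<Rightarrow> complex" where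
  "fU j = (if mixed j then w j False 1 else w j True 1)"

text \<open>In a nonreal block the second vector must be the partner \<open>vp\<close>, which
  completes a spectral pair; \<open>w j False 1\<close> is in general another vector of that plane
  and is recovered in \<open>coefficients_nonreal\<close>.\<close>

definition fV :: "int \<Rightarrow> real \<Rightarrow> complex" where
  "fV j = (if mixed j then vp j False else if \<sigma> j True \<notin> \<real> then vp j True else w j False 1)"

lemma smooth_w: "smooth_circle (w j s 1)" and smooth_vp: "smooth_circle (vp j s)"
  using pair[of j s] by (auto simp: spectral_pair_def)

lemma e1_in: "e1 j \<in> {\<sigma> j True, \<sigma> j False}" and e2_in: "e2 j \<in> {\<sigma> j True, \<sigma> j False}"
  by (auto simp: e1_def e2_def)

lemma exponents_disjoint:
  assumes "i \<noteq> j"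
  shows "\<sigma> i s \<noteq> \<sigma> j s'" "\<sigma> i s \<noteq> cnj (\<sigma> j s')"
  using basic_solution_winding_unique[OF basic[of j s'] basic[of i s]] assms by auto

lemma P_w_real:
  assumes "\<sigma> j s \<in> \<real>"
  shows "P (w j s 1) t = Re (\<sigma> j s) *\<^sub>R w j s 1 t"
  using pair[of j s] assms by (simp add: spectral_pair_def complex_is_Real_iff)

text \<open>Multiplying by the conjugate of the first vector and taking imaginary parts leaves
  \<open>y\<close> times the positive Wronskian. A single point \<open>t\<close> suffices.\<close>

lemma independent_pair:
  assumes "\<sigma> j s \<notin> \<real>" "x *\<^sub>R w j s 1 t + y *\<^sub>R vp j s t = 0"
  shows "x = 0 \<and> y = 0"
proof -
  have "cnj (w j s 1 t) * (x *\<^sub>R w j s 1 t + y *\<^sub>R vp j s t) = 0" using assms(2) by simp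
  moreover have "Im (cnj a * (x *\<^sub>R a + y *\<^sub>R b)) = y * Im (cnj a * b)" for a b
    by (simp add: algebra_simps)
  ultimately have "y * Im (cnj (w j s 1 t) * vp j s t) = 0" by (metis zero_complex.simps(2))
  then have y: "y = 0" using pair_pos[OF assms(1), of t] by simp
  have "w j s 1 t \<noteq> 0" using pair_pos[OF assms(1), of t] by auto
  then show ?thesis using assms(2) y by simp
qed

text \<open>For equal exponents a relation at \<open>r = 1\<close> scales to all radii, against the
  independence of the solutions. For distinct ones, applying \<open>P\<close> to the relation
  separates the terms, and neither function has a zero.\<close>

lemma independent_real:
  assumes r: "\<sigma> j True \<in> \<real>" "\<sigma> j False \<in> \<real>" and 0: "\<And>t. x *\<^sub>R w j True 1 t + y *\<^sub>R w j False 1 t = 0"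
  shows "x = 0 \<and> y = 0"
proof (cases "\<sigma> j True = \<sigma> j False")
  case True
  have Im: "Im (\<sigma> j True) = 0" "Im (\<sigma> j False) = 0" using r by (auto simp: complex_is_Real_iff)
  show ?thesis
  proof (rule independent)
    fix r t :: real assume "0 < r"
    then have "of_real x * w j True r t + of_real y * w j False r t
        = (r powr Re (\<sigma> j True)) *\<^sub>R (x *\<^sub>R w j True 1 t + y *\<^sub>R w j False 1 t)"
      using w_formula[of r j True t] w_formula[of r j False t] Im
      by (simp add: True scaleR_conv_of_real algebra_simps)
    then show "of_real x * w j True r t + of_real y * w j False r t = 0" using 0 by simp
  qed
next
  case False
  then have ne: "Re (\<sigma> j True) \<noteq> Re (\<sigma> j False)"
    using r by (auto simp: complex_eq_iff complex_is_Real_iff)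
  have "(\<lambda>t. x *\<^sub>R w j True 1 t + y *\<^sub>R w j False 1 t) = (\<lambda>t. 0)" using 0 by auto
  then have "P (\<lambda>t. x *\<^sub>R w j True 1 t + y *\<^sub>R w j False 1 t) 0 = 0" by (simp add: P_zero)
  then have "x *\<^sub>R P (w j True 1) 0 + y *\<^sub>R P (w j False 1) 0 = 0"
    by (simp only: P_add P_scaleR smooth_circle_scaleR smooth_w)
  then have "Re (\<sigma> j True) *\<^sub>R (x *\<^sub>R w j True 1 0) + Re (\<sigma> j False) *\<^sub>R (y *\<^sub>R w j False 1 0) = 0"
    using r by (simp add: P_w_real mult.commute)
  moreover have "y *\<^sub>R w j False 1 0 = - (x *\<^sub>R w j True 1 0)" using 0[of 0] by (simp add: eq_neg_iff_add_eq_0 add.commute)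
  ultimately have "(Re (\<sigma> j True) - Re (\<sigma> j False)) *\<^sub>R (x *\<^sub>R w j True 1 0) = 0"
    by (simp only: scaleR_diff_left scaleR_minus_right add_uminus_conv_diff)
  then have "x *\<^sub>R w j True 1 0 = 0" using ne by simp
  moreover have nz: "w j s 1 0 \<noteq> 0" if "\<sigma> j s \<in> \<real>" for s
    using winding_real[OF that] by (simp add: has_winding_def)
  ultimately have x: "x = 0" using r by simp
  then show ?thesis using 0[of 0] nz[of False] r by simp
qed

sublocale circle_blocks lam nu c e1 e2 fU fV N M
proof unfold_locales
  fix i j :: int and x y t :: real and s s' :: complex
  show "smooth_circle (fU j)" "smooth_circle (fV j)"
    using smooth_w smooth_vp by (auto simp: fU_def fV_def)
  show "e1 j \<notin> \<real> \<Longrightarrow> e2 j = e1 j \<and> spectral_pair (Re (e1 j)) (Im (e1 j)) (fU j) (fV j)"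
    using pair same_exponent by (auto simp: e1_def e2_def fU_def fV_def mixed_def split: if_splits)
  show "e1 j \<in> \<real> \<Longrightarrow> e2 j \<in> \<real> \<and> (\<forall>t. P (fU j) t = Re (e1 j) *\<^sub>R fU j t \<and> P (fV j) t = Re (e2 j) *\<^sub>R fV j t)"
    using P_w_real by (auto simp: e1_def e2_def fU_def fV_def mixed_def split: if_splits)
  show "(\<And>t. x *\<^sub>R fU j t + y *\<^sub>R fV j t = 0) \<Longrightarrow> x = 0 \<and> y = 0"
  proof -
    assume 0: "\<And>t. x *\<^sub>R fU j t + y *\<^sub>R fV j t = 0"
    consider "mixed j" | "\<sigma> j True \<notin> \<real>" "\<not> mixed j" | "\<sigma> j True \<in> \<real>" "\<sigma> j False \<in> \<real>" "\<not> mixed j"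
      by (auto simp: mixed_def)
    then show "x = 0 \<and> y = 0"
    proof cases
      case 1
      then show ?thesis using 0[of 0] independent_pair[of j False x 0 y]
        by (simp add: fU_def fV_def) (simp add: mixed_def)
    next
      case 2
      then show ?thesis using 0[of 0] independent_pair[of j True x 0 y]
        by (simp add: fU_def fV_def)
    next
      case 3
      then show ?thesis using 0 independent_real[of j x y] by (simp add: fU_def fV_def)
    qed
  qed
  show "i \<noteq> j \<Longrightarrow> s \<in> {e1 i, e2 i} \<Longrightarrow> s' \<in> {e1 j, e2 j} \<Longrightarrow> s \<noteq> s' \<and> s \<noteq> cnj s'"
  proof -
    assume ij: "i \<noteq> j" and s: "s \<in> {e1 i, e2 i}" and s': "s' \<in> {e1 j, e2 j}"
    obtain a where "s = \<sigma> i a" using s e1_in[of i] e2_in[of i] by auto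
    moreover obtain b where "s' = \<sigma> j b" using s' e1_in[of j] e2_in[of j] by auto
    ultimately show ?thesis using exponents_disjoint[OF ij] by simp
  qed
  show "1 \<le> N" by (rule high_N)
  assume j: "N \<le> \<bar>j\<bar>"
  then have nm: "\<not> mixed j" using high_nonreal by (simp add: mixed_def)
  show "norm (fU j t - cis (of_int j * t)) \<le> M / \<bar>of_int j\<bar>"
    using high_w[OF j] nm by (simp add: fU_def)
  show "norm (fV j t - \<i> * cis (of_int j * t)) \<le> M / \<bar>of_int j\<bar>"
    using high_vp[OF j] nm high_nonreal[OF j] by (simp add: fV_def)
  show "norm (e1 j - lam * of_int j) \<le> M" using high_exponent[OF j] nm by (simp add: e1_def)
  show "e1 j \<notin> \<real>" using high_nonreal[OF j] nm by (simp add: e1_def)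
qed

text \<open>In a mixed block the real exponent of \<open>w j True\<close> belongs to no block, so
  \<open>eigenfunction_exponent\<close> makes that slice vanish, although a function with a winding
  number has no zeros.\<close>

lemma not_mixed: "\<not> mixed j"
proof
  assume m: "mixed j"
  then have r: "\<sigma> j True \<in> \<real>" by (simp add: mixed_def)
  then have s: "of_real (Re (\<sigma> j True)) = \<sigma> j True" by (simp add: complex_eq_iff complex_is_Real_iff)
  have ne: "\<sigma> j True \<noteq> e1 i \<and> \<sigma> j True \<noteq> e2 i" for i
  proof (cases "i = j")
    case True
    then show ?thesis using m by (auto simp: e1_def e2_def mixed_def)
  next
    case False
    then show ?thesis using exponents_disjoint(1)[of j i] e1_in[of i] e2_in[of i] by auto
  qed
  have "w j True 1 0 = 0"
    by (rule eigenfunction_exponent[OF smooth_w P_w_real[OF r]]) (use s ne in auto)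
  then show False using winding_real[OF r] by (simp add: has_winding_def)
qed

section \<open>Coefficients with respect to the basic solutions\<close>

lemma Gf_flow_nonreal:
  assumes "\<sigma> j True \<notin> \<real>" "0 < r"
  shows "Gf j (flow r j z) t = (r powr Re (\<sigma> j True)) *\<^sub>R
     (cos (Im (\<sigma> j True) * ln r) *\<^sub>R (Re z *\<^sub>R w j True 1 t + Im z *\<^sub>R vp j True t)
      + sin (Im (\<sigma> j True) * ln r) *\<^sub>R (Re z *\<^sub>R vp j True t - Im z *\<^sub>R w j True 1 t))"
proof -
  have f: "fU j = w j True 1" "fV j = vp j True" "e1 j = \<sigma> j True"
    using assms(1) not_mixed by (auto simp: fU_def fV_def e1_def)
  have "flow r j z = (r powr Re (\<sigma> j True)) *\<^sub>R (cis (Im (\<sigma> j True) * ln r) * z)"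
  proof -
    have "exp (\<sigma> j True * of_real (ln r)) = of_real (r powr Re (\<sigma> j True)) * cis (Im (\<sigma> j True) * ln r)"
      using assms(2) by (subst exp_eq_polar) (simp add: powr_def)
    then show ?thesis
      using assms(1) by (simp only: flow_def act_def f if_False scaleR_conv_of_real mult.assoc)
  qed
  then show ?thesis unfolding Gf_def f by (simp add: algebra_simps)
qed

text \<open>By \<open>spectral_pair_unique\<close> the second solution is the multiple
  \<open>z\<close> of the first in the block coordinate. A real \<open>z\<close> would make them
  dependent over the reals; for high \<open>j\<close> the normalisation makes
  \<open>w j False 1\<close> the partner itself, that is \<open>z = \<i>\<close>.\<close>

lemma coefficients_nonreal:
  assumes s: "\<sigma> j True \<notin> \<real>"
  shows "\<exists>z. Im z \<noteq> 0 \<and> (N \<le> \<bar>j\<bar> \<longrightarrow> z = \<i>) \<and>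
     (\<forall>r t x y. 0 < r \<longrightarrow> of_real x * w j True r t + of_real y * w j False r t
        = Gf j (flow r j (of_real x + of_real y * z)) t)"
proof -
  have s': "\<sigma> j False \<notin> \<real>" and e: "\<sigma> j False = \<sigma> j True" using s same_exponent by auto
  have Im: "Im (\<sigma> j True) \<noteq> 0" using s by (simp add: complex_is_Real_iff)
  have "\<exists>z. z \<noteq> 0 \<and> (\<forall>t. w j False 1 t = Re z *\<^sub>R w j True 1 t + Im z *\<^sub>R vp j True t \<and>
      vp j False t = Re z *\<^sub>R vp j True t - Im z *\<^sub>R w j True 1 t)"
    by (rule spectral_pair_unique[OF pair[of j True] pair[of j False, unfolded e] Im pair_pos[OF s] pair_pos[OF s']])
  then obtain z where z: "\<And>t. w j False 1 t = Re z *\<^sub>R w j True 1 t + Im z *\<^sub>R vp j True t"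
      "\<And>t. vp j False t = Re z *\<^sub>R vp j True t - Im z *\<^sub>R w j True 1 t"
    by blast
  have combine: "of_real x * w j True r t + of_real y * w j False r t
        = Gf j (flow r j (of_real x + of_real y * z)) t" if "0 < r" for r t x y
    unfolding Gf_flow_nonreal[OF s that] w_formula[OF that, of j True] w_formula[OF that, of j False] e z
    by (simp add: scaleR_conv_of_real algebra_simps)
  have "Im z \<noteq> 0"
  proof
    assume "Im z = 0"
    have "of_real (- Re z) * w j True r t + of_real 1 * w j False r t = 0" if "0 < r" for r t
    proof -
      have "of_real (- Re z) + of_real 1 * z = 0" using \<open>Im z = 0\<close> by (simp add: complex_eq_iff)
      then have "of_real (- Re z) * w j True r t + of_real 1 * w j False r t = Gf j (flow r j 0) t"
        unfolding combine[OF that] by simp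
      then show ?thesis by (simp add: Gf_flow_nonreal[OF s that])
    qed
    then show False using independent[of "- Re z" j 1] by simp
  qed
  moreover have "z = \<i>" if "N \<le> \<bar>j\<bar>"
  proof -
    have "Re z *\<^sub>R w j True 1 0 + (Im z - 1) *\<^sub>R vp j True 0 = 0"
      using z(1)[of 0] high_minus[OF that, of 0] by (simp add: algebra_simps)
    from independent_pair[OF s this] show ?thesis by (simp add: complex_eq_iff)
  qed
  ultimately show ?thesis using combine by blast
qed

text \<open>Changing from the block coordinate to the coefficients of \<open>w j True\<close> and
  \<open>w j False\<close> is a real linear map independent of \<open>r\<close>. Recording
  \<open>K = 2\<close> for high \<open>j\<close> leaves only finitely many other values, so a common
  bound exists.\<close>

lemma coefficients:
  "\<exists>K\<ge>0. (N \<le> \<bar>j\<bar> \<longrightarrow> K = 2) \<and> (\<forall>\<zeta>. \<exists>x y. \<forall>r>0.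
     (\<forall>t. of_real x * w j True r t + of_real y * w j False r t = Gf j (flow r j \<zeta>) t) \<and>
     \<bar>x\<bar> * r powr Re (\<sigma> j True) \<le> K * norm (flow r j \<zeta>) \<and>
     \<bar>y\<bar> * r powr Re (\<sigma> j False) \<le> K * norm (flow r j \<zeta>))"
proof (cases "\<sigma> j True \<in> \<real>")
  case True
  then have F: "\<sigma> j False \<in> \<real>" using not_mixed[of j] by (auto simp: mixed_def)
  have f: "fU j = w j True 1" "fV j = w j False 1" "e1 j = \<sigma> j True" "e2 j = \<sigma> j False"
    using not_mixed True by (auto simp: fU_def fV_def e1_def e2_def)
  have low: "\<not> N \<le> \<bar>j\<bar>" using high_nonreal True by blast
  show ?thesis
  proof (rule exI[of _ 1], intro conjI allI)
    fix \<zeta> :: complex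
    show "\<exists>x y. \<forall>r>0. (\<forall>t. of_real x * w j True r t + of_real y * w j False r t = Gf j (flow r j \<zeta>) t) \<and>
       \<bar>x\<bar> * r powr Re (\<sigma> j True) \<le> 1 * norm (flow r j \<zeta>) \<and> \<bar>y\<bar> * r powr Re (\<sigma> j False) \<le> 1 * norm (flow r j \<zeta>)"
    proof (rule exI[of _ "Re \<zeta>"], rule exI[of _ "Im \<zeta>"], intro allI impI conjI)
      fix r t :: real assume r: "0 < r"
      have fl: "flow r j \<zeta> = Complex (r powr Re (\<sigma> j True) * Re \<zeta>) (r powr Re (\<sigma> j False) * Im \<zeta>)"
        using flow_real[of j r \<zeta>] True r by (simp add: f powr_def)
      have Im: "Im (\<sigma> j True) = 0" "Im (\<sigma> j False) = 0" using True F by (auto simp: complex_is_Real_iff)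
      show "of_real (Re \<zeta>) * w j True r t + of_real (Im \<zeta>) * w j False r t = Gf j (flow r j \<zeta>) t"
        using w_formula[OF r, of j True t] w_formula[OF r, of j False t]
        by (simp add: Gf_def fl f Im scaleR_conv_of_real mult_ac)
      show "\<bar>Re \<zeta>\<bar> * r powr Re (\<sigma> j True) \<le> 1 * norm (flow r j \<zeta>)"
        using abs_Re_le_cmod[of "flow r j \<zeta>"] by (simp add: fl abs_mult mult.commute)
      show "\<bar>Im \<zeta>\<bar> * r powr Re (\<sigma> j False) \<le> 1 * norm (flow r j \<zeta>)"
        using abs_Im_le_cmod[of "flow r j \<zeta>"] by (simp add: fl abs_mult mult.commute)
    qed
  qed (use low in auto)
next
  case False
  obtain z where z: "Im z \<noteq> 0" "N \<le> \<bar>j\<bar> \<longrightarrow> z = \<i>"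
     "\<And>r t x y. 0 < r \<Longrightarrow> of_real x * w j True r t + of_real y * w j False r t
        = Gf j (flow r j (of_real x + of_real y * z)) t"
    using coefficients_nonreal[OF False] by blast
  have e: "\<sigma> j False = \<sigma> j True" by (rule same_exponent[OF False])
  \<comment> \<open>It dominates both \<open>1 + \<bar>Re z\<bar> / \<bar>Im z\<bar>\<close>, needed
    for \<open>x\<close>, and \<open>1 / \<bar>Im z\<bar>\<close>, needed for \<open>y\<close>; at
    \<open>z = \<i>\<close> it equals 2.\<close>
  define K where "K = 1 + (1 + \<bar>Re z\<bar>) / \<bar>Im z\<bar>"
  have K0: "0 \<le> K" by (simp add: K_def)
  show ?thesis
  proof (rule exI[of _ K], intro conjI allI)
    fix \<zeta> :: complex
    define y where "y = Im \<zeta> / Im z"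
    define x where "x = Re \<zeta> - y * Re z"
    have xy: "of_real x + of_real y * z = \<zeta>" using z(1) by (simp add: x_def y_def complex_eq_iff)
    have y: "\<bar>y\<bar> \<le> norm \<zeta> / \<bar>Im z\<bar>"
      unfolding y_def abs_divide by (intro divide_right_mono abs_Im_le_cmod) auto
    have "\<bar>x\<bar> \<le> \<bar>Re \<zeta>\<bar> + \<bar>y\<bar> * \<bar>Re z\<bar>" unfolding x_def by (metis abs_mult abs_triangle_ineq4)
    also have "\<dots> \<le> norm \<zeta> + norm \<zeta> / \<bar>Im z\<bar> * \<bar>Re z\<bar>"
      by (intro add_mono mult_right_mono y abs_Re_le_cmod) auto
    also have "\<dots> \<le> K * norm \<zeta>"
      by (simp add: K_def algebra_simps add_divide_distrib)
    finally have x: "\<bar>x\<bar> \<le> K * norm \<zeta>" .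
    have "norm \<zeta> / \<bar>Im z\<bar> \<le> K * norm \<zeta>" by (simp add: K_def algebra_simps add_divide_distrib)
    with y have y': "\<bar>y\<bar> \<le> K * norm \<zeta>" by linarith
    show "\<exists>x y. \<forall>r>0. (\<forall>t. of_real x * w j True r t + of_real y * w j False r t = Gf j (flow r j \<zeta>) t) \<and>
       \<bar>x\<bar> * r powr Re (\<sigma> j True) \<le> K * norm (flow r j \<zeta>) \<and> \<bar>y\<bar> * r powr Re (\<sigma> j False) \<le> K * norm (flow r j \<zeta>)"
    proof (rule exI[of _ x], rule exI[of _ y], intro allI impI conjI)
      fix r t :: real assume r: "0 < r"
      show "of_real x * w j True r t + of_real y * w j False r t = Gf j (flow r j \<zeta>) t"
        using z(3)[OF r, of x t y] xy by simp
      have "norm (flow r j \<zeta>) = r powr Re (\<sigma> j True) * norm \<zeta>"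
        using False r not_mixed[of j] by (simp add: flow_def act_def e1_def norm_mult powr_def)
      then have n: "K * norm (flow r j \<zeta>) = (K * norm \<zeta>) * r powr Re (\<sigma> j True)" by simp
      show "\<bar>x\<bar> * r powr Re (\<sigma> j True) \<le> K * norm (flow r j \<zeta>)"
        unfolding n by (intro mult_right_mono x) simp
      show "\<bar>y\<bar> * r powr Re (\<sigma> j False) \<le> K * norm (flow r j \<zeta>)"
        unfolding n e by (intro mult_right_mono y') simp
    qed
  qed (use K0 z(2) in \<open>auto simp: K_def\<close>)
qed

lemma laurent_expansion:
  "\<exists>C > 0. \<forall>(\<delta> :: real) (R :: ereal) u.
     0 \<le> \<delta> \<and> L_solution lam nu c \<delta> R u \<longrightarrow>
     (\<exists>a :: int \<Rightarrow> bool \<Rightarrow> real.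
        (\<forall>r t. (r, t) \<in> cyl \<delta> R \<longrightarrow>
           ((\<lambda>j. of_real (a j True) * w j True r t + of_real (a j False) * w j False r t)
              has_sum u r t) UNIV) \<and>
        (\<forall>R0. \<delta> < R0 \<and> ereal R0 < R \<longrightarrow>
           (\<forall>j s. \<bar>a j s\<bar> \<le> C / R0 powr Re (\<sigma> j s) * (SUP \<theta>\<in>{0..2*pi}. norm (u R0 \<theta>)))))"
proof -
  obtain B where B: "B > 0" and exp: "\<And>\<delta> R u. 0 \<le> \<delta> \<Longrightarrow> L_solution lam nu c \<delta> R u \<Longrightarrow>
     \<exists>\<zeta>. (\<forall>r t. (r, t) \<in> cyl \<delta> R \<longrightarrow> ((\<lambda>j. Gf j (flow r j (\<zeta> j)) t) has_sum u r t) UNIV) \<and>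
         (\<forall>r j. \<delta> < r \<and> ereal r < R \<longrightarrow> norm (flow r j (\<zeta> j)) \<le> B * (SUP \<theta>\<in>{0..2*pi}. norm (u r \<theta>)))"
    using solution_expansion by blast
  obtain K where K: "\<And>j. 0 \<le> K j" "\<And>j. N \<le> \<bar>j\<bar> \<Longrightarrow> K j = 2"
    and coeff: "\<And>j \<zeta>. \<exists>x y. \<forall>r>0.
     (\<forall>t. of_real x * w j True r t + of_real y * w j False r t = Gf j (flow r j \<zeta>) t) \<and>
     \<bar>x\<bar> * r powr Re (\<sigma> j True) \<le> K j * norm (flow r j \<zeta>) \<and>
     \<bar>y\<bar> * r powr Re (\<sigma> j False) \<le> K j * norm (flow r j \<zeta>)"
    using coefficients by metis
  \<comment> \<open>The value 2 covers the high indices, the finite sum the low ones.\<close>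
  define K' where "K' = 2 + (\<Sum>j | \<bar>j\<bar> < N. K j)"
  have sum0: "0 \<le> (\<Sum>j | \<bar>j\<bar> < N. K j)" by (intro sum_nonneg K)
  have KK': "K j \<le> K'" for j
  proof (cases "\<bar>j\<bar> < N")
    case True
    then have "K j \<le> (\<Sum>j | \<bar>j\<bar> < N. K j)" using finite_low K(1) by (intro member_le_sum) auto
    then show ?thesis by (simp add: K'_def)
  next
    case False
    then show ?thesis using K(2)[of j] sum0 by (simp add: K'_def)
  qed
  have K'0: "0 < K'" using sum0 by (simp add: K'_def)
  show ?thesis
  proof (intro exI[of _ "K' * B"] conjI allI impI)
    show "0 < K' * B" using K'0 B by simp
    fix \<delta> R u assume "0 \<le> \<delta> \<and> L_solution lam nu c \<delta> R u"
    then have \<delta>: "0 \<le> \<delta>" and L: "L_solution lam nu c \<delta> R u" by auto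
    obtain \<zeta> where \<zeta>: "\<And>r t. (r, t) \<in> cyl \<delta> R \<Longrightarrow> ((\<lambda>j. Gf j (flow r j (\<zeta> j)) t) has_sum u r t) UNIV"
      "\<And>r j. \<delta> < r \<Longrightarrow> ereal r < R \<Longrightarrow> norm (flow r j (\<zeta> j)) \<le> B * (SUP \<theta>\<in>{0..2*pi}. norm (u r \<theta>))"
      using exp[OF \<delta> L] by blast
    define Q where "Q j x y \<longleftrightarrow> (\<forall>r>0.
       (\<forall>t. of_real x * w j True r t + of_real y * w j False r t = Gf j (flow r j (\<zeta> j)) t) \<and>
       \<bar>x\<bar> * r powr Re (\<sigma> j True) \<le> K j * norm (flow r j (\<zeta> j)) \<and>
       \<bar>y\<bar> * r powr Re (\<sigma> j False) \<le> K j * norm (flow r j (\<zeta> j)))" for j and x y :: real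
    have "\<forall>j. \<exists>x y. Q j x y" unfolding Q_def using coeff by blast
    then obtain x where "\<forall>j. \<exists>y. Q j (x j) y" by (rule choice[THEN exE])
    then obtain y where "\<forall>j. Q j (x j) (y j)" by (rule choice[THEN exE])
    then have Q: "Q j (x j) (y j)" for j by blast
    have xy: "of_real (x j) * w j True r t + of_real (y j) * w j False r t = Gf j (flow r j (\<zeta> j)) t"
      "\<bar>x j\<bar> * r powr Re (\<sigma> j True) \<le> K j * norm (flow r j (\<zeta> j))"
      "\<bar>y j\<bar> * r powr Re (\<sigma> j False) \<le> K j * norm (flow r j (\<zeta> j))" if "0 < r" for j r t
      using Q[of j] that unfolding Q_def by blast+
    define a where "a j s = (if s then x j else y j)" for j s
    show "\<exists>a :: int \<Rightarrow> bool \<Rightarrow> real.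
        (\<forall>r t. (r, t) \<in> cyl \<delta> R \<longrightarrow>
           ((\<lambda>j. of_real (a j True) * w j True r t + of_real (a j False) * w j False r t)
              has_sum u r t) UNIV) \<and>
        (\<forall>R0. \<delta> < R0 \<and> ereal R0 < R \<longrightarrow>
           (\<forall>j s. \<bar>a j s\<bar> \<le> K' * B / R0 powr Re (\<sigma> j s) * (SUP \<theta>\<in>{0..2*pi}. norm (u R0 \<theta>))))"
    proof (intro exI[of _ a] conjI allI impI)
      fix r t assume rt: "(r, t) \<in> cyl \<delta> R"
      then have "0 < r" using \<delta> by (simp add: cyl_def)
      then show "((\<lambda>j. of_real (a j True) * w j True r t + of_real (a j False) * w j False r t) has_sum u r t) UNIV"
        using \<zeta>(1)[OF rt] by (simp add: a_def xy(1))
    next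
      fix R0 j s assume R0: "\<delta> < R0 \<and> ereal R0 < R"
      then have pos: "0 < R0" using \<delta> by simp
      let ?S = "SUP \<theta>\<in>{0..2*pi}. norm (u R0 \<theta>)"
      have "\<bar>a j s\<bar> * R0 powr Re (\<sigma> j s) \<le> K j * norm (flow R0 j (\<zeta> j))"
        using xy(2,3)[OF pos, of j] by (cases s) (auto simp: a_def)
      also have "\<dots> \<le> K' * (B * ?S)"
        using R0 \<zeta>(2)[of R0 j] KK'[of j] K'0 by (intro mult_mono) auto
      finally show "\<bar>a j s\<bar> \<le> K' * B / R0 powr Re (\<sigma> j s) * ?S"
        using pos by (simp add: field_simps)
    qed
  qed
qed

end

theorem theorem6p2:
  fixes lam :: complex and nu :: real and k :: nat and c :: "real \<Rightarrow> complex"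
    and w :: "int \<Rightarrow> bool \<Rightarrow> real \<Rightarrow> real \<Rightarrow> complex" and \<sigma> :: "int \<Rightarrow> bool \<Rightarrow> complex"
  assumes "0 < Re lam" and "Im lam \<noteq> 0"
    and "0 \<le> nu" and "nu < 1" and "2 \<le> k" and "Ck_circle k c"
    and "basic_family lam nu c w \<sigma>"
  shows "\<exists>C > 0. \<forall>(\<delta> :: real) (R :: ereal) u.
           0 \<le> \<delta> \<and> ereal \<delta> < R \<and> L_solution lam nu c \<delta> R u \<longrightarrow>
           (\<exists>a :: int \<Rightarrow> bool \<Rightarrow> real.
              (\<forall>r t. (r, t) \<in> cyl \<delta> R \<longrightarrow>
                 ((\<lambda>j. of_real (a j True) * w j True r t + of_real (a j False) * w j False r t)
                    has_sum u r t) UNIV) \<and>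
              (\<forall>R0. \<delta> < R0 \<and> ereal R0 < R \<longrightarrow>
                 (\<forall>j s. \<bar>a j s\<bar> \<le> C / R0 powr Re (\<sigma> j s) * (SUP \<theta>\<in>{0..2*pi}. norm (u R0 \<theta>)))))"
proof -
  have c: "periodic2pi c" "continuous_on UNIV c"
  proof -
    show "periodic2pi c" using assms(6) by (simp add: Ck_circle_def)
    obtain D where D: "D 0 = c" "\<forall>i<k. \<forall>t. (D i has_vector_derivative D (Suc i) t) (at t)"
      using assms(6) by (auto simp: Ck_circle_def)
    then have "(c has_vector_derivative D (Suc 0) t) (at t)" for t
      using D(2)[rule_format, of 0 t] assms(5) by simp
    then show "continuous_on UNIV c"
      by (intro continuous_at_imp_continuous_on ballI has_vector_derivative_continuous)
  qed
  interpret circle_operator lam nu c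
    by unfold_locales (use assms c in auto)
  define \<gamma> where "\<gamma> = integral {0..2*pi} (\<lambda>t. (norm (c t))\<^sup>2) / (4 * Re lam * pi)"
  have basic: "basic_solution lam nu c (w j s) (\<sigma> j s) j"
    and indep: "(\<And>r t. 0 < r \<Longrightarrow> of_real x * w j True r t + of_real y * w j False r t = 0) \<Longrightarrow> x = 0 \<and> y = 0"
    and same: "\<sigma> j True \<notin> \<real> \<Longrightarrow> \<sigma> j False = \<sigma> j True" for j s and x y :: real
    using assms(7) unfolding basic_family_def by blast+
  obtain N0 M0 :: real and \<phi> \<psi> :: "int \<Rightarrow> real \<Rightarrow> complex" where high: "\<forall>j. N0 \<le> \<bar>real_of_int j\<bar> \<longrightarrow>
          \<sigma> j False = \<sigma> j True \<and>
          norm (\<sigma> j True - (lam * of_real (of_int j + nu) + of_real (\<gamma> / of_int j))) \<le> M0 / (of_int j)\<^sup>2 \<and>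
          (\<forall>t. norm (\<phi> j t - exp (\<i> * of_int j * of_real t)) \<le> M0 / \<bar>of_int j\<bar>) \<and>
          (\<forall>t. norm (\<psi> j t) \<le> M0 / \<bar>of_int j\<bar>) \<and>
          periodic2pi (\<phi> j) \<and> periodic2pi (\<psi> j) \<and>
          (\<forall>r t. 0 < r \<longrightarrow>
             w j True r t = (of_real r) powr (\<sigma> j True) * \<phi> j t + cnj ((of_real r) powr (\<sigma> j True) * \<psi> j t) \<and>
             w j False r t = \<i> * ((of_real r) powr (\<sigma> j True) * \<phi> j t - cnj ((of_real r) powr (\<sigma> j True) * \<psi> j t)))"
    using assms(7) unfolding basic_family_def Let_def \<gamma>_def[symmetric] by blast
  define Q where "Q j s v \<longleftrightarrow> spectral_pair (Re (\<sigma> j s)) (Im (\<sigma> j s)) (w j s 1) v \<and>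
      (\<forall>r t. 0 < r \<longrightarrow> w j s r t =
       (r powr Re (\<sigma> j s)) *\<^sub>R (cos (Im (\<sigma> j s) * ln r) *\<^sub>R w j s 1 t + sin (Im (\<sigma> j s) * ln r) *\<^sub>R v t)) \<and>
      (\<sigma> j s \<in> \<real> \<longrightarrow> has_winding (w j s 1) j) \<and>
      (\<sigma> j s \<notin> \<real> \<longrightarrow> has_winding (\<lambda>t. w j s 1 t - \<i> * v t) j \<and> (\<forall>t. 0 < Im (cnj (w j s 1 t) * v t)))" for j s v
  have "\<forall>j s. \<exists>v. Q j s v"
    unfolding Q_def using basic_solution_pair[OF basic] by blast
  then obtain vp where Q: "\<And>j s. Q j s (vp j s)" by metis
  have vp: "spectral_pair (Re (\<sigma> j s)) (Im (\<sigma> j s)) (w j s 1) (vp j s)"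
       "0 < r \<Longrightarrow> w j s r t =
       (r powr Re (\<sigma> j s)) *\<^sub>R (cos (Im (\<sigma> j s) * ln r) *\<^sub>R w j s 1 t + sin (Im (\<sigma> j s) * ln r) *\<^sub>R vp j s t)"
       "\<sigma> j s \<in> \<real> \<Longrightarrow> has_winding (w j s 1) j"
       "\<sigma> j s \<notin> \<real> \<Longrightarrow> 0 < Im (cnj (w j s 1 t) * vp j s t)" for j s r t
    using Q[of j s] unfolding Q_def by blast+
  \<comment> \<open>The first two terms bound the lower order terms of the asymptotics once
    \<open>1 \<le> \<bar>j\<bar>\<close>; the last is the shift between
    \<open>lam * (j + nu)\<close> and \<open>lam * j\<close>.\<close>
  define M1 where "M1 = \<bar>\<gamma>\<bar> + \<bar>M0\<bar> + norm lam * nu"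
  \<comment> \<open>Beyond \<open>N\<close> the asymptotics hold, \<open>j\<close> is nonzero, and
    \<open>\<bar>Im lam * j\<bar>\<close> exceeds the error \<open>M1\<close>, so that the exponent
    cannot be real.\<close>
  define N where "N = \<lceil>\<bar>N0\<bar> + M1 / \<bar>Im lam\<bar> + 2\<rceil>"
  have M1: "0 \<le> M1" using assms(3) by (simp add: M1_def)
  have q: "0 \<le> M1 / \<bar>Im lam\<bar>" using M1 by simp
  have NN: "\<bar>N0\<bar> + M1 / \<bar>Im lam\<bar> + 2 \<le> \<bar>real_of_int j\<bar>" if "N \<le> \<bar>j\<bar>" for j
  proof -
    have "\<bar>N0\<bar> + M1 / \<bar>Im lam\<bar> + 2 \<le> of_int N" unfolding N_def by (rule le_of_int_ceiling)
    also have "\<dots> \<le> \<bar>real_of_int j\<bar>" using that by linarith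
    finally show ?thesis .
  qed
  have close: "norm (\<sigma> j True - lam * of_int j) \<le> M1" if "N \<le> \<bar>j\<bar>" for j
  proof -
    have j: "N0 \<le> \<bar>real_of_int j\<bar>" "1 \<le> \<bar>real_of_int j\<bar>" using NN[OF that] q by linarith+
    have h: "norm (\<sigma> j True - (lam * of_real (of_int j + nu) + of_real (\<gamma> / of_int j))) \<le> M0 / (of_int j)\<^sup>2"
      using high j(1) by blast
    have "M0 / (real_of_int j)\<^sup>2 \<le> \<bar>M0\<bar> / (real_of_int j)\<^sup>2" by (intro divide_right_mono) auto
    also have "\<dots> \<le> \<bar>M0\<bar> / 1"
      using j(2) abs_le_square_iff[of 1 "real_of_int j"] by (intro divide_left_mono) auto
    finally have m: "M0 / (real_of_int j)\<^sup>2 \<le> \<bar>M0\<bar>" by simp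
    have "\<bar>\<gamma>\<bar> / \<bar>real_of_int j\<bar> \<le> \<bar>\<gamma>\<bar> / 1" using j(2) by (intro divide_left_mono) auto
    then have g: "norm (complex_of_real (\<gamma> / of_int j)) \<le> \<bar>\<gamma>\<bar>" by (simp only: norm_of_real abs_divide div_by_1)
    have "\<sigma> j True - lam * of_int j = (\<sigma> j True - (lam * of_real (of_int j + nu) + of_real (\<gamma> / of_int j)))
        + of_real (\<gamma> / of_int j) + lam * of_real nu"
      by (simp add: algebra_simps)
    also have "norm \<dots> \<le> norm (\<sigma> j True - (lam * of_real (of_int j + nu) + of_real (\<gamma> / of_int j)))
        + norm (complex_of_real (\<gamma> / of_int j)) + norm (lam * of_real nu)"
      by (intro order_trans[OF norm_triangle_ineq] add_right_mono norm_triangle_ineq)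
    also have "norm (lam * of_real nu) = norm lam * nu" using assms(3) by (simp add: norm_mult)
    finally show ?thesis using h m g unfolding M1_def by linarith
  qed
  have nonreal: "\<sigma> j True \<notin> \<real>" if "N \<le> \<bar>j\<bar>" for j
  proof
    assume "\<sigma> j True \<in> \<real>"
    then have "\<bar>Im lam * of_int j\<bar> \<le> M1"
      using close[OF that] abs_Im_le_cmod[of "\<sigma> j True - lam * of_int j"] by (simp add: complex_is_Real_iff)
    then have "\<bar>Im lam\<bar> * \<bar>of_int j\<bar> \<le> M1" by (simp add: abs_mult)
    then have "\<bar>real_of_int j\<bar> \<le> M1 / \<bar>Im lam\<bar>"
      using assms(2) by (simp add: field_simps)
    then show False using NN[OF that] by linarith
  qed
  have uv: "w j True 1 t = \<phi> j t + cnj (\<psi> j t)" "vp j True t = \<i> * (\<phi> j t - cnj (\<psi> j t))"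
    "w j False 1 t = \<i> * (\<phi> j t - cnj (\<psi> j t))" if "N \<le> \<bar>j\<bar>" for j t
  proof -
    have j: "N0 \<le> \<bar>real_of_int j\<bar>" using NN[OF that] q by linarith
    have wT: "w j True r t = (of_real r) powr (\<sigma> j True) * \<phi> j t + cnj ((of_real r) powr (\<sigma> j True) * \<psi> j t)"
      and wF: "w j False r t = \<i> * ((of_real r) powr (\<sigma> j True) * \<phi> j t - cnj ((of_real r) powr (\<sigma> j True) * \<psi> j t))"
      if "0 < r" for r
      using high j that by blast+
    show "w j True 1 t = \<phi> j t + cnj (\<psi> j t)" "w j False 1 t = \<i> * (\<phi> j t - cnj (\<psi> j t))"
      using wT[of 1] wF[of 1] by simp_all
    have Im: "Im (\<sigma> j True) \<noteq> 0" using nonreal[OF that] by (simp add: complex_is_Real_iff)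
    \<comment> \<open>At this radius \<open>r powr \<sigma>\<close> is \<open>\<i>\<close> times a
      positive number, and comparing the two formulas for \<open>w j True\<close> yields the partner
      \<open>vp\<close> in terms of \<open>\<phi>\<close> and \<open>\<psi>\<close>.\<close>
    define r where "r = exp (pi / (2 * Im (\<sigma> j True)))"
    have r: "0 < r" "Im (\<sigma> j True) * ln r = pi / 2" using Im by (auto simp: r_def)
    have "(of_real r :: complex) powr \<sigma> j True = of_real (r powr Re (\<sigma> j True)) * \<i>"
      unfolding of_real_powr_polar[OF r(1)] r(2) by simp
    then have "w j True r t = (r powr Re (\<sigma> j True)) *\<^sub>R (\<i> * \<phi> j t + cnj (\<i> * \<psi> j t))"
      unfolding wT[OF r(1)] by (simp add: scaleR_conv_of_real algebra_simps)
    moreover have "w j True r t = (r powr Re (\<sigma> j True)) *\<^sub>R vp j True t"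
      using vp(2)[OF r(1), of j True t] unfolding r(2) by simp
    ultimately have "(r powr Re (\<sigma> j True)) *\<^sub>R vp j True t
        = (r powr Re (\<sigma> j True)) *\<^sub>R (\<i> * \<phi> j t + cnj (\<i> * \<psi> j t))"
      by (simp only:)
    then have "vp j True t = \<i> * \<phi> j t + cnj (\<i> * \<psi> j t)"
      using r(1) by simp
    then show "vp j True t = \<i> * (\<phi> j t - cnj (\<psi> j t))"
      by (simp add: algebra_simps)
  qed
  \<comment> \<open>The errors of \<open>\<phi>\<close> and \<open>\<psi>\<close> add up to
    \<open>2 * M0\<close>; \<open>M1\<close> is included because the same constant must also bound
    the deviation of the exponents.\<close>
  have wclose: "norm (\<phi> j t + cnj (\<psi> j t) - cis (of_int j * t)) \<le> (M1 + 2 * \<bar>M0\<bar>) / \<bar>of_int j\<bar>"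
    "norm (\<i> * (\<phi> j t - cnj (\<psi> j t)) - \<i> * cis (of_int j * t)) \<le> (M1 + 2 * \<bar>M0\<bar>) / \<bar>of_int j\<bar>" if "N \<le> \<bar>j\<bar>" for j t
  proof -
    have j: "N0 \<le> \<bar>real_of_int j\<bar>" using NN[OF that] q by linarith
    have 1: "norm (\<phi> j t - cis (of_int j * t)) \<le> M0 / \<bar>of_int j\<bar>" "norm (cnj (\<psi> j t)) \<le> M0 / \<bar>of_int j\<bar>"
      using high j by (auto simp: cis_conv_exp mult.assoc)
    have "2 * M0 / \<bar>real_of_int j\<bar> \<le> (M1 + 2 * \<bar>M0\<bar>) / \<bar>of_int j\<bar>"
      using M1 by (intro divide_right_mono) auto
    then have 2: "norm (\<phi> j t - cis (of_int j * t)) + norm (cnj (\<psi> j t)) \<le> (M1 + 2 * \<bar>M0\<bar>) / \<bar>of_int j\<bar>"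
      using 1 by simp
    have "\<phi> j t + cnj (\<psi> j t) - cis (of_int j * t) = (\<phi> j t - cis (of_int j * t)) + cnj (\<psi> j t)" by simp
    then show "norm (\<phi> j t + cnj (\<psi> j t) - cis (of_int j * t)) \<le> (M1 + 2 * \<bar>M0\<bar>) / \<bar>of_int j\<bar>"
      using norm_triangle_ineq[of "\<phi> j t - cis (of_int j * t)" "cnj (\<psi> j t)"] 2 by (simp only:)
    have "\<i> * (\<phi> j t - cnj (\<psi> j t)) - \<i> * cis (of_int j * t) = \<i> * ((\<phi> j t - cis (of_int j * t)) - cnj (\<psi> j t))"
      by (simp add: algebra_simps)
    then have "norm (\<i> * (\<phi> j t - cnj (\<psi> j t)) - \<i> * cis (of_int j * t)) = norm ((\<phi> j t - cis (of_int j * t)) - cnj (\<psi> j t))"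
      by (simp only: norm_mult norm_ii mult_1)
    then show "norm (\<i> * (\<phi> j t - cnj (\<psi> j t)) - \<i> * cis (of_int j * t)) \<le> (M1 + 2 * \<bar>M0\<bar>) / \<bar>of_int j\<bar>"
      using norm_triangle_ineq4[of "\<phi> j t - cis (of_int j * t)" "cnj (\<psi> j t)"] 2 by linarith
  qed
  interpret circle_family lam nu c w \<sigma> vp N "M1 + 2 * \<bar>M0\<bar>"
  proof
    fix j t and s :: bool and r x y :: real
    show "basic_solution lam nu c (w j s) (\<sigma> j s) j" by (rule basic)
    show "(\<And>r t. 0 < r \<Longrightarrow> of_real x * w j True r t + of_real y * w j False r t = 0) \<Longrightarrow> x = 0 \<and> y = 0"
      by (rule indep)
    show "\<sigma> j True \<notin> \<real> \<Longrightarrow> \<sigma> j False = \<sigma> j True" by (rule same)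
    show "spectral_pair (Re (\<sigma> j s)) (Im (\<sigma> j s)) (w j s 1) (vp j s)" by (rule vp)
    show "0 < r \<Longrightarrow> w j s r t =
       (r powr Re (\<sigma> j s)) *\<^sub>R (cos (Im (\<sigma> j s) * ln r) *\<^sub>R w j s 1 t + sin (Im (\<sigma> j s) * ln r) *\<^sub>R vp j s t)"
      by (rule vp)
    show "\<sigma> j s \<in> \<real> \<Longrightarrow> has_winding (w j s 1) j" by (rule vp)
    show "\<sigma> j s \<notin> \<real> \<Longrightarrow> 0 < Im (cnj (w j s 1 t) * vp j s t)" by (rule vp)
    have "(1::real) \<le> of_int N" unfolding N_def using q le_of_int_ceiling[of "\<bar>N0\<bar> + M1 / \<bar>Im lam\<bar> + 2"] by linarith
    then show "1 \<le> N" by linarith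
    assume j: "N \<le> \<bar>j\<bar>"
    show "\<sigma> j True \<notin> \<real>" by (rule nonreal[OF j])
    show "norm (\<sigma> j True - lam * of_int j) \<le> M1 + 2 * \<bar>M0\<bar>" using close[OF j] by simp
    show "norm (w j True 1 t - cis (of_int j * t)) \<le> (M1 + 2 * \<bar>M0\<bar>) / \<bar>of_int j\<bar>"
      unfolding uv[OF j] by (rule wclose[OF j])
    show "norm (vp j True t - \<i> * cis (of_int j * t)) \<le> (M1 + 2 * \<bar>M0\<bar>) / \<bar>of_int j\<bar>"
      unfolding uv[OF j] by (rule wclose[OF j])
    show "w j False 1 t = vp j True t" unfolding uv[OF j] by (rule refl)
  qed
  show ?thesis using laurent_expansion by blast
qed

end
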